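(* For any non-decreasing sequence of positive real numbers $\{\Omega(n)\}_{n\geq 0}$ tending to $+\infty$ and satisfying $$\sup_{n> 1} \frac{\Omega(n)}{\log n} = +\infty,$$ there exists a compact set $E\subset\mathbb{T}$ of positive Lebesgue measure such that: (i) For any non-trivial measure $\mu \in M(E)$ we have $$\sum_{n\in \mathbb{Z}} |\widehat{\mu}(n)|^2 \Omega(|n|) =+\infty.$$ (ii) There exists a non-trivial $\mu \in M(E)$ with $$\widehat{\mu}(n) = \mathcal{O}\left(n^{-M}\right), \qquad n\to +\infty,$$ for any $M>0$.
   Context: $\mathbb{T}$ is the unit circle. $M(E)$ denotes the set of finite complex Borel measures on $\mathbb{T}$ supported on $E$, and $\widehat\mu(n)=\int_{\mathbb{T}}\zeta^{-n}d\mu(\zeta)$, $n\in\mathbb{Z}$. *)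

theory Defs
  imports "HOL-Analysis.Analysis" "HOL-Library.Landau_Symbols"
begin

text \<open>A complex measure is a countably additive set function on the sigma-algebra of \<open>M\<close>; its
  values outside \<open>sets M\<close> are irrelevant. Finiteness is automatic, as its values are complex numbers.\<close>

definition complex_measure :: "'a measure \<Rightarrow> ('a set \<Rightarrow> complex) \<Rightarrow> bool" where
  "complex_measure M \<mu> \<longleftrightarrow>
     \<mu> {} = 0 \<and>
     (\<forall>A :: nat \<Rightarrow> 'a set. range A \<subseteq> sets M \<longrightarrow> disjoint_family A \<longrightarrow>
        (\<lambda>i. \<mu> (A i)) sums \<mu> (\<Union>i. A i))"

text \<open>The positive part in the Jordan decomposition of a real signed measure \<open>\<nu>\<close>, namely
  \<open>\<nu>\<^sup>+(A) = sup {\<nu>(B) | B \<subseteq> A}\<close>; the negative part is the positive part of \<open>-\<nu>\<close>. The map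
  \<open>ennreal\<close> truncates negative values to 0, which does not affect the supremum because
  \<open>B = {}\<close> is admissible.\<close>

definition positive_variation :: "'a measure \<Rightarrow> ('a set \<Rightarrow> real) \<Rightarrow> 'a measure" where
  "positive_variation M \<nu> =
     measure_of (space M) (sets M) (\<lambda>A. SUP B\<in>{B\<in>sets M. B \<subseteq> A}. ennreal (\<nu> B))"

definition signed_integral ::
    "'a measure \<Rightarrow> ('a set \<Rightarrow> real) \<Rightarrow> ('a \<Rightarrow> complex) \<Rightarrow> complex" where
  "signed_integral M \<nu> f =
     integral\<^sup>L (positive_variation M \<nu>) f - integral\<^sup>L (positive_variation M (\<lambda>A. - \<nu> A)) f"

definition complex_measure_integral ::
    "'a measure \<Rightarrow> ('a set \<Rightarrow> complex) \<Rightarrow> ('a \<Rightarrow> complex) \<Rightarrow> complex" where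
  "complex_measure_integral M \<mu> f =
     signed_integral M (\<lambda>A. Re (\<mu> A)) f + \<i> * signed_integral M (\<lambda>A. Im (\<mu> A)) f"

abbreviation unit_circle :: "complex set" where
  "unit_circle \<equiv> sphere 0 1"

definition circle_borel :: "complex measure" where
  "circle_borel = restrict_space borel unit_circle"

text \<open>Lebesgue measure on the circle, normalised to total mass 1.\<close>

definition circle_lebesgue :: "complex measure" where
  "circle_lebesgue = distr (uniform_measure lborel {0..<2 * pi}) circle_borel cis"

text \<open>The space \<open>M(E)\<close>. The support condition says that the total variation of the measure vanishes
  on the complement of \<open>E\<close>, i.e. that every Borel subset of the complement is a null set.\<close>

definition circle_measures_on :: "complex set \<Rightarrow> (complex set \<Rightarrow> complex) set" where
  "circle_measures_on E =
     {\<mu>. complex_measure circle_borel \<mu> \<and>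
         (\<forall>A\<in>sets circle_borel. A \<inter> E = {} \<longrightarrow> \<mu> A = 0)}"

definition nontrivial_circle_measure :: "(complex set \<Rightarrow> complex) \<Rightarrow> bool" where
  "nontrivial_circle_measure \<mu> \<longleftrightarrow> (\<exists>A\<in>sets circle_borel. \<mu> A \<noteq> 0)"

definition fourier_coeff :: "(complex set \<Rightarrow> complex) \<Rightarrow> int \<Rightarrow> complex" where
  "fourier_coeff \<mu> n = complex_measure_integral circle_borel \<mu> (\<lambda>\<zeta>. \<zeta> powi (- n))"

end

theory Submission
  imports Defs "HOL-Complex_Analysis.Complex_Analysis"
begin

text \<open>The function \<open>h(t) = exp (- \<kappa> / (1 + \<kappa>/L - e\<^sup>-\<^sup>i\<^sup>t))\<close> has no positive frequencies, has modulus
  at most 1 and mean close to 1, and is at most \<open>e\<^sup>-\<^sup>L\<^sup>/\<^sup>2\<close> on an arc of length about \<open>\<kappa>/L\<close> around 0.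
  A smooth cutoff turns it into a function \<open>f\<close> that vanishes on that arc and whose positive
  coefficients are \<open>O(L\<^sup>p e\<^sup>-\<^sup>L\<^sup>/\<^sup>2)\<close>. The set \<open>E\<close> omits, for each \<open>k\<close>, the arcs on which \<open>f\<^sub>k(N\<^sub>k t)\<close>
  vanishes, where \<open>L\<^sub>k\<close> is a multiple of \<open>k log N\<^sub>k\<close> and \<open>N\<^sub>k\<close> is sparse.

  For (ii) take the density \<open>\<Prod>\<^sub>k f\<^sub>k(N\<^sub>k t)\<close>: multiplying a smooth partial product by the next factor
  changes its \<open>n\<close>-th coefficient, \<open>n > 0\<close>, by a factor of modulus at most 1 and an error
  \<open>2\<^sup>-\<^sup>k n\<^sup>-\<^sup>k\<close>, since all other terms contain either a coefficient of the partial product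
  at a frequency beyond \<open>N\<^sub>k\<close> or one of the tiny positive coefficients of \<open>f\<^sub>k\<close>. The mean of the density stays close to 1, so \<open>E\<close> is not a null set.

  For (i) pair \<open>\<mu>\<close> with a bump supported in the gaps of stage \<open>k\<close>, with coefficients \<open>c\<^sub>m\<close>. As \<open>\<mu>\<close> lives
  on \<open>E\<close>, \<open>c\<^sub>0 \<mu>^(j) = - \<Sum>\<^sub>m\<^sub>\<noteq>\<^sub>0 c\<^sub>m \<mu>^(j - m N\<^sub>k)\<close>, and by Cauchy-Schwarz and
  \<open>\<Sum> |c\<^sub>m|\<^sup>2 \<le> c\<^sub>0\<close> a finite weighted sum \<open>S\<close> forces \<open>|\<mu>^(j)|\<^sup>2 \<le> S / (c\<^sub>0 \<Omega>(N\<^sub>k/2))\<close>. Up to a constant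
  depending on \<open>k\<close>, \<open>c\<^sub>0\<close> is at least \<open>1 / log N\<^sub>k\<close>, so the growth hypothesis lets the right-hand side tend to 0.\<close>

section \<open>Jordan decomposition\<close>

text \<open>A modulus can be made small on a set at a price measured by its logarithm only: the mean
  of log |h| is -\<kappa>/(1 + \<kappa>/L), spent as depth L/2 on arcs of relative length of order
  \<kappa>/L. Depth times length is thus about \<kappa>, and fast decreasing \<kappa> keep the mean
  of the product away from 0. The weight N^k in front of the positive coefficients has to be beaten
  by exp(-L/2), which puts L, and with it the reciprocal of the gap length, at the scale log N. This
  is why log n is compared with \<Omega>: part (i) needs the gap length times \<Omega>(N/2) to be
  unbounded. The argument N/2 appears because |j| <= N/2 keeps every j - mN with m nonzero at
  distance at least N/2 from 0. Decay in (ii) is one-sided of necessity: for polynomially bounded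
  \<Omega>, rapid decay on both sides would contradict (i). Finally, N and L are selected after the
  partial product is known, so all constants in the estimates must be uniform in N and L; this is
  the reason for working with families of functions indexed by L.\<close>

definition signed_measure :: "'a measure \<Rightarrow> ('a set \<Rightarrow> real) \<Rightarrow> bool" where
  "signed_measure M \<nu> \<longleftrightarrow> \<nu> {} = 0 \<and>
     (\<forall>A :: nat \<Rightarrow> 'a set. range A \<subseteq> sets M \<longrightarrow> disjoint_family A \<longrightarrow>
        (\<lambda>i. \<nu> (A i)) sums \<nu> (\<Union>i. A i))"

lemma complex_measure_Re: "complex_measure M \<mu> \<Longrightarrow> signed_measure M (\<lambda>A. Re (\<mu> A))"
  unfolding complex_measure_def signed_measure_def by (auto intro: sums_Re)

lemma complex_measure_Im: "complex_measure M \<mu> \<Longrightarrow> signed_measure M (\<lambda>A. Im (\<mu> A))"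
  unfolding complex_measure_def signed_measure_def by (auto intro: sums_Im)

lemma signed_measure_minus: "signed_measure M \<nu> \<Longrightarrow> signed_measure M (\<lambda>A. - \<nu> A)"
  unfolding signed_measure_def by (auto intro: sums_minus)

lemma signed_measure_Un:
  assumes "signed_measure M \<nu>" "A \<in> sets M" "B \<in> sets M" "A \<inter> B = {}"
  shows "\<nu> (A \<union> B) = \<nu> A + \<nu> B"
proof -
  have "(\<lambda>i. \<nu> (binaryset A B i)) sums \<nu> (\<Union>i. binaryset A B i)"
  proof -
    have "range (binaryset A B) \<subseteq> sets M" "disjoint_family (binaryset A B)"
      using assms by (auto simp: binaryset_def disjoint_family_on_def)
    then show ?thesis using assms(1) unfolding signed_measure_def by blast
  qed
  moreover have "(\<lambda>i. \<nu> (binaryset A B i)) sums (\<nu> A + \<nu> B)"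
    using assms(1) by (intro binaryset_sums) (auto simp: signed_measure_def)
  ultimately show ?thesis by (simp add: UN_binaryset_eq sums_unique2)
qed

lemma signed_measure_Diff:
  assumes "signed_measure M \<nu>" "A \<in> sets M" "B \<in> sets M" "B \<subseteq> A"
  shows "\<nu> (A - B) = \<nu> A - \<nu> B"
  using signed_measure_Un[OF assms(1) assms(3), of "A - B"] assms
  by (simp add: Un_absorb1)

text \<open>If \<open>\<nu>\<close> were unbounded, one could split off infinitely many disjoint sets of absolute
  \<open>\<nu>\<close>-value at least 1 while keeping an unbounded remainder.\<close>

lemma signed_measure_bounded:
  assumes \<nu>: "signed_measure M \<nu>"
  obtains C where "\<And>A. A \<in> sets M \<Longrightarrow> \<bar>\<nu> A\<bar> \<le> C"
proof (rule ccontr)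
  assume contr: "\<not> thesis"
  define unb where "unb E \<longleftrightarrow> E \<in> sets M \<and> (\<forall>C. \<exists>B\<in>sets M. B \<subseteq> E \<and> \<bar>\<nu> B\<bar> > C)" for E
  have start: "unb (space M)"
    unfolding unb_def
  proof (intro conjI allI)
    fix C show "\<exists>B\<in>sets M. B \<subseteq> space M \<and> C < \<bar>\<nu> B\<bar>"
    proof (rule ccontr)
      assume "\<not> ?thesis"
      then have "\<bar>\<nu> A\<bar> \<le> C" if "A \<in> sets M" for A
        using sets.sets_into_space[OF that] that by (meson not_less)
      with that contr show False by blast
    qed
  qed simp
  have step: "\<exists>E'. unb E' \<and> E' \<subseteq> E \<and> \<bar>\<nu> (E - E')\<bar> \<ge> 1" if E: "unb E" for E
  proof -
    \<comment> \<open>Since |\<nu> A| > 1 + |\<nu> E|, both A and E - A have absolute value at least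
      1. Whichever of the two stays unbounded, the piece split off is large enough.\<close>
    obtain A where A: "A \<in> sets M" "A \<subseteq> E" "\<bar>\<nu> A\<bar> > 1 + \<bar>\<nu> E\<bar>" using E unfolding unb_def by blast
    have Es: "E \<in> sets M" using E unb_def by blast
    have d: "\<nu> (E - A) = \<nu> E - \<nu> A" using signed_measure_Diff[OF \<nu> Es A(1,2)] .
    have "unb A \<or> unb (E - A)"
    proof (rule ccontr)
      assume n: "\<not> ?thesis"
      obtain C1 where C1: "\<And>B. B \<in> sets M \<Longrightarrow> B \<subseteq> A \<Longrightarrow> \<bar>\<nu> B\<bar> \<le> C1"
        using n A(1) unfolding unb_def by (meson not_less)
      obtain C2 where C2: "\<And>B. B \<in> sets M \<Longrightarrow> B \<subseteq> E - A \<Longrightarrow> \<bar>\<nu> B\<bar> \<le> C2"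
        using n A(1) Es unfolding unb_def by (meson not_less sets.Diff)
      obtain B where B: "B \<in> sets M" "B \<subseteq> E" "\<bar>\<nu> B\<bar> > C1 + C2" using E unfolding unb_def by blast
      have "\<nu> ((B \<inter> A) \<union> (B - A)) = \<nu> (B \<inter> A) + \<nu> (B - A)"
        by (rule signed_measure_Un[OF \<nu>]) (use A B in auto)
      then have "\<nu> B = \<nu> (B \<inter> A) + \<nu> (B - A)" by (simp add: Un_Diff_Int Un_commute)
      moreover have "\<bar>\<nu> (B \<inter> A)\<bar> \<le> C1" "\<bar>\<nu> (B - A)\<bar> \<le> C2" using A B by (auto intro!: C1 C2)
      ultimately show False using B(3) by linarith
    qed
    then show ?thesis
    proof
      assume "unb A" then show ?thesis using A d by (intro exI[of _ A]) auto
    next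
      assume "unb (E - A)"
      moreover have "E - (E - A) = A" using A by auto
      ultimately show ?thesis using A by (intro exI[of _ "E - A"]) auto
    qed
  qed
  have "\<exists>E. \<forall>n. unb (E n) \<and> (E (Suc n) \<subseteq> E n \<and> \<bar>\<nu> (E n - E (Suc n))\<bar> \<ge> 1)"
  proof (rule dependent_nat_choice)
    show "\<exists>x. unb x" using start by blast
    show "\<And>x n. unb x \<Longrightarrow> \<exists>y. unb y \<and> y \<subseteq> x \<and> \<bar>\<nu> (x - y)\<bar> \<ge> 1" by (rule step)
  qed
  then obtain E where E: "\<And>n. unb (E n)" "\<And>n. E (Suc n) \<subseteq> E n \<and> \<bar>\<nu> (E n - E (Suc n))\<bar> \<ge> 1"
    by blast
  have dec: "E n \<subseteq> E m" if "m \<le> n" for m n using E(2) lift_Suc_antimono_le[of E, OF _ that] by blast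
  have "disjoint_family (\<lambda>n. E n - E (Suc n))"
    unfolding disjoint_family_on_def
  proof (intro ballI impI)
    have *: "(E m - E (Suc m)) \<inter> (E n - E (Suc n)) = {}" if "m < n" for m n
      using dec[of "Suc m" n] that by auto
    show "(E m - E (Suc m)) \<inter> (E n - E (Suc n)) = {}" if "m \<noteq> n" for m n
      using that *[of m n] *[of n m] by (metis Int_commute nat_neq_iff)
  qed
  moreover have "range (\<lambda>n. E n - E (Suc n)) \<subseteq> sets M" using E(1) unb_def by auto
  ultimately have "summable (\<lambda>n. \<nu> (E n - E (Suc n)))"
    using \<nu> unfolding signed_measure_def by (blast intro: sums_summable)
  then have "(\<lambda>n. \<nu> (E n - E (Suc n))) \<longlonglongrightarrow> 0" by (rule summable_LIMSEQ_zero)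
  then have "\<forall>\<^sub>F n in sequentially. \<bar>\<nu> (E n - E (Suc n))\<bar> < 1"
    using order_tendstoD(2)[OF tendsto_rabs_zero, of _ _ 1] by simp
  then obtain n where "\<bar>\<nu> (E n - E (Suc n))\<bar> < 1" unfolding eventually_sequentially by blast
  then show False using E(2)[of n] by linarith
qed

text \<open>The supremum inside \<open>positive_variation\<close>, taken in the reals so that it can
  be subtracted; boundedness of \<nu> makes it meaningful.\<close>

definition upper_variation :: "'a measure \<Rightarrow> ('a set \<Rightarrow> real) \<Rightarrow> 'a set \<Rightarrow> real" where
  "upper_variation M \<nu> A = (SUP B\<in>{B\<in>sets M. B \<subseteq> A}. \<nu> B)"

context
  fixes M :: "'a measure" and \<nu>
  assumes \<nu>: "signed_measure M \<nu>"
begin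

lemma upper_variation_ge:
  assumes "B \<in> sets M" "B \<subseteq> A" shows "\<nu> B \<le> upper_variation M \<nu> A"
proof -
  obtain C where "\<And>A. A \<in> sets M \<Longrightarrow> \<bar>\<nu> A\<bar> \<le> C" using signed_measure_bounded[OF \<nu>] by blast
  then have "bdd_above (\<nu> ` {B\<in>sets M. B \<subseteq> A})" by (intro bdd_aboveI[of _ C]) fastforce
  then show ?thesis unfolding upper_variation_def using assms by (intro cSUP_upper) auto
qed

lemma upper_variation_le:
  assumes "\<And>B. B \<in> sets M \<Longrightarrow> B \<subseteq> A \<Longrightarrow> \<nu> B \<le> c" shows "upper_variation M \<nu> A \<le> c"
  unfolding upper_variation_def using assms by (intro cSUP_least) auto

lemma upper_variation_nonneg: "0 \<le> upper_variation M \<nu> A"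
  using upper_variation_ge[of "{}" A] \<nu> by (simp add: signed_measure_def)

lemma upper_variation_mono: "A \<subseteq> A' \<Longrightarrow> upper_variation M \<nu> A \<le> upper_variation M \<nu> A'"
  by (intro upper_variation_le upper_variation_ge) auto

lemma upper_variation_superadd:
  assumes "A \<inter> A' = {}"
  shows "upper_variation M \<nu> A + upper_variation M \<nu> A' \<le> upper_variation M \<nu> (A \<union> A')"
proof -
  have "\<nu> B \<le> upper_variation M \<nu> (A \<union> A') - upper_variation M \<nu> A'" if "B \<in> sets M" "B \<subseteq> A" for B
  proof -
    have "upper_variation M \<nu> A' \<le> upper_variation M \<nu> (A \<union> A') - \<nu> B"
    proof (rule upper_variation_le)
      fix B' assume B': "B' \<in> sets M" "B' \<subseteq> A'"
      have "\<nu> (B \<union> B') = \<nu> B + \<nu> B'" by (rule signed_measure_Un[OF \<nu>]) (use that B' assms in auto)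
      moreover have "\<nu> (B \<union> B') \<le> upper_variation M \<nu> (A \<union> A')"
        by (rule upper_variation_ge) (use that B' in auto)
      ultimately show "\<nu> B' \<le> upper_variation M \<nu> (A \<union> A') - \<nu> B" by simp
    qed
    then show ?thesis by simp
  qed
  then have "upper_variation M \<nu> A \<le> upper_variation M \<nu> (A \<union> A') - upper_variation M \<nu> A'"
    by (intro upper_variation_le)
  then show ?thesis by simp
qed

lemma SUP_ennreal_eq_upper_variation:
  "(SUP B\<in>{B\<in>sets M. B \<subseteq> A}. ennreal (\<nu> B)) = ennreal (upper_variation M \<nu> A)"
proof (rule antisym)
  let ?s = "SUP B\<in>{B\<in>sets M. B \<subseteq> A}. ennreal (\<nu> B)"
  show le: "?s \<le> ennreal (upper_variation M \<nu> A)"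
    by (intro SUP_least ennreal_leI upper_variation_ge) auto
  then have "?s < top" using le_less_trans ennreal_less_top by blast
  then obtain s where s: "?s = ennreal s" "s \<ge> 0" by (cases ?s) auto
  have "\<nu> B \<le> s" if "B \<in> sets M" "B \<subseteq> A" for B
  proof -
    have "ennreal (\<nu> B) \<le> ?s" using that by (intro SUP_upper) auto
    then show ?thesis using s by (simp add: ennreal_le_iff)
  qed
  then show "ennreal (upper_variation M \<nu> A) \<le> ?s"
    unfolding s(1) by (intro ennreal_leI upper_variation_le)
qed

text \<open>One inequality is superadditivity on finite unions. For the other, a set B in the union
  is cut into the pieces \<open>B \<inter> A i\<close>, and countable additivity of \<nu> is applied
  to them.\<close>

lemma countably_additive_upper_variation:
  "countably_additive (sets M) (\<lambda>A. ennreal (upper_variation M \<nu> A))"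
proof (rule countably_additiveI)
  fix A :: "nat \<Rightarrow> 'a set"
  assume A: "range A \<subseteq> sets M" "disjoint_family A" "(\<Union>i. A i) \<in> sets M"
  let ?V = "upper_variation M \<nu>"
  have fin: "(\<Sum>i<n. ?V (A i)) \<le> ?V (\<Union>i<n. A i)" for n
  proof (induction n)
    case 0 show ?case using upper_variation_nonneg by simp
  next
    case (Suc n)
    have "A i \<inter> A n = {}" if "i < n" for i using disjoint_family_onD[OF A(2), of i n] that by simp
    then have "(\<Union>i<n. A i) \<inter> A n = {}" by auto
    from upper_variation_superadd[OF this] Suc show ?case by (simp add: lessThan_Suc Un_commute)
  qed
  have fin': "(\<Sum>i<n. ?V (A i)) \<le> ?V (\<Union>i. A i)" for n
    by (rule order_trans[OF fin upper_variation_mono]) auto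
  have summ: "summable (\<lambda>i. ?V (A i))"
    by (rule summableI_nonneg_bounded[OF upper_variation_nonneg fin'])
  have "(\<Sum>i. ?V (A i)) = ?V (\<Union>i. A i)"
  proof (rule antisym)
    show "(\<Sum>i. ?V (A i)) \<le> ?V (\<Union>i. A i)" by (rule suminf_le_const[OF summ fin'])
    show "?V (\<Union>i. A i) \<le> (\<Sum>i. ?V (A i))"
    proof (rule upper_variation_le)
      fix B assume B: "B \<in> sets M" "B \<subseteq> (\<Union>i. A i)"
      have "(\<lambda>i. \<nu> (B \<inter> A i)) sums \<nu> (\<Union>i. B \<inter> A i)"
      proof -
        have "range (\<lambda>i. B \<inter> A i) \<subseteq> sets M" using A(1) B(1) by auto
        moreover have "disjoint_family (\<lambda>i. B \<inter> A i)"
          using disjoint_family_onD[OF A(2)] by (simp add: disjoint_family_on_def) blast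
        ultimately show ?thesis using \<nu> unfolding signed_measure_def by blast
      qed
      moreover have "(\<Union>i. B \<inter> A i) = B" using B by auto
      ultimately have s: "(\<lambda>i. \<nu> (B \<inter> A i)) sums \<nu> B" by simp
      then have "\<nu> B = (\<Sum>i. \<nu> (B \<inter> A i))" by (simp add: sums_unique)
      also have "\<dots> \<le> (\<Sum>i. ?V (A i))"
        using A B by (intro suminf_le sums_summable[OF s] summ upper_variation_ge) auto
      finally show "\<nu> B \<le> (\<Sum>i. ?V (A i))" .
    qed
  qed
  then show "(\<Sum>i. ennreal (?V (A i))) = ennreal (?V (\<Union>i. A i))"
    using suminf_ennreal2[OF upper_variation_nonneg summ] by simp
qed

lemma sets_positive_variation [simp]: "sets (positive_variation M \<nu>) = sets M"
  unfolding positive_variation_def by (simp add: sets.space_closed)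

lemma space_positive_variation [simp]: "space (positive_variation M \<nu>) = space M"
  by (rule sets_eq_imp_space_eq) simp

lemma emeasure_positive_variation:
  assumes "A \<in> sets M"
  shows "emeasure (positive_variation M \<nu>) A = ennreal (upper_variation M \<nu> A)"
proof -
  have "upper_variation M \<nu> {} = 0"
    using \<nu> upper_variation_nonneg[of "{}"] upper_variation_le[of "{}" 0]
    by (simp add: signed_measure_def)
  then have "positive (sets M) (\<lambda>A. ennreal (upper_variation M \<nu> A))" by (simp add: positive_def)
  then show ?thesis
    unfolding positive_variation_def SUP_ennreal_eq_upper_variation
    using countably_additive_upper_variation assms
    by (intro emeasure_measure_of_sigma) (auto simp: sets.sigma_algebra_axioms)
qed

lemma measure_positive_variation:
  "A \<in> sets M \<Longrightarrow> measure (positive_variation M \<nu>) A = upper_variation M \<nu> A"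
  by (simp add: measure_def emeasure_positive_variation upper_variation_nonneg)

lemma finite_measure_positive_variation: "finite_measure (positive_variation M \<nu>)"
  by (rule finite_measureI) (simp add: emeasure_positive_variation)

end

text \<open>For B inside A, \<nu> B = \<nu> A - \<nu> (A - B), and the last term is at most the
  upper variation of -\<nu>. The same argument for -\<nu> gives the reverse inequality.\<close>

lemma Jordan_decomposition:
  assumes "signed_measure M \<nu>" "A \<in> sets M"
  shows "\<nu> A = measure (positive_variation M \<nu>) A - measure (positive_variation M (\<lambda>A. - \<nu> A)) A"
proof -
  have *: "upper_variation M \<nu> A \<le> \<nu> A + upper_variation M (\<lambda>A. - \<nu> A) A"
    if "signed_measure M \<nu>" for \<nu>
  proof (rule upper_variation_le[OF that])
    fix B assume B: "B \<in> sets M" "B \<subseteq> A"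
    have "- \<nu> (A - B) \<le> upper_variation M (\<lambda>A. - \<nu> A) A"
      using upper_variation_ge[OF signed_measure_minus[OF that], of "A - B" A] B assms by auto
    then show "\<nu> B \<le> \<nu> A + upper_variation M (\<lambda>A. - \<nu> A) A"
      using signed_measure_Diff[OF that assms(2) B] by simp
  qed
  from *[OF assms(1)] *[OF signed_measure_minus[OF assms(1)]] show ?thesis
    using assms signed_measure_minus[OF assms(1)] by (simp add: measure_positive_variation)
qed

text \<open>The relation p - q = \<alpha> - \<beta>, written with sums because
  \<open>ennreal\<close> has no proper subtraction; in this form it passes through the induction on
  measurable functions.\<close>

lemma nn_integral_add_measures_eq:
  assumes sets: "sets p = sets M" "sets q = sets M" "sets \<alpha> = sets M" "sets \<beta> = sets M"
    and eq: "\<And>A. A \<in> sets M \<Longrightarrow> emeasure p A + emeasure \<beta> A = emeasure q A + emeasure \<alpha> A"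
    and f: "f \<in> borel_measurable M"
  shows "(\<integral>\<^sup>+x. f x \<partial>p) + (\<integral>\<^sup>+x. f x \<partial>\<beta>) = (\<integral>\<^sup>+x. f x \<partial>q) + (\<integral>\<^sup>+x. f x \<partial>\<alpha>)"
  using f
proof (induction rule: borel_measurable_induct)
  case (cong f g)
  have sp: "space p = space M" "space q = space M" "space \<alpha> = space M" "space \<beta> = space M"
    using sets[THEN sets_eq_imp_space_eq] by simp_all
  have "(\<integral>\<^sup>+x. f x \<partial>X) = (\<integral>\<^sup>+x. g x \<partial>X)" if "space X = space M" for X
    using cong that by (intro nn_integral_cong) auto
  then show ?case using cong sp by simp
next
  case (set A)
  then show ?case using eq sets by simp
next
  case (mult u c)
  have [measurable]: "u \<in> borel_measurable p" "u \<in> borel_measurable q" "u \<in> borel_measurable \<alpha>" "u \<in> borel_measurable \<beta>"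
    using mult sets by (simp_all cong: measurable_cong_sets)
  show ?case using mult by (simp add: nn_integral_cmult flip: distrib_left)
next
  case (add u v)
  have [measurable]: "u \<in> borel_measurable p" "u \<in> borel_measurable q" "u \<in> borel_measurable \<alpha>" "u \<in> borel_measurable \<beta>"
    "v \<in> borel_measurable p" "v \<in> borel_measurable q" "v \<in> borel_measurable \<alpha>" "v \<in> borel_measurable \<beta>"
    using add sets by (simp_all cong: measurable_cong_sets)
  show ?case using add by (simp add: nn_integral_add) (metis (no_types, lifting) add.assoc add.left_commute)
next
  case (seq V)
  have m: "V i \<in> borel_measurable p" "V i \<in> borel_measurable q" "V i \<in> borel_measurable \<alpha>" "V i \<in> borel_measurable \<beta>" for i
    using seq sets by (simp_all cong: measurable_cong_sets)
  have inc: "incseq (\<lambda>i. \<integral>\<^sup>+x. V i x \<partial>X)" for X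
    using seq by (intro incseq_SucI nn_integral_mono) (auto simp: incseq_Suc_iff le_fun_def)
  have S: "(\<integral>\<^sup>+x. Sup (range V) x \<partial>X) = (SUP i. \<integral>\<^sup>+x. V i x \<partial>X)" if "\<And>i. V i \<in> borel_measurable X" for X
    unfolding SUP_apply using seq that by (intro nn_integral_monotone_convergence_SUP)
  show ?case unfolding S[OF m(1)] S[OF m(2)] S[OF m(3)] S[OF m(4)]
    using seq inc by (simp flip: ennreal_SUP_add)
qed

lemma integral_add_measures_eq:
  fixes f :: "'a \<Rightarrow> complex"
  assumes sets: "sets p = sets M" "sets q = sets M" "sets \<alpha> = sets M" "sets \<beta> = sets M"
    and fin: "finite_measure p" "finite_measure q" "finite_measure \<alpha>" "finite_measure \<beta>"
    and eq: "\<And>A. A \<in> sets M \<Longrightarrow> measure p A + measure \<beta> A = measure q A + measure \<alpha> A"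
    and f: "f \<in> borel_measurable M" "\<And>x. norm (f x) \<le> C"
  shows "(\<integral>x. f x \<partial>p) + (\<integral>x. f x \<partial>\<beta>) = (\<integral>x. f x \<partial>q) + (\<integral>x. f x \<partial>\<alpha>)"
proof -
  have sp: "space p = space M" "space q = space M" "space \<alpha> = space M" "space \<beta> = space M"
    using sets[THEN sets_eq_imp_space_eq] by simp_all
  have int: "integrable X g" if "sets X = sets M" "finite_measure X" "g \<in> borel_measurable M" "\<And>x. norm (g x) \<le> D"
    for X D and g :: "'a \<Rightarrow> 'b::{banach, second_countable_topology}"
    using that by (intro finite_measure.integrable_const_bound[where B=D]) (auto cong: measurable_cong_sets)
  have eq': "emeasure p A + emeasure \<beta> A = emeasure q A + emeasure \<alpha> A" if "A \<in> sets M" for A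
    using eq[OF that] fin by (simp add: finite_measure.emeasure_eq_measure flip: ennreal_plus)
  have pos: "(\<integral>x. g x \<partial>p) + (\<integral>x. g x \<partial>\<beta>) = (\<integral>x. g x \<partial>q) + (\<integral>x. g x \<partial>\<alpha>)"
    if g: "g \<in> borel_measurable M" "\<And>x. norm (g x) \<le> D" "\<And>x. 0 \<le> g x" for g :: "'a \<Rightarrow> real" and D
  proof -
    have *: "(\<integral>\<^sup>+x. ennreal (g x) \<partial>X) = ennreal (\<integral>x. g x \<partial>X)" if "sets X = sets M" "finite_measure X" for X
      using int[OF that g(1,2)] g(3) by (intro nn_integral_eq_integral) auto
    have "ennreal ((\<integral>x. g x \<partial>p) + (\<integral>x. g x \<partial>\<beta>)) = ennreal ((\<integral>x. g x \<partial>q) + (\<integral>x. g x \<partial>\<alpha>))"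
      using nn_integral_add_measures_eq[OF sets eq', of "\<lambda>x. ennreal (g x)"] g
      by (simp add: * sets fin)
    then show ?thesis using g(3) by (subst (asm) ennreal_inj) (auto intro!: add_nonneg_nonneg)
  qed
  have real: "(\<integral>x. g x \<partial>p) + (\<integral>x. g x \<partial>\<beta>) = (\<integral>x. g x \<partial>q) + (\<integral>x. g x \<partial>\<alpha>)"
    if g: "g \<in> borel_measurable M" "\<And>x. norm (g x) \<le> D" for g :: "'a \<Rightarrow> real" and D
  proof -
    \<comment> \<open>Adding the bound D makes g nonnegative and changes both sides of the claim by
      the same multiple of the total masses.\<close>
    have i: "(\<integral>x. g x + D \<partial>X) = (\<integral>x. g x \<partial>X) + D * measure X (space M)"
      if "sets X = sets M" "finite_measure X" for X
      using int[OF that g] that sets_eq_imp_space_eq[OF that(1)]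
      by (simp add: finite_measure.integrable_const)
    have a: "0 \<le> g x + D" "norm (g x + D) \<le> 2 * D" for x
      using g(2)[of x] by (auto simp: abs_le_iff)
    have "D * measure p (space M) + D * measure \<beta> (space M) = D * measure q (space M) + D * measure \<alpha> (space M)"
      using eq[OF sets.top] by (metis distrib_left)
    then show ?thesis
      using pos[of "\<lambda>x. g x + D" "2 * D"] a g(1) by (simp add: i sets fin)
  qed
  have D: "\<bar>Re (f x)\<bar> \<le> C" "\<bar>Im (f x)\<bar> \<le> C" for x
    using f(2)[of x] abs_Re_le_cmod[of "f x"] abs_Im_le_cmod[of "f x"] by linarith+
  show ?thesis
    using real[of "\<lambda>x. Re (f x)" C] real[of "\<lambda>x. Im (f x)" C] f D
    by (intro complex_eqI) (simp_all add: int[OF sets(1) fin(1) f] int[OF sets(2) fin(2) f] int[OF sets(3) fin(3) f] int[OF sets(4) fin(4) f])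
qed

text \<open>Any representation of \<nu> as a difference of finite measures yields the integral, not
  only the Jordan one. Measures given by densities are integrated in this way.\<close>

lemma signed_integral_eqI:
  fixes f :: "'a \<Rightarrow> complex"
  assumes \<nu>: "signed_measure M \<nu>"
    and sets: "sets \<alpha> = sets M" "sets \<beta> = sets M"
    and fin: "finite_measure \<alpha>" "finite_measure \<beta>"
    and eq: "\<And>A. A \<in> sets M \<Longrightarrow> \<nu> A = measure \<alpha> A - measure \<beta> A"
    and f: "f \<in> borel_measurable M" "\<And>x. norm (f x) \<le> C"
  shows "signed_integral M \<nu> f = (\<integral>x. f x \<partial>\<alpha>) - (\<integral>x. f x \<partial>\<beta>)"
proof -
  have "(\<integral>x. f x \<partial>positive_variation M \<nu>) + (\<integral>x. f x \<partial>\<beta>) =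
      (\<integral>x. f x \<partial>positive_variation M (\<lambda>A. - \<nu> A)) + (\<integral>x. f x \<partial>\<alpha>)"
    using Jordan_decomposition[OF \<nu>] eq signed_measure_minus[OF \<nu>] \<nu> sets fin f
    by (intro integral_add_measures_eq[where M=M and C=C])
      (fastforce simp: finite_measure_positive_variation)+
  then show ?thesis unfolding signed_integral_def by (simp add: algebra_simps)
qed

section \<open>Fourier coefficients of periodic functions\<close>

abbreviation angle_measure :: "real measure" where
  "angle_measure \<equiv> uniform_measure lborel {0..<2 * pi}"

lemma finite_measure_angle: "finite_measure angle_measure"
  by (rule finite_measureI) (simp add: ennreal_divide_self flip: ennreal_zero_less_mult_iff)

lemma measure_angle_UNIV: "measure angle_measure UNIV = 1"
proof -
  have "measure angle_measure UNIV = measure lborel ({0..<2*pi} \<inter> UNIV) / measure lborel {0..<2*pi::real}"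
    by (rule measure_uniform_measure) auto
  then show ?thesis by simp
qed

lemma angle_measure_eq_density:
  "angle_measure = density lborel (\<lambda>x. ennreal (indicator {0..<2*pi} x / (2*pi)))"
proof -
  have "indicator {0..<2*pi} x / emeasure lborel {0..<2*pi} = ennreal (indicator {0..<2*pi} x / (2*pi))" for x :: real
    by (cases "x \<in> {0..<2*pi}") (simp_all add: divide_ennreal[symmetric] ennreal_1[symmetric] del: ennreal_1)
  then show ?thesis unfolding uniform_measure_def by simp
qed

lemma integrable_angle:
  fixes f :: "real \<Rightarrow> 'b::{banach, second_countable_topology}"
  assumes "f \<in> borel_measurable borel" "\<And>x. norm (f x) \<le> C"
  shows "integrable angle_measure f"
  using assms by (intro finite_measure.integrable_const_bound[OF finite_measure_angle, where B=C]) auto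

lemma norm_integral_finite_measure_le:
  fixes f :: "'a \<Rightarrow> 'b::{banach, second_countable_topology}"
  assumes M: "finite_measure M" and f: "f \<in> borel_measurable M" "\<And>x. norm (f x) \<le> C"
  shows "norm (LINT t|M. f t) \<le> C * measure M (space M)"
proof -
  have i: "integrable M f"
    by (rule finite_measure.integrable_const_bound[OF M, where B=C]) (use f in auto)
  have "norm (LINT t|M. f t) \<le> (LINT t|M. norm (f t))" by (rule integral_norm_bound)
  also have "\<dots> \<le> (LINT t|M. C)"
    by (rule integral_mono[OF integrable_norm[OF i] finite_measure.integrable_const[OF M] f(2)])
  finally show ?thesis by (simp add: mult.commute)
qed

lemma integral_angle_le:
  fixes f :: "real \<Rightarrow> 'b::{banach, second_countable_topology}"
  assumes "f \<in> borel_measurable borel" "\<And>x. norm (f x) \<le> C"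
  shows "norm (LINT t|angle_measure. f t) \<le> C"
  using norm_integral_finite_measure_le[OF finite_measure_angle, of f C] assms
  by (simp add: measure_angle_UNIV)

lemma integral_angle_eq:
  fixes f :: "real \<Rightarrow> 'b::euclidean_space"
  assumes "continuous_on UNIV f"
  shows "(LINT t|angle_measure. f t) = (1 / (2*pi)) *\<^sub>R integral {0..2*pi} f"
proof -
  have [measurable]: "f \<in> borel_measurable borel" using assms by (rule borel_measurable_continuous_onI)
  have "(LINT t|angle_measure. f t) = (LINT t|lborel. (indicator {0..<2*pi} t / (2*pi)) *\<^sub>R f t)"
    unfolding angle_measure_eq_density by (subst integral_density) auto
  also have "\<dots> = (LINT t|lborel. (1 / (2*pi)) *\<^sub>R (indicator {0..<2*pi} t *\<^sub>R f t))"
    by (intro Bochner_Integration.integral_cong) auto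
  also have "\<dots> = (1 / (2*pi)) *\<^sub>R (LINT t|lborel. indicator {0..<2*pi} t *\<^sub>R f t)"
    by (rule integral_scaleR_right)
  also have "(LINT t|lborel. indicator {0..<2*pi} t *\<^sub>R f t) = (LINT t|lborel. indicator {0..2*pi} t *\<^sub>R f t)"
  proof (rule integral_cong_AE)
    have "AE t in lborel. t \<noteq> 2*pi" by (rule AE_lborel_singleton)
    then show "AE t in lborel. indicator {0..<2*pi} t *\<^sub>R f t = indicator {0..2*pi} t *\<^sub>R f t"
      by eventually_elim (auto simp: indicator_def)
  qed auto
  also have "\<dots> = integral {0..2*pi} f"
    using set_borel_integral_eq_integral(2)[OF borel_integrable_atLeastAtMost'[of 0 "2*pi" f]] assms
      continuous_on_subset by (fastforce simp: set_lebesgue_integral_def)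
  finally show ?thesis .
qed

lemma integral_angle_deriv_eq_0:
  fixes F :: "real \<Rightarrow> complex"
  assumes "\<And>t. (F has_vector_derivative f t) (at t)" "continuous_on UNIV f" "F (2*pi) = F 0"
  shows "(LINT t|angle_measure. f t) = 0"
proof -
  have "(f has_integral F (2*pi) - F 0) {0..2*pi}"
    using assms(1) by (intro fundamental_theorem_of_calculus) (auto intro: has_vector_derivative_at_within)
  then show ?thesis using assms by (simp add: integral_angle_eq integral_unique)
qed

lemma has_vector_derivative_cis:
  "((\<lambda>t. cis (a * t)) has_vector_derivative (\<i> * of_real a * cis (a * t))) (at t)"
proof -
  have "((\<lambda>t. exp (\<i> * (of_real a * of_real t))) has_vector_derivative (\<i> * of_real a * exp (\<i> * (of_real a * of_real t)))) (at t)"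
    by (auto intro!: derivative_eq_intros has_vector_derivative_real_field simp: mult_ac)
  then show ?thesis by (simp add: cis_conv_exp)
qed

lemma cis_int_periodic [simp]: "cis (of_int n * (t + 2*pi)) = cis (of_int n * t)"
proof -
  have "cis (of_int n * (t + 2*pi)) = cis (of_int n * t) * cis (2 * pi * of_int n)"
    by (simp add: cis_mult algebra_simps)
  then show ?thesis by simp
qed

lemma integral_cis:
  "(LINT t|angle_measure. cis (of_int n * t)) = (if n = 0 then 1 else 0)"
proof (cases "n = 0")
  case True then show ?thesis by (simp add: measure_angle_UNIV)
next
  case False
  have "((\<lambda>t. cis (of_int n * t) / (\<i> * of_int n)) has_vector_derivative cis (of_int n * t)) (at t)" for t
    using has_vector_derivative_divide[OF has_vector_derivative_cis[of "of_int n" t], of "\<i> * of_int n"] False by simp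
  from integral_angle_deriv_eq_0[OF this] cis_int_periodic[of n 0] False show ?thesis
    by (simp add: continuous_intros)
qed

section \<open>Continuous periodic functions and their Fourier coefficients\<close>

definition periodic_cont :: "(real \<Rightarrow> complex) \<Rightarrow> bool" where
  "periodic_cont f \<longleftrightarrow> continuous_on UNIV f \<and> (\<forall>t. f (t + 2*pi) = f t)"

lemma periodic_cont_mult: "periodic_cont f \<Longrightarrow> periodic_cont g \<Longrightarrow> periodic_cont (\<lambda>t. f t * g t)"
  and periodic_cont_add: "periodic_cont f \<Longrightarrow> periodic_cont g \<Longrightarrow> periodic_cont (\<lambda>t. f t + g t)"
  and periodic_cont_diff: "periodic_cont f \<Longrightarrow> periodic_cont g \<Longrightarrow> periodic_cont (\<lambda>t. f t - g t)"
  and periodic_cont_cnj: "periodic_cont f \<Longrightarrow> periodic_cont (\<lambda>t. cnj (f t))"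
  and periodic_cont_const: "periodic_cont (\<lambda>t. c)"
  and periodic_cont_cis: "periodic_cont (\<lambda>t. cis (of_int n * t))"
  by (auto simp: periodic_cont_def intro!: continuous_intros)

lemma periodic_add_nat:
  assumes "\<And>t. f (t + 2*pi) = f t" shows "f (t + 2*pi * real N) = f t"
proof (induction N)
  case (Suc N)
  have "f (t + 2*pi * real (Suc N)) = f ((t + 2*pi * real N) + 2*pi)" by (simp add: algebra_simps)
  then show ?case using Suc assms by simp
qed simp

lemma periodic_add_int:
  assumes "\<And>t. f (t + 2*pi) = f t" shows "f (t + 2*pi * of_int k) = f t"
proof (cases "k \<ge> 0")
  case True
  then show ?thesis using periodic_add_nat[of f t "nat k"] assms by simp
next
  case False
  then show ?thesis using periodic_add_nat[of f "t + 2*pi * of_int k" "nat (-k)"] assms by simp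
qed

lemma periodic_cis_cong:
  assumes "\<And>t. f (t + 2*pi) = f t" "cis s = cis t" shows "f s = f t"
proof -
  have "cis (t - s) = 1" using assms(2) by (simp flip: cis_divide)
  then have "cos (t - s) = 1" by (simp add: complex_eq_iff)
  then obtain k :: int where "t - s = of_int k * 2 * pi" using cos_one_2pi_int by blast
  then have "t = s + 2*pi * of_int k" by (simp add: algebra_simps)
  then show ?thesis using periodic_add_int[of f s k] assms(1) by simp
qed

lemma periodic_representative:
  fixes f :: "real \<Rightarrow> 'b"
  assumes "\<And>t. f (t + 2*pi) = f t" obtains s where "s \<in> {0..2*pi}" "f s = f t"
proof -
  define k where "k = \<lfloor>t / (2*pi)\<rfloor>"
  have "of_int k \<le> t / (2*pi)" "t / (2*pi) < of_int k + 1" unfolding k_def by linarith+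
  then have "t - 2*pi * of_int k \<in> {0..2*pi}" by (simp add: field_simps)
  moreover have "f (t - 2*pi * of_int k) = f t"
    using periodic_add_int[of f "t - 2*pi * of_int k" k] assms by simp
  ultimately show ?thesis using that by blast
qed

lemma periodic_cont_scale:
  assumes "periodic_cont f" shows "periodic_cont (\<lambda>t. f (real N * t))"
proof -
  have "f (real N * (t + 2*pi)) = f (real N * t)" for t
    using periodic_add_nat[of f "real N * t" N] assms unfolding periodic_cont_def
    by (simp add: algebra_simps)
  moreover have "continuous_on UNIV (\<lambda>t. f (real N * t))"
  proof (rule continuous_on_compose2[of UNIV f])
    show "continuous_on UNIV f" using assms by (simp add: periodic_cont_def)
    show "continuous_on UNIV (\<lambda>t. real N * t)" by (intro continuous_intros)
  qed simp
  ultimately show ?thesis unfolding periodic_cont_def by simp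
qed

lemma periodic_cont_bounded:
  assumes "periodic_cont f" obtains C where "C \<ge> 0" "\<And>t. norm (f t) \<le> C"
proof -
  have "compact (f ` {0..2*pi})"
    using assms unfolding periodic_cont_def
    by (intro compact_continuous_image) (auto intro: continuous_on_subset)
  then have "bounded (f ` {0..2*pi})" by (rule compact_imp_bounded)
  then obtain C where "\<forall>y\<in>f ` {0..2*pi}. norm y \<le> C" unfolding bounded_iff by blast
  then have C: "norm (f t) \<le> C" if "t \<in> {0..2*pi}" for t using that by simp
  have "norm (f t) \<le> C" for t
  proof -
    have "\<And>t. f (t + 2*pi) = f t" using assms unfolding periodic_cont_def by blast
    then obtain s where "s \<in> {0..2*pi}" "f s = f t" by (rule periodic_representative)
    then show ?thesis using C[of s] by simp
  qed
  moreover have "C \<ge> 0" using order_trans[OF norm_ge_zero C[of 0]] by simp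
  ultimately show ?thesis using that by blast
qed

lemma periodic_cont_measurable: "periodic_cont f \<Longrightarrow> f \<in> borel_measurable borel"
  unfolding periodic_cont_def by (auto intro: borel_measurable_continuous_onI)

lemma integrable_periodic_cont: "periodic_cont f \<Longrightarrow> integrable angle_measure f"
  by (rule periodic_cont_bounded, assumption, rule integrable_angle[OF periodic_cont_measurable])

definition fc :: "(real \<Rightarrow> complex) \<Rightarrow> int \<Rightarrow> complex" where
  "fc f n = (LINT t|angle_measure. f t * cis (- (of_int n * t)))"

text \<open>Here the frequency is an integer multiple inside \<open>cis\<close>, the shape expected
  by \<open>periodic_cont_cis\<close> and \<open>integral_cis\<close>.\<close>

lemma fc_altdef: "fc f n = (LINT t|angle_measure. f t * cis (of_int (- n) * t))"
  by (simp add: fc_def)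

lemma norm_fc_le:
  assumes "f \<in> borel_measurable borel" "\<And>x. norm (f x) \<le> C"
  shows "norm (fc f n) \<le> C"
proof -
  have [measurable]: "(\<lambda>t. cis (- (of_int n * t))) \<in> borel_measurable borel"
    by (intro borel_measurable_continuous_onI continuous_intros)
  show ?thesis unfolding fc_def using assms by (intro integral_angle_le) (auto simp: norm_mult)
qed

lemma fc_diff: "periodic_cont f \<Longrightarrow> periodic_cont g \<Longrightarrow> fc (\<lambda>t. f t - g t) n = fc f n - fc g n"
  unfolding fc_altdef
  by (simp add: left_diff_distrib integrable_periodic_cont periodic_cont_mult periodic_cont_cis del: of_int_minus)

lemma fc_deriv:
  assumes "periodic_cont f" "periodic_cont f'" "\<And>t. (f has_vector_derivative f' t) (at t)"
  shows "fc f' n = \<i> * of_int n * fc f n"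
proof -
  let ?e = "\<lambda>t. cis (of_int (- n) * t)"
  have d: "((\<lambda>t. f t * ?e t) has_vector_derivative (f t * (\<i> * of_int (-n) * ?e t) + f' t * ?e t)) (at t)" for t
    using has_vector_derivative_mult[OF assms(3) has_vector_derivative_cis[of "of_int (-n)" t]] by simp
  have p: "periodic_cont (\<lambda>t. f t * (\<i> * of_int (-n) * ?e t))" "periodic_cont (\<lambda>t. f' t * ?e t)"
    "periodic_cont (\<lambda>t. f t * ?e t)"
    by (intro periodic_cont_mult periodic_cont_const periodic_cont_cis assms)+
  have "f (0 + 2*pi) * ?e (0 + 2*pi) = f 0 * ?e 0"
    using p(3) unfolding periodic_cont_def by blast
  then have "f (2*pi) * ?e (2*pi) = f 0 * ?e 0" by (simp only: add_0)
  then have "0 = (LINT t|angle_measure. f t * (\<i> * of_int (-n) * ?e t) + f' t * ?e t)"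
    using periodic_cont_add[OF p(1,2)]
    unfolding periodic_cont_def by (intro integral_angle_deriv_eq_0[OF d, symmetric]) blast+
  also have "\<dots> = (LINT t|angle_measure. f t * (\<i> * of_int (-n) * ?e t)) + fc f' n"
    unfolding fc_altdef by (intro Bochner_Integration.integral_add integrable_periodic_cont p)
  also have "(LINT t|angle_measure. f t * (\<i> * of_int (-n) * ?e t)) = (\<i> * of_int (-n)) * fc f n"
    unfolding fc_altdef integral_mult_right_zero[symmetric] by (intro Bochner_Integration.integral_cong) auto
  finally show ?thesis by (simp add: algebra_simps)
qed

text \<open>Fubini with the counting measure on the integers. The measure is general because the
  lemma serves both the angle measure and the positive measures that make up \<mu>.\<close>

lemma integral_infsum:
  fixes a :: "int \<Rightarrow> complex"
  assumes M: "finite_measure M" and a: "(\<lambda>n. norm (a n)) summable_on UNIV"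
    and g: "\<And>n. g n \<in> borel_measurable M" "\<And>n x. norm (g n x) \<le> C"
  shows "(LINT x|M. (\<Sum>\<^sub>\<infinity>n. a n * g n x)) = (\<Sum>\<^sub>\<infinity>n. a n * (LINT x|M. g n x))"
proof -
  interpret finite_measure M by fact
  interpret C: sigma_finite_measure "count_space (UNIV :: int set)"
    by (rule sigma_finite_measure_count_space)
  interpret P: pair_sigma_finite "count_space (UNIV :: int set)" M ..
  have C: "C \<ge> 0" using order_trans[OF norm_ge_zero g(2)] .
  have as: "(\<lambda>n. norm (a n) * C) summable_on UNIV" using a by (rule summable_on_cmult_left)
  have s1: "(\<lambda>n. norm (a n * g n x)) summable_on UNIV" for x
    by (rule summable_on_comparison_test[OF as]) (auto simp: norm_mult intro!: mult_left_mono g)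
  have n2: "norm (LINT x|M. g n x) \<le> C * measure M (space M)" for n
    by (rule norm_integral_finite_measure_le[OF M g])
  have as2: "(\<lambda>n. norm (a n) * (C * measure M (space M))) summable_on UNIV" using a by (rule summable_on_cmult_left)
  have s2: "(\<lambda>n. norm (a n * (LINT x|M. g n x))) summable_on UNIV"
    by (rule summable_on_comparison_test[OF as2]) (auto simp: norm_mult intro!: mult_left_mono n2)
  have e1: "(\<Sum>\<^sub>\<infinity>n. a n * g n x) = (LINT n|count_space UNIV. a n * g n x)" for x
    using infsetsum_infsum[of "\<lambda>n. a n * g n x" UNIV] s1[of x]
    by (simp add: abs_summable_equivalent[symmetric] infsetsum_def)
  have e2: "(\<Sum>\<^sub>\<infinity>n. a n * (LINT x|M. g n x)) = (LINT n|count_space UNIV. a n * (LINT x|M. g n x))"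
    using infsetsum_infsum[of "\<lambda>n. a n * (LINT x|M. g n x)" UNIV] s2
    by (simp add: abs_summable_equivalent[symmetric] infsetsum_def)
  have ia: "integrable (count_space UNIV) (\<lambda>n. norm (a n) * C)"
  proof -
    have "integrable (count_space UNIV) a"
      using a by (simp add: abs_summable_on_def[symmetric] abs_summable_equivalent[symmetric])
    then show ?thesis by (intro integrable_mult_left integrable_norm)
  qed
  have meas: "(\<lambda>(n, x). a n * g n x) \<in> borel_measurable (count_space UNIV \<Otimes>\<^sub>M M)"
    by (intro measurable_pair_measure_countable1) (use g in auto)
  have "integrable (count_space UNIV \<Otimes>\<^sub>M M) (\<lambda>(n, x). a n * g n x)"
  proof (rule P.Fubini_integrable[OF meas])
    show "integrable (count_space UNIV) (\<lambda>n. LINT x|M. norm (case (n, x) of (n, x) \<Rightarrow> a n * g n x))"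
    proof (rule Bochner_Integration.integrable_bound)
      show "integrable (count_space UNIV) (\<lambda>n. (norm (a n) * C) * measure M (space M))"
        using ia by (rule integrable_mult_left)
      have "(LINT x|M. norm (a n * g n x)) \<le> norm (a n) * C * measure M (space M)" for n
      proof -
        have "(LINT x|M. norm (a n * g n x)) \<le> (LINT x|M. norm (a n) * C)"
          using g by (intro integral_mono integrable_const_bound[where B="norm (a n) * C"] integrable_const)
            (auto simp: norm_mult intro!: mult_left_mono)
        then show ?thesis by (simp add: mult_ac)
      qed
      then show "AE n in count_space UNIV. norm (LINT x|M. norm (case (n, x) of (n, x) \<Rightarrow> a n * g n x))
          \<le> norm (norm (a n) * C * measure M (space M))"
        using C by (auto simp: AE_count_space abs_mult)
    qed simp
    show "AE n in count_space UNIV. integrable M (\<lambda>x. case (n, x) of (n, x) \<Rightarrow> a n * g n x)"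
      using g by (auto simp: AE_count_space intro!: integrable_mult_right integrable_const_bound[where B=C])
  qed
  then have "(LINT x|M. (LINT n|count_space UNIV. a n * g n x)) = (LINT n|count_space UNIV. (LINT x|M. a n * g n x))"
    by (rule P.Fubini_integral)
  then show ?thesis unfolding e1 e2 by simp
qed

section \<open>Density of trigonometric polynomials and rapidly decreasing coefficients\<close>

lemma measurable_angle: "f \<in> borel_measurable borel \<Longrightarrow> f \<in> borel_measurable angle_measure"
  by simp

inductive trig_poly :: "(complex \<Rightarrow> complex) \<Rightarrow> bool" where
  trig_poly_monom: "trig_poly (\<lambda>z. c * z powi n)"
| trig_poly_add: "trig_poly f \<Longrightarrow> trig_poly g \<Longrightarrow> trig_poly (\<lambda>z. f z + g z)"

text \<open>The product is matched on the circle only: the exponent law for \<open>powi\<close>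
  fails at 0.\<close>

lemma trig_poly_mult:
  assumes "trig_poly f" "trig_poly g"
  shows "\<exists>h. trig_poly h \<and> (\<forall>z\<in>unit_circle. h z = f z * g z)"
  using assms(1)
proof induction
  case (trig_poly_monom c n)
  show ?case using assms(2)
  proof induction
    case (trig_poly_monom d m)
    have "(c * d) * z powi (n + m) = c * z powi n * (d * z powi m)" if "z \<in> unit_circle" for z
    proof -
      have "z \<noteq> 0" using that by auto
      then show ?thesis by (simp add: power_int_add)
    qed
    then show ?case using trig_poly.trig_poly_monom by blast
  next
    case (trig_poly_add f g)
    then obtain h k where "trig_poly h" "\<forall>z\<in>unit_circle. h z = c * z powi n * f z"
      "trig_poly k" "\<forall>z\<in>unit_circle. k z = c * z powi n * g z" by blast
    then show ?case
      by (intro exI[of _ "\<lambda>z. h z + k z"]) (simp add: trig_poly.trig_poly_add distrib_left)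
  qed
next
  case (trig_poly_add f f')
  then obtain h k where "trig_poly h" "\<forall>z\<in>unit_circle. h z = f z * g z"
    "trig_poly k" "\<forall>z\<in>unit_circle. k z = f' z * g z" by blast
  then show ?case
    by (intro exI[of _ "\<lambda>z. h z + k z"]) (simp add: trig_poly.trig_poly_add distrib_right)
qed

lemma real_polynomial_function_trig_poly:
  fixes p :: "complex \<Rightarrow> real"
  assumes "real_polynomial_function p"
  shows "\<exists>g. trig_poly g \<and> (\<forall>z\<in>unit_circle. g z = of_real (p z))"
  using assms
proof induction
  case (linear f)
  interpret bounded_linear f by fact
  \<comment> \<open>This is \<open>f 1 * Re z + f \<i> * Im z\<close> with cnj z replaced by 1/z,
    which is legitimate on the circle.\<close>
  let ?g = "\<lambda>z. (of_real (f 1) / 2 + of_real (f \<i>) / (2 * \<i>)) * z powi 1 +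
    (of_real (f 1) / 2 - of_real (f \<i>) / (2 * \<i>)) * z powi (-1)"
  have "?g z = of_real (f z)" if "z \<in> unit_circle" for z
  proof -
    have "inverse z = cnj z"
      using that by (auto simp: inverse_complex_def complex_eq_iff cmod_def)
    then have "?g z = of_real (f 1) * ((z + cnj z) / 2) + of_real (f \<i>) * ((z - cnj z) / (2 * \<i>))"
      by (simp add: power_int_minus field_simps)
    also have "\<dots> = of_real (Re z * f 1 + Im z * f \<i>)"
      by (simp add: complex_add_cnj complex_diff_cnj, simp add: complex_eq_iff)
    also have "Re z * f 1 + Im z * f \<i> = f z"
    proof -
      have "z = Re z *\<^sub>R 1 + Im z *\<^sub>R \<i>" by (simp add: complex_eq_iff)
      then show ?thesis by (metis add scaleR real_scaleR_def)
    qed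
    finally show ?thesis .
  qed
  moreover have "trig_poly ?g" by (intro trig_poly.intros)
  ultimately show ?case by blast
next
  case (const c)
  then show ?case using trig_poly_monom[of "of_real c" 0] by auto
next
  case (add f g)
  then obtain h k where "trig_poly h" "\<forall>z\<in>unit_circle. h z = of_real (f z)"
    "trig_poly k" "\<forall>z\<in>unit_circle. k z = of_real (g z)" by blast
  then show ?case
    by (intro exI[of _ "\<lambda>z. h z + k z"]) (simp add: trig_poly.trig_poly_add)
next
  case (mult f g)
  then obtain h k where "trig_poly h" "\<forall>z\<in>unit_circle. h z = of_real (f z)"
    "trig_poly k" "\<forall>z\<in>unit_circle. k z = of_real (g z)" by blast
  then show ?case using trig_poly_mult[of h k] by auto
qed

text \<open>Real Stone-Weierstrass is applied to the real and the imaginary part separately, each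
  with error e/2.\<close>

lemma trig_poly_dense:
  fixes f :: "complex \<Rightarrow> complex"
  assumes "continuous_on unit_circle f" "e > 0"
  shows "\<exists>g. trig_poly g \<and> (\<forall>z\<in>unit_circle. norm (f z - g z) < e)"
proof -
  have *: "\<exists>g. trig_poly g \<and> (\<forall>z\<in>unit_circle. norm (of_real (u z) - g z) < e / 2)"
    if u: "continuous_on unit_circle u" for u :: "complex \<Rightarrow> real"
  proof -
    obtain p where p: "real_polynomial_function p" "\<And>z. z \<in> unit_circle \<Longrightarrow> \<bar>u z - p z\<bar> < e / 2"
      using Stone_Weierstrass_real_polynomial_function[OF compact_sphere u, of "e / 2"] assms(2) by auto
    obtain g where g: "trig_poly g" "\<forall>z\<in>unit_circle. g z = of_real (p z)"
      using real_polynomial_function_trig_poly[OF p(1)] by blast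
    have "norm (complex_of_real (u z) - g z) < e / 2" if "z \<in> unit_circle" for z
      using p(2)[OF that] g(2) that by (simp flip: of_real_diff)
    with g(1) show ?thesis by blast
  qed
  obtain g where g: "trig_poly g" "\<forall>z\<in>unit_circle. norm (of_real (Re (f z)) - g z) < e / 2"
    using *[of "\<lambda>z. Re (f z)"] assms(1) by (auto intro: continuous_intros)
  obtain k where k: "trig_poly k" "\<forall>z\<in>unit_circle. norm (of_real (Im (f z)) - k z) < e / 2"
    using *[of "\<lambda>z. Im (f z)"] assms(1) by (auto intro: continuous_intros)
  obtain l where l: "trig_poly l" "\<forall>z\<in>unit_circle. l z = \<i> * k z"
    using trig_poly_mult[OF trig_poly_monom[of \<i> 0] k(1)] by auto
  have "norm (f z - (g z + l z)) < e" if z: "z \<in> unit_circle" for z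
  proof -
    have "f z - (g z + l z) = (of_real (Re (f z)) - g z) + \<i> * (of_real (Im (f z)) - k z)"
      using l(2) z complex_eq[of "f z"] by (simp add: algebra_simps)
    also have "norm \<dots> \<le> norm (of_real (Re (f z)) - g z) + norm (of_real (Im (f z)) - k z)"
      by (metis norm_triangle_ineq norm_mult norm_ii mult_1)
    also have "\<dots> < e" using add_strict_mono[OF g(2)[rule_format, OF z] k(2)[rule_format, OF z]] by simp
    finally show ?thesis .
  qed
  then show ?thesis using g(1) l(1) trig_poly_add by blast
qed

lemma cis_powi: "cis t powi n = cis (of_int n * t)"
  by (metis cis_power_int)

text \<open>The jump of \<open>Arg2pi\<close> at 1 is harmless: preimages of closed sets under g are
  images under \<open>cis\<close> of compact subsets of [0, 2 pi], hence closed.\<close>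

lemma periodic_cont_factor:
  assumes "periodic_cont f"
  obtains g where "continuous_on unit_circle g" "\<And>t. g (cis t) = f t"
proof -
  have per: "\<And>t. f (t + 2*pi) = f t" using assms by (simp add: periodic_cont_def)
  define g where "g z = f (Arg2pi z)" for z
  have g: "g (cis t) = f t" for t
  proof -
    have "cis (Arg2pi (cis t)) = cis t"
      using Arg2pi_eq[of "cis t"] by (simp add: cis_conv_exp)
    then show ?thesis unfolding g_def using periodic_cis_cong[of f] per by blast
  qed
  have "continuous_on unit_circle g"
  proof (subst continuous_on_closed_vimage)
    show "\<forall>B. closed B \<longrightarrow> closed (g -` B \<inter> unit_circle)"
    proof (intro allI impI)
      fix B :: "complex set" assume B: "closed B"
      have "g -` B \<inter> unit_circle = cis ` ({0..2*pi} \<inter> f -` B)"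
      proof (intro equalityI subsetI)
        fix z assume z: "z \<in> g -` B \<inter> unit_circle"
        then have "z = cis (Arg2pi z)" using Arg2pi_eq[of z] by (simp add: cis_conv_exp)
        moreover have "Arg2pi z \<in> {0..2*pi} \<inter> f -` B"
          using z Arg2pi[of z] by (auto simp: g_def)
        ultimately show "z \<in> cis ` ({0..2*pi} \<inter> f -` B)" by blast
      next
        fix z assume "z \<in> cis ` ({0..2*pi} \<inter> f -` B)"
        then show "z \<in> g -` B \<inter> unit_circle" using g by auto
      qed
      moreover have "compact ({0..2*pi} \<inter> f -` B)"
      proof -
        have "closed (f -` B)" using assms B by (intro continuous_closed_vimage) (auto simp: periodic_cont_def continuous_on_eq_continuous_at)
        then show ?thesis by (intro compact_Int_closed) auto
      qed
      then have "compact (cis ` ({0..2*pi} \<inter> f -` B))"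
        by (intro compact_continuous_image continuous_intros)
      ultimately show "closed (g -` B \<inter> unit_circle)" by (simp add: compact_imp_closed)
    qed
  qed simp
  with g that show ?thesis by blast
qed

lemma trig_poly_continuous: "trig_poly g \<Longrightarrow> continuous_on unit_circle g"
  by (induction rule: trig_poly.induct) (auto intro!: continuous_intros)

lemma trig_poly_periodic_cont:
  assumes "trig_poly g" shows "periodic_cont (\<lambda>t. g (cis t))"
  using assms
proof induction
  case (trig_poly_monom c n)
  show ?case unfolding cis_powi by (intro periodic_cont_mult periodic_cont_const periodic_cont_cis)
qed (rule periodic_cont_add)

text \<open>Vanishing coefficients make f orthogonal to trigonometric polynomials. Approximating cnj
  f by them gives mean 0 for |f|^2, and continuity does the rest.\<close>

lemma fc_eq_0_imp_eq_0:
  assumes f: "periodic_cont f" and 0: "\<And>n. fc f n = 0"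
  shows "f t = 0"
proof -
  have trig: "(LINT t|angle_measure. f t * g (cis t)) = 0" if "trig_poly g" for g
    using that
  proof induction
    case (trig_poly_monom c n)
    have "(LINT t|angle_measure. f t * (c * cis t powi n)) = (LINT t|angle_measure. c * (f t * cis (of_int n * t)))"
      by (simp add: cis_powi mult_ac)
    also have "\<dots> = c * fc f (-n)" by (simp add: fc_def)
    finally show ?case using 0 by simp
  next
    case (trig_poly_add g h)
    then show ?case using f
      by (simp add: distrib_left integrable_periodic_cont periodic_cont_mult trig_poly_periodic_cont)
  qed
  obtain C where C: "C \<ge> 0" "\<And>t. norm (f t) \<le> C" using periodic_cont_bounded[OF f] by blast
  obtain k where k: "continuous_on unit_circle k" "\<And>t. k (cis t) = cnj (f t)"
    using periodic_cont_factor[OF periodic_cont_cnj[OF f]] by blast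
  have "norm (LINT t|angle_measure. f t * cnj (f t)) \<le> 0 + e" if "e > 0" for e
  proof -
    obtain g where g: "trig_poly g" "\<forall>z\<in>unit_circle. norm (k z - g z) < e / (C + 1)"
      using trig_poly_dense[OF k(1), of "e / (C + 1)"] \<open>e > 0\<close> C by auto
    note pc = f periodic_cont_cnj[OF f] trig_poly_periodic_cont[OF g(1)] periodic_cont_mult periodic_cont_diff
    have "(LINT t|angle_measure. f t * cnj (f t)) = (LINT t|angle_measure. f t * cnj (f t)) - (LINT t|angle_measure. f t * g (cis t))"
      using trig[OF g(1)] by simp
    also have "\<dots> = (LINT t|angle_measure. f t * (cnj (f t) - g (cis t)))"
      by (simp add: right_diff_distrib integrable_periodic_cont pc)
    also have "norm \<dots> \<le> C * (e / (C + 1))"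
    proof (rule integral_angle_le)
      show "(\<lambda>t. f t * (cnj (f t) - g (cis t))) \<in> borel_measurable borel"
        by (intro periodic_cont_measurable pc)
      have "norm (cnj (f t) - g (cis t)) \<le> e / (C + 1)" for t
        using g(2)[rule_format, of "cis t"] k(2)[of t] by simp
      then show "norm (f t * (cnj (f t) - g (cis t))) \<le> C * (e / (C + 1))" for t
        unfolding norm_mult using C by (intro mult_mono) auto
    qed
    also have "\<dots> \<le> e" using C \<open>e > 0\<close> by (simp add: field_simps)
    finally show ?thesis by simp
  qed
  then have "norm (LINT t|angle_measure. f t * cnj (f t)) \<le> 0" by (rule field_le_epsilon)
  then have "(LINT t|angle_measure. f t * cnj (f t)) = 0" by simp
  moreover have "(LINT t|angle_measure. f t * cnj (f t)) = of_real (LINT t|angle_measure. (cmod (f t))\<^sup>2)"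
  proof -
    have "integrable angle_measure (\<lambda>t. (cmod (f t))\<^sup>2)"
    proof (rule integrable_angle)
      show "(\<lambda>t. (cmod (f t))\<^sup>2) \<in> borel_measurable borel"
        using periodic_cont_measurable[OF f] by measurable
      show "norm ((cmod (f t))\<^sup>2) \<le> C\<^sup>2" for t using C(2)[of t] by (simp add: power_mono)
    qed
    then show ?thesis unfolding complex_norm_square[symmetric] by (rule integral_of_real)
  qed
  ultimately have "(LINT t|angle_measure. (cmod (f t))\<^sup>2) = 0" by simp
  moreover have cont: "continuous_on UNIV (\<lambda>t. (cmod (f t))\<^sup>2)"
    using f by (auto simp: periodic_cont_def intro!: continuous_intros)
  ultimately have "integral {0..2*pi} (\<lambda>t. (cmod (f t))\<^sup>2) = 0" by (simp add: integral_angle_eq)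
  then have z: "f s = 0" if "s \<in> {0..2*pi}" for s
    using integral_eq_0_iff[of 0 "2*pi" "\<lambda>t. (cmod (f t))\<^sup>2"] continuous_on_subset[OF cont] that by auto
  have "\<And>t. f (t + 2*pi) = f t" using f by (simp add: periodic_cont_def)
  then obtain s where "s \<in> {0..2*pi}" "f s = f t" by (rule periodic_representative)
  then show ?thesis using z by metis
qed

context
  fixes a :: "int \<Rightarrow> complex"
  assumes a: "(\<lambda>n. norm (a n)) summable_on UNIV"
begin

lemma periodic_cont_trig_series: "periodic_cont (\<lambda>t. \<Sum>\<^sub>\<infinity>n. a n * cis (of_int n * t))"
proof -
  have "uniform_limit UNIV (\<lambda>X t. \<Sum>n\<in>X. a n * cis (of_int n * t)) (\<lambda>t. \<Sum>\<^sub>\<infinity>n. a n * cis (of_int n * t))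
      (finite_subsets_at_top UNIV)"
    by (rule Weierstrass_m_test_general[OF _ a]) (simp add: norm_mult)
  then have "continuous_on UNIV (\<lambda>t. \<Sum>\<^sub>\<infinity>n. a n * cis (of_int n * t))"
    by (rule uniform_limit_theorem[rotated]) (auto intro!: always_eventually continuous_intros)
  then show ?thesis by (simp add: periodic_cont_def)
qed

lemma fc_trig_series: "fc (\<lambda>t. \<Sum>\<^sub>\<infinity>n. a n * cis (of_int n * t)) m = a m"
proof -
  have "fc (\<lambda>t. \<Sum>\<^sub>\<infinity>n. a n * cis (of_int n * t)) m =
      (LINT t|angle_measure. (\<Sum>\<^sub>\<infinity>n. a n * cis (of_int (n - m) * t)))"
    unfolding fc_def infsum_cmult_left'[symmetric] by (simp add: mult.assoc cis_mult algebra_simps)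
  also have "\<dots> = (\<Sum>\<^sub>\<infinity>n. a n * (LINT t|angle_measure. cis (of_int (n - m) * t)))"
    using periodic_cont_measurable[OF periodic_cont_cis]
    by (intro integral_infsum[OF finite_measure_angle a, where C=1]) (auto simp del: of_int_diff)
  also have "\<dots> = (\<Sum>\<^sub>\<infinity>n. if n = m then a m else 0)"
    by (intro infsum_cong) (simp only: integral_cis, auto)
  also have "\<dots> = a m" by (subst infsum_cong_neutral[where T="{m}" and g="\<lambda>n. a m"]) auto
  finally show ?thesis .
qed

end

text \<open>The absolutely convergent series is continuous with the same coefficients as f, so
  uniqueness applies to the difference.\<close>

lemma fourier_inversion:
  assumes f: "periodic_cont f" and s: "(\<lambda>n. norm (fc f n)) summable_on UNIV"
  shows "f t = (\<Sum>\<^sub>\<infinity>n. fc f n * cis (of_int n * t))"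
proof -
  let ?S = "\<lambda>t. \<Sum>\<^sub>\<infinity>n. fc f n * cis (of_int n * t)"
  have "f t - ?S t = 0"
  proof (rule fc_eq_0_imp_eq_0[of "\<lambda>t. f t - ?S t"])
    show "periodic_cont (\<lambda>t. f t - ?S t)" by (intro periodic_cont_diff f periodic_cont_trig_series s)
    show "fc (\<lambda>t. f t - ?S t) n = 0" for n
      using fc_diff[OF f periodic_cont_trig_series[OF s]] fc_trig_series[OF s] by simp
  qed
  then show ?thesis by simp
qed

text \<open>Expanding f(Nt) in its series, each term cis(mNt) shifts the spectrum of P by mN. With N
  = 1 and n = 0 the same identity gives Parseval for the test functions.\<close>

lemma fc_mult_scale:
  assumes P: "periodic_cont P" and f: "periodic_cont f" and s: "(\<lambda>n. norm (fc f n)) summable_on UNIV"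
  shows "fc (\<lambda>t. P t * f (real N * t)) n = (\<Sum>\<^sub>\<infinity>m. fc f m * fc P (n - m * int N))"
proof -
  obtain C where C: "C \<ge> 0" "\<And>t. norm (P t) \<le> C" using periodic_cont_bounded[OF P] by blast
  let ?g = "\<lambda>m t. P t * cis (of_int (- (n - m * int N)) * t)"
  have "P t * f (real N * t) * cis (of_int (- n) * t) = (\<Sum>\<^sub>\<infinity>m. fc f m * ?g m t)" for t
  proof -
    have "(\<Sum>\<^sub>\<infinity>m. fc f m * ?g m t) = (\<Sum>\<^sub>\<infinity>m. (P t * cis (of_int (- n) * t)) * (fc f m * cis (of_int m * (real N * t))))"
    proof (rule infsum_cong)
      fix m
      have "cis (of_int (- (n - m * int N)) * t) = cis (of_int (- n) * t) * cis (of_int m * (real N * t))"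
        by (simp add: cis_mult algebra_simps)
      then show "fc f m * ?g m t = (P t * cis (of_int (- n) * t)) * (fc f m * cis (of_int m * (real N * t)))"
        by (simp only: mult_ac)
    qed
    also have "\<dots> = (P t * cis (of_int (- n) * t)) * f (real N * t)"
      unfolding infsum_cmult_right' using fourier_inversion[OF f s] by simp
    finally show ?thesis by (simp add: mult_ac)
  qed
  then have "fc (\<lambda>t. P t * f (real N * t)) n = (LINT t|angle_measure. (\<Sum>\<^sub>\<infinity>m. fc f m * ?g m t))"
    unfolding fc_altdef by (simp only:)
  also have "\<dots> = (\<Sum>\<^sub>\<infinity>m. fc f m * (LINT t|angle_measure. ?g m t))"
  proof (rule integral_infsum[OF finite_measure_angle s, where C=C])
    show "?g m \<in> borel_measurable angle_measure" for m
      by (rule measurable_angle, rule periodic_cont_measurable[OF periodic_cont_mult[OF P periodic_cont_cis]])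
    show "norm (?g m t) \<le> C" for m t using C by (simp add: norm_mult)
  qed
  finally show ?thesis unfolding fc_altdef .
qed

lemma summable_on_int_inverse_square: "(\<lambda>n::int. 1 / (1 + \<bar>real_of_int n\<bar>)^2) summable_on UNIV"
proof -
  have "summable (\<lambda>n. 1 / real (Suc n) ^ 2)"
    using summable_Suc_iff[of "\<lambda>n. inverse (real n ^ 2)"] inverse_power_summable[of 2] by (simp add: field_simps)
  then have "summable (\<lambda>n. 1 / (1 + real n) ^ 2)" by (simp add: add.commute)
  then have nat: "(\<lambda>n. 1 / (1 + real n) ^ 2) summable_on UNIV" by (intro norm_summable_imp_summable_on) simp
  have "(\<lambda>n::int. 1 / (1 + \<bar>real_of_int n\<bar>)^2) summable_on range int"
    by (subst summable_on_reindex) (use nat in \<open>auto simp: o_def\<close>)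
  moreover have "(\<lambda>n::int. 1 / (1 + \<bar>real_of_int n\<bar>)^2) summable_on range (\<lambda>n. - int n)"
    by (subst summable_on_reindex) (use nat in \<open>auto simp: o_def inj_on_def\<close>)
  ultimately have "(\<lambda>n::int. 1 / (1 + \<bar>real_of_int n\<bar>)^2) summable_on (range int \<union> range (\<lambda>n. - int n))"
    by (rule summable_on_union)
  moreover have "range int \<union> range (\<lambda>n. - int n) = (UNIV :: int set)"
    using int_cases2 by (auto simp: image_iff) metis
  ultimately show ?thesis by simp
qed

section \<open>Rapidly decreasing coefficient sequences\<close>

definition rapid :: "(int \<Rightarrow> complex) \<Rightarrow> bool" where
  "rapid a \<longleftrightarrow> (\<forall>M::nat. \<exists>C. \<forall>n. norm (a n) * (1 + \<bar>real_of_int n\<bar>) ^ M \<le> C)"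

lemma rapidD:
  assumes "rapid a" obtains C where "C \<ge> 0" "\<And>n. norm (a n) * (1 + \<bar>real_of_int n\<bar>) ^ M \<le> C"
proof -
  obtain C where C: "\<And>n. norm (a n) * (1 + \<bar>real_of_int n\<bar>) ^ M \<le> C" using assms unfolding rapid_def by blast
  have "0 \<le> norm (a 0) * (1 + \<bar>real_of_int 0\<bar>) ^ M" by simp
  then have "C \<ge> 0" using C order_trans by blast
  with C that show ?thesis by blast
qed

text \<open>Integration by parts produces weights |n|^M, which say nothing at n = 0; the case M = 0
  of the assumption supplies the missing bound.\<close>

lemma rapidI:
  assumes "\<And>M. \<exists>C. \<forall>n. norm (a n) * \<bar>real_of_int n\<bar> ^ M \<le> C" shows "rapid a"
  unfolding rapid_def
proof
  fix M
  obtain C where C: "\<And>n. norm (a n) * \<bar>real_of_int n\<bar> ^ M \<le> C" using assms by blast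
  obtain D where D: "\<And>n. norm (a n) \<le> D" using assms[of 0] by auto
  have "norm (a n) * (1 + \<bar>real_of_int n\<bar>) ^ M \<le> 2 ^ M * (D + C)" for n
  proof -
    have "(1 + \<bar>real_of_int n\<bar>) ^ M \<le> 2 ^ M * (1 + \<bar>real_of_int n\<bar> ^ M)"
    proof (cases "n = 0")
      case False
      then have "1 + \<bar>real_of_int n\<bar> \<le> 2 * \<bar>real_of_int n\<bar>" by simp
      then have "(1 + \<bar>real_of_int n\<bar>) ^ M \<le> (2 * \<bar>real_of_int n\<bar>) ^ M" by (intro power_mono) auto
      then show ?thesis by (simp add: power_mult_distrib distrib_left add_increasing)
    qed (simp add: power_0_left)
    then have "norm (a n) * (1 + \<bar>real_of_int n\<bar>) ^ M \<le> norm (a n) * (2 ^ M * (1 + \<bar>real_of_int n\<bar> ^ M))"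
      by (intro mult_left_mono) auto
    also have "\<dots> = 2 ^ M * (norm (a n) + norm (a n) * \<bar>real_of_int n\<bar> ^ M)" by (simp add: algebra_simps)
    also have "\<dots> \<le> 2 ^ M * (D + C)" using C[of n] D[of n] by (intro mult_left_mono) auto
    finally show ?thesis .
  qed
  then show "\<exists>C. \<forall>n. norm (a n) * (1 + \<bar>real_of_int n\<bar>) ^ M \<le> C" by blast
qed

lemma rapid_summable:
  assumes "rapid a" shows "(\<lambda>n. norm (a n) * (1 + \<bar>real_of_int n\<bar>) ^ M) summable_on UNIV"
proof -
  \<comment> \<open>Two powers more than asked for leave a summable inverse square.\<close>
  obtain C where C: "C \<ge> 0" "\<And>n. norm (a n) * (1 + \<bar>real_of_int n\<bar>) ^ (M + 2) \<le> C"
    using rapidD[OF assms] by blast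
  have "(\<lambda>n::int. C * (1 / (1 + \<bar>real_of_int n\<bar>)^2)) summable_on UNIV"
    by (intro summable_on_cmult_right summable_on_int_inverse_square)
  then show ?thesis
    by (rule summable_on_comparison_test) (use C(2) in \<open>simp_all add: pos_le_divide_eq mult.assoc power_add del: add_2_eq_Suc'\<close>)
qed

lemma rapid_abs_summable: "rapid a \<Longrightarrow> (\<lambda>n. norm (a n)) summable_on UNIV"
  using rapid_summable[of a 0] by simp

text \<open>Preserves rapid decay from one partial product to the next. The weight splits by 1 + |n|
  <= (1 + |n - mN|) (1 + N) (1 + |m|).\<close>

lemma rapid_convolution:
  assumes a: "rapid a" and b: "rapid b"
  shows "rapid (\<lambda>n. \<Sum>\<^sub>\<infinity>m. a m * b (n - m * int N))"
  unfolding rapid_def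
proof
  fix M
  obtain B where B: "B \<ge> 0" "\<And>n. norm (b n) * (1 + \<bar>real_of_int n\<bar>) ^ M \<le> B" using rapidD[OF b] by blast
  have sM: "(\<lambda>m. (norm (a m) * (1 + \<bar>real_of_int m\<bar>) ^ M) * ((1 + real N) ^ M * B)) summable_on UNIV"
    by (intro summable_on_cmult_left rapid_summable a)
  have "norm (\<Sum>\<^sub>\<infinity>m. a m * b (n - m * int N)) * (1 + \<bar>real_of_int n\<bar>) ^ M
      \<le> (\<Sum>\<^sub>\<infinity>m. (norm (a m) * (1 + \<bar>real_of_int m\<bar>) ^ M) * ((1 + real N) ^ M * B))" for n
  proof -
    let ?c = "\<lambda>m. a m * b (n - m * int N) * of_real ((1 + \<bar>real_of_int n\<bar>) ^ M)"
    have bd: "norm (?c m) \<le> (norm (a m) * (1 + \<bar>real_of_int m\<bar>) ^ M) * ((1 + real N) ^ M * B)" for m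
    proof -
      have "1 + \<bar>real_of_int n\<bar> \<le> (1 + \<bar>real_of_int (n - m * int N)\<bar>) * (1 + \<bar>real_of_int (m * int N)\<bar>)"
      proof -
        have "\<bar>real_of_int n\<bar> \<le> \<bar>real_of_int (n - m * int N)\<bar> + \<bar>real_of_int (m * int N)\<bar>" by simp
        moreover have "0 \<le> \<bar>real_of_int (n - m * int N)\<bar> * \<bar>real_of_int (m * int N)\<bar>" by simp
        ultimately show ?thesis unfolding distrib_left distrib_right by linarith
      qed
      moreover have "1 + \<bar>real_of_int (m * int N)\<bar> \<le> (1 + real N) * (1 + \<bar>real_of_int m\<bar>)"
        by (simp add: distrib_left distrib_right abs_mult)
      ultimately have "1 + \<bar>real_of_int n\<bar> \<le> (1 + \<bar>real_of_int (n - m * int N)\<bar>) * ((1 + real N) * (1 + \<bar>real_of_int m\<bar>))"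
        by (meson order_trans mult_left_mono abs_ge_zero add_nonneg_nonneg zero_le_one)
      then have "(1 + \<bar>real_of_int n\<bar>) ^ M \<le> ((1 + \<bar>real_of_int (n - m * int N)\<bar>) * ((1 + real N) * (1 + \<bar>real_of_int m\<bar>))) ^ M"
        by (intro power_mono) auto
      then have "norm (a m) * norm (b (n - m * int N)) * (1 + \<bar>real_of_int n\<bar>) ^ M \<le>
          norm (a m) * norm (b (n - m * int N)) * ((1 + \<bar>real_of_int (n - m * int N)\<bar>) * ((1 + real N) * (1 + \<bar>real_of_int m\<bar>))) ^ M"
        by (intro mult_left_mono) auto
      also have "\<dots> = (norm (b (n - m * int N)) * (1 + \<bar>real_of_int (n - m * int N)\<bar>) ^ M) * ((norm (a m) * (1 + \<bar>real_of_int m\<bar>) ^ M) * (1 + real N) ^ M)"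
        by (simp add: power_mult_distrib mult_ac)
      also have "\<dots> \<le> B * ((norm (a m) * (1 + \<bar>real_of_int m\<bar>) ^ M) * (1 + real N) ^ M)"
        by (intro mult_right_mono B(2)) auto
      finally show ?thesis unfolding norm_mult norm_of_real by (simp add: abs_of_nonneg mult_ac)
    qed
    have s: "(\<lambda>m. norm (?c m)) summable_on UNIV"
      by (rule summable_on_comparison_test[OF sM bd]) auto
    have "norm (\<Sum>\<^sub>\<infinity>m. a m * b (n - m * int N)) * (1 + \<bar>real_of_int n\<bar>) ^ M
        = norm ((\<Sum>\<^sub>\<infinity>m. a m * b (n - m * int N)) * of_real ((1 + \<bar>real_of_int n\<bar>) ^ M))"
      unfolding norm_mult norm_of_real by (simp add: abs_of_nonneg)
    also have "\<dots> = norm (infsum ?c UNIV)" unfolding infsum_cmult_left' ..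
    also have "\<dots> \<le> (\<Sum>\<^sub>\<infinity>m. norm (?c m))" by (rule norm_infsum_bound[OF s])
    also have "\<dots> \<le> (\<Sum>\<^sub>\<infinity>m. (norm (a m) * (1 + \<bar>real_of_int m\<bar>) ^ M) * ((1 + real N) ^ M * B))"
      by (rule infsum_mono[OF s sM bd])
    finally show ?thesis .
  qed
  then show "\<exists>C. \<forall>n. norm (\<Sum>\<^sub>\<infinity>m. a m * b (n - m * int N)) * (1 + \<bar>real_of_int n\<bar>) ^ M \<le> C" by blast
qed

section \<open>A smooth step function\<close>

text \<open>The functions \<open>x\<^sup>-\<^sup>c exp (- 1/x)\<close>, extended by 0, are bounded and closed under differentiation
  up to linear combinations.\<close>

definition flat :: "nat \<Rightarrow> real \<Rightarrow> real" where
  "flat c x = (if x > 0 then exp (- 1 / x) / x ^ c else 0)"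

lemma flat_nonneg: "0 \<le> flat c x"
  by (simp add: flat_def)

text \<open>The exponential series of 1/x dominates its term of index c.\<close>

lemma flat_le: "flat c x \<le> fact c"
proof (cases "x > 0")
  case True
  have "(1/x) ^ c / fact c \<le> exp (1/x)"
  proof -
    have "(\<Sum>n\<in>{c}. (1/x) ^ n /\<^sub>R fact n) \<le> (\<Sum>n. (1/x) ^ n /\<^sub>R fact n)"
      using True by (intro sum_le_suminf summable_exp_generic) auto
    then show ?thesis by (simp add: exp_def divide_inverse_commute)
  qed
  then show ?thesis using True by (simp add: flat_def exp_minus field_simps)
qed (simp add: flat_def)

lemma flat_Suc: "flat c x = x * flat (Suc c) x"
  by (simp add: flat_def)

lemma flat_tendsto_0: "(flat c \<longlongrightarrow> 0) (at 0)"
proof (rule Lim_null_comparison)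
  have "norm (flat c x) \<le> \<bar>x\<bar> * fact (Suc c)" for x
    using flat_Suc[of c x] flat_le[of "Suc c" x] flat_nonneg[of "Suc c" x]
    by (simp add: abs_mult mult_left_mono del: fact_Suc)
  then show "\<forall>\<^sub>F x in at 0. norm (flat c x) \<le> \<bar>x\<bar> * fact (Suc c)" by simp
  show "((\<lambda>x. \<bar>x\<bar> * fact (Suc c)) \<longlongrightarrow> (0::real)) (at 0)"
    by (intro tendsto_mult_left_zero tendsto_rabs_zero tendsto_ident_at)
qed

lemma flat_deriv:
  "(flat c has_real_derivative flat (c + 2) x - real c * flat (c + 1) x) (at x)"
proof -
  consider "x > 0" | "x < 0" | "x = 0" by linarith
  then show ?thesis
  proof cases
    case 1
    have "((\<lambda>x. exp (- 1 / x) / x ^ c) has_real_derivative flat (c + 2) x - real c * flat (c + 1) x) (at x)"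
    proof -
      have "x ^ c = x * x ^ (c - Suc 0) \<or> c = 0" using 1 by (cases c) auto
      then show ?thesis using 1
        by (auto intro!: derivative_eq_intros simp: flat_def field_simps power2_eq_square power_add)
    qed
    then show ?thesis
      by (rule has_field_derivative_transform_within_open[of _ _ _ "{0<..}"]) (use 1 in \<open>auto simp: flat_def\<close>)
  next
    case 2
    have "((\<lambda>x. 0) has_real_derivative 0) (at x)" by simp
    then have "(flat c has_real_derivative 0) (at x)"
      by (rule has_field_derivative_transform_within_open[of _ _ _ "{..<0}"]) (use 2 in \<open>auto simp: flat_def\<close>)
    then show ?thesis using 2 by (simp add: flat_def)
  next
    case 3
    \<comment> \<open>The difference quotient at 0 is again a flat function, with exponent one
      higher, and tends to 0.\<close>
    have "(\<lambda>h. (flat c (0 + h) - flat c 0) / h) = (\<lambda>h. flat (Suc c) h)"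
      by (auto simp: flat_Suc[of c] flat_def fun_eq_iff)
    then have "(flat c has_real_derivative 0) (at 0)"
      unfolding DERIV_def using flat_tendsto_0[of "Suc c"] by simp
    then show ?thesis using 3 by (simp add: flat_def)
  qed
qed

text \<open>A space containing \<open>bump\<close>, closed under differentiation and made of bounded
  functions that vanish outside (0, 1). Hence all derivatives of \<open>bump\<close> are bounded,
  without computing any of them.\<close>

inductive bump_span :: "(real \<Rightarrow> real) \<Rightarrow> bool" where
  "bump_span (\<lambda>x. r * (flat c x * flat d (1 - x)))"
| "bump_span f \<Longrightarrow> bump_span g \<Longrightarrow> bump_span (\<lambda>x. f x + g x)"

lemma bump_span_props:
  assumes "bump_span f"
  shows "(\<exists>g. bump_span g \<and> (\<forall>x. (f has_real_derivative g x) (at x))) \<and> (\<exists>C. \<forall>x. \<bar>f x\<bar> \<le> C)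
    \<and> (\<forall>x. x \<le> 0 \<or> 1 \<le> x \<longrightarrow> f x = 0)"
  using assms
proof induction
  case (1 r c d)
  let ?g = "\<lambda>x. ((r * (flat (c + 2) x * flat d (1 - x)) + (- r * real c) * (flat (c + 1) x * flat d (1 - x)))
    + (- r) * (flat c x * flat (d + 2) (1 - x))) + (r * real d) * (flat c x * flat (d + 1) (1 - x))"
  have "((\<lambda>x. flat d (1 - x)) has_real_derivative - (flat (d + 2) (1 - x) - real d * flat (d + 1) (1 - x))) (at x)" for x
  proof -
    have "((\<lambda>x. 1 - x) has_real_derivative -1) (at x)" by (auto intro!: derivative_eq_intros)
    from DERIV_chain2[where f="flat d" and g="\<lambda>x. 1 - x", OF flat_deriv this] show ?thesis by simp
  qed
  then have "((\<lambda>x. r * (flat c x * flat d (1 - x))) has_real_derivative ?g x) (at x)" for x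
    by (auto intro!: derivative_eq_intros flat_deriv simp: algebra_simps)
  moreover have "bump_span ?g" by (intro bump_span.intros)
  moreover have "\<bar>r * (flat c x * flat d (1 - x))\<bar> \<le> \<bar>r\<bar> * (fact c * fact d)" for x
    unfolding abs_mult using flat_nonneg flat_le by (intro mult_mono) (auto simp: abs_of_nonneg)
  moreover have "r * (flat c x * flat d (1 - x)) = 0" if "x \<le> 0 \<or> 1 \<le> x" for x
    using that by (auto simp: flat_def)
  ultimately show ?case by blast
next
  case (2 f g)
  then obtain f' g' Cf Cg where
    "bump_span f'" "\<And>x. (f has_real_derivative f' x) (at x)" "\<And>x. \<bar>f x\<bar> \<le> Cf"
    "bump_span g'" "\<And>x. (g has_real_derivative g' x) (at x)" "\<And>x. \<bar>g x\<bar> \<le> Cg" by blast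
  note * = this
  have "\<bar>f x + g x\<bar> \<le> Cf + Cg" for x using *(3)[of x] *(6)[of x] by linarith
  then have "\<exists>C. \<forall>x. \<bar>f x + g x\<bar> \<le> C" by blast
  moreover have "\<exists>h. bump_span h \<and> (\<forall>x. ((\<lambda>x. f x + g x) has_real_derivative h x) (at x))"
    by (intro exI[of _ "\<lambda>x. f' x + g' x"] conjI allI bump_span.intros DERIV_add *)
  ultimately show ?case using 2 by auto
qed

definition bump :: "real \<Rightarrow> real" where "bump x = flat 0 x * flat 0 (1 - x)"

lemma bump_bump_span: "bump_span bump"
  using bump_span.intros(1)[of 1 0 0] by (simp add: bump_def[abs_def])

lemma continuous_on_bump: "continuous_on S bump"
  using bump_span_props[OF bump_bump_span] by (meson DERIV_isCont continuous_at_imp_continuous_on)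

lemma bump_nonneg: "0 \<le> bump x"
  by (simp add: bump_def flat_nonneg)

definition smooth_step :: "real \<Rightarrow> real" where
  "smooth_step x = (if x \<le> 0 then 0 else integral {0..x} bump) / integral {0..1} bump"

lemma integral_bump_pos: "0 < integral {0..1} bump"
proof -
  have "0 \<le> integral {0..1} bump"
    by (intro integral_nonneg integrable_continuous_real continuous_on_bump bump_nonneg)
  moreover have "integral {0..1} bump \<noteq> 0"
  proof
    assume "integral {0..1} bump = 0"
    then have "bump (1/2) = 0"
      using integral_eq_0_iff[OF continuous_on_bump[of "{0..1}"]] bump_nonneg by auto
    then show False by (simp add: bump_def flat_def)
  qed
  ultimately show ?thesis by simp
qed

lemma smooth_step_deriv:
  "(smooth_step has_real_derivative bump x / integral {0..1} bump) (at x)"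
proof -
  \<comment> \<open>The primitive starts to the left of both 0 and x, so that x is an interior point
    and one formula covers both branches of \<open>smooth_step\<close>.\<close>
  let ?I = "\<lambda>y. integral {-\<bar>x\<bar>-1..y} bump"
  have eq: "?I y = (if y \<le> 0 then 0 else integral {0..y} bump)" if y: "y \<in> {-\<bar>x\<bar>-1<..<\<bar>x\<bar>+1}" for y
  proof -
    have z: "integral {-\<bar>x\<bar>-1..w} bump = 0" if "w \<le> 0" for w
    proof -
      have "integral {-\<bar>x\<bar>-1..w} bump = integral {-\<bar>x\<bar>-1..w} (\<lambda>_. 0)"
        using that by (intro integral_cong) (auto simp: bump_def flat_def)
      then show ?thesis by simp
    qed
    show ?thesis
    proof (cases "y \<le> 0")
      case False
      have "integral {-\<bar>x\<bar>-1..0} bump + integral {0..y} bump = ?I y"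
        using False by (intro Henstock_Kurzweil_Integration.integral_combine integrable_continuous_real continuous_on_bump) auto
      then show ?thesis using z[of 0] False by simp
    qed (use z in simp)
  qed
  have "(?I has_real_derivative bump x) (at x within {-\<bar>x\<bar>-1..\<bar>x\<bar>+1})"
    by (rule integral_has_real_derivative[OF continuous_on_bump]) auto
  then have "(?I has_real_derivative bump x) (at x)"
    by (subst (asm) at_within_interior) (auto simp: interior_atLeastAtMost_real)
  then have "((\<lambda>y. ?I y / integral {0..1} bump) has_real_derivative bump x / integral {0..1} bump) (at x)"
    by (rule DERIV_cdivide)
  then show ?thesis
    by (rule has_field_derivative_transform_within_open[of _ _ _ "{-\<bar>x\<bar>-1<..<\<bar>x\<bar>+1}"])
      (auto simp: smooth_step_def eq)
qed

lemma smooth_step_eq_0: "x \<le> 0 \<Longrightarrow> smooth_step x = 0"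
  by (simp add: smooth_step_def)

lemma smooth_step_eq_1:
  assumes "x \<ge> 1" shows "smooth_step x = 1"
proof -
  have "integral {0..1} bump + integral {1..x} bump = integral {0..x} bump"
    using assms by (intro Henstock_Kurzweil_Integration.integral_combine integrable_continuous_real continuous_on_bump) auto
  moreover have "integral {1..x} bump = integral {1..x} (\<lambda>_. 0)"
    by (intro integral_cong) (auto simp: bump_def flat_def)
  ultimately show ?thesis using assms integral_bump_pos by (simp add: smooth_step_def)
qed

lemma smooth_step_mono: "x \<le> y \<Longrightarrow> smooth_step x \<le> smooth_step y"
  by (rule DERIV_nonneg_imp_nondecreasing)
    (use smooth_step_deriv bump_nonneg integral_bump_pos in \<open>auto intro!: exI divide_nonneg_pos\<close>)

lemma smooth_step_bounds: "0 \<le> smooth_step x" "smooth_step x \<le> 1"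
  using smooth_step_mono[of x 0] smooth_step_mono[of 0 x] smooth_step_mono[of x 1] smooth_step_mono[of 1 x]
    smooth_step_eq_0[of x] smooth_step_eq_0[of 0] smooth_step_eq_1[of x] smooth_step_eq_1[of 1]
  by linarith+

text \<open>A smooth function given together with the list of its derivatives, all of them
  bounded.\<close>

definition smooth_seq :: "(nat \<Rightarrow> real \<Rightarrow> real) \<Rightarrow> bool" where
  "smooth_seq \<beta> \<longleftrightarrow> (\<forall>j x. (\<beta> j has_real_derivative \<beta> (Suc j) x) (at x)) \<and> (\<forall>j. \<exists>C. \<forall>x. \<bar>\<beta> j x\<bar> \<le> C)"

text \<open>Vanishing of every derivative on the negative axis confines all functions obtained by
  differentiating the cutoff to the region where the outer factor is tiny.\<close>

lemma smooth_step_seq: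
  obtains \<beta> where "smooth_seq \<beta>" "\<beta> 0 = smooth_step" "\<And>j x. x \<le> 0 \<Longrightarrow> \<beta> j x = 0"
proof -
  define I where "I = integral {0..1} bump"
  have "\<exists>g. \<forall>n. (bump_span (g n) \<and> (n = 0 \<longrightarrow> g n = bump)) \<and> (\<forall>x. (g n has_real_derivative g (Suc n) x) (at x))"
  proof (rule dependent_nat_choice)
    show "\<exists>f. bump_span f \<and> (0 = (0::nat) \<longrightarrow> f = bump)" using bump_bump_span by blast
    show "\<exists>g. (bump_span g \<and> (Suc n = 0 \<longrightarrow> g = bump)) \<and> (\<forall>x. (f has_real_derivative g x) (at x))"
      if "bump_span f \<and> (n = 0 \<longrightarrow> f = bump)" for f n
      using bump_span_props[of f] that by auto
  qed
  then obtain g where g: "\<And>n. bump_span (g n)" "g 0 = bump"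
    "\<And>n x. (g n has_real_derivative g (Suc n) x) (at x)" by blast
  define \<beta> where "\<beta> j = (case j of 0 \<Rightarrow> smooth_step | Suc n \<Rightarrow> (\<lambda>x. g n x / I))" for j
  have "(\<beta> j has_real_derivative \<beta> (Suc j) x) (at x)" for j x
    using smooth_step_deriv[of x] DERIV_cdivide[OF g(3)] by (auto simp: \<beta>_def g(2) I_def split: nat.split)
  moreover have "\<exists>C. \<forall>x. \<bar>\<beta> j x\<bar> \<le> C" for j
  proof (cases j)
    case 0
    then show ?thesis using smooth_step_bounds by (auto simp: \<beta>_def intro!: exI[of _ 1])
  next
    case (Suc n)
    obtain C where C: "\<And>x. \<bar>g n x\<bar> \<le> C" using bump_span_props[OF g(1)[of n]] by blast
    have "I > 0" using integral_bump_pos by (simp add: I_def)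
    then have "\<bar>\<beta> j x\<bar> \<le> C / I" for x
      using C[of x] Suc by (simp add: \<beta>_def abs_divide divide_right_mono)
    then show ?thesis by blast
  qed
  ultimately have "smooth_seq \<beta>" unfolding smooth_seq_def by blast
  moreover have "\<beta> j x = 0" if "x \<le> 0" for j x
    using that bump_span_props[OF g(1)] smooth_step_eq_0 by (auto simp: \<beta>_def split: nat.split)
  ultimately show ?thesis using that[of \<beta>] by (simp add: \<beta>_def)
qed

section \<open>Uniform decay of coefficients\<close>

text \<open>In the variable z = cis (-t) a simple pole at 1 + \<kappa>/L, just outside the closed
  unit disc, with positive real part on the disc.\<close>

definition pole_fun :: "real \<Rightarrow> real \<Rightarrow> real \<Rightarrow> complex" where
  "pole_fun \<kappa> L t = 1 / (of_real (1 + \<kappa> / L) - cis (- t))"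

text \<open>The parameter s is 1 for the actual factor and 0 for the constant 1, so that one
  coefficient estimate also covers the bare cutoff.\<close>

definition outer_fun :: "real \<Rightarrow> real \<Rightarrow> real \<Rightarrow> real \<Rightarrow> complex" where
  "outer_fun s \<kappa> L t = exp (- (of_real (s * \<kappa>) * pole_fun \<kappa> L t))"

text \<open>A trigonometric polynomial in place of the distance to 0. It is 2 at t = 0, at least 1
  iff 1 - cos t <= \<kappa>^2/(8 L^2), and nonnegative iff 1 - cos t <= \<kappa>^2/(4 L^2);
  \<open>smooth_step\<close> makes its transition between the two arcs.\<close>

definition gap_coord :: "real \<Rightarrow> real \<Rightarrow> real \<Rightarrow> real" where
  "gap_coord \<kappa> L t = 8 * (L / \<kappa>)\<^sup>2 * (cos t - 1) + 2"

text \<open>An algebra of families depending on the parameter \<open>L\<close> that is closed under differentiation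
  in \<open>t\<close>, and whose members grow at most polynomially in \<open>L\<close>.\<close>

inductive fam :: "real \<Rightarrow> (nat \<Rightarrow> real \<Rightarrow> real) \<Rightarrow> (real \<Rightarrow> real \<Rightarrow> complex) \<Rightarrow> bool"
  for \<kappa> \<beta> where
  fam_base: "fam \<kappa> \<beta> (\<lambda>L t. of_real (\<beta> j (gap_coord \<kappa> L t)))"
| fam_pole: "fam \<kappa> \<beta> g \<Longrightarrow> fam \<kappa> \<beta> (\<lambda>L t. pole_fun \<kappa> L t * g L t)"
| fam_cis: "fam \<kappa> \<beta> g \<Longrightarrow> fam \<kappa> \<beta> (\<lambda>L t. cis (of_int n * t) * g L t)"
| fam_scale: "fam \<kappa> \<beta> g \<Longrightarrow> fam \<kappa> \<beta> (\<lambda>L t. of_real L * g L t)"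
| fam_const: "fam \<kappa> \<beta> g \<Longrightarrow> fam \<kappa> \<beta> (\<lambda>L t. c * g L t)"
| fam_add: "fam \<kappa> \<beta> g \<Longrightarrow> fam \<kappa> \<beta> h \<Longrightarrow> fam \<kappa> \<beta> (\<lambda>L t. g L t + h L t)"

context
  fixes \<kappa> L :: real
  assumes \<kappa>: "0 < \<kappa>" "\<kappa> \<le> 1" and L: "1 \<le> L"
begin

lemma pole_den_Re: "\<kappa> / L \<le> Re (of_real (1 + \<kappa> / L) - cis (- t))"
  using cos_le_one[of t] by simp

lemma pole_den_nonzero: "of_real (1 + \<kappa> / L) - cis (- t) \<noteq> 0"
proof
  assume "of_real (1 + \<kappa> / L) - cis (- t) = 0"
  then have "Re (of_real (1 + \<kappa> / L) - cis (- t)) = 0" by (simp only: zero_complex.sel)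
  moreover have "0 < \<kappa> / L" using \<kappa> L by simp
  ultimately show False using pole_den_Re[of t] by linarith
qed

lemma norm_pole_le: "norm (pole_fun \<kappa> L t) \<le> L / \<kappa>"
proof -
  define d where "d = norm (of_real (1 + \<kappa> / L) - cis (- t))"
  have "\<kappa> / L \<le> d" unfolding d_def by (rule order_trans[OF pole_den_Re complex_Re_le_cmod])
  moreover have "0 < \<kappa> / L" using \<kappa> L by simp
  ultimately have "1 / d \<le> 1 / (\<kappa> / L)" by (intro frac_le) auto
  moreover have "norm (pole_fun \<kappa> L t) = 1 / d" unfolding pole_fun_def d_def norm_divide by simp
  ultimately show ?thesis by simp
qed

lemma Re_pole: "Re (pole_fun \<kappa> L t) = (1 + \<kappa> / L - cos t) / ((\<kappa> / L)\<^sup>2 + 2 * (1 + \<kappa> / L) * (1 - cos t))"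
proof -
  have "(cmod (of_real (1 + \<kappa> / L) - cis (- t)))\<^sup>2 = (1 + \<kappa> / L - cos t)\<^sup>2 + (sin t)\<^sup>2"
    by (simp add: cmod_power2)
  also have "\<dots> = (\<kappa> / L)\<^sup>2 + 2 * (1 + \<kappa> / L) * (1 - cos t)"
  proof -
    have "(1 + e - c)\<^sup>2 + (1 - c\<^sup>2) = e\<^sup>2 + 2 * (1 + e) * (1 - c)" for e c :: real
      by (simp add: power2_eq_square algebra_simps)
    then show ?thesis unfolding sin_squared_eq .
  qed
  finally have c: "(cmod (of_real (1 + \<kappa> / L) - cis (- t)))\<^sup>2 = (\<kappa> / L)\<^sup>2 + 2 * (1 + \<kappa> / L) * (1 - cos t)" .
  have r: "Re (1 / z) = Re z / (cmod z)\<^sup>2" for z by (simp add: Re_divide cmod_power2)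
  show ?thesis unfolding pole_fun_def r c by simp
qed

lemma Re_pole_nonneg: "0 \<le> Re (pole_fun \<kappa> L t)"
proof -
  have e: "0 < \<kappa> / L" using \<kappa> L by simp
  then have *: "0 \<le> 1 + \<kappa> / L - cos t" "0 \<le> 1 - cos t"
    using cos_le_one[of t] by linarith+
  have **: "0 \<le> 2 * (1 + \<kappa> / L)" using \<kappa> L by (intro mult_nonneg_nonneg add_nonneg_nonneg) auto
  show ?thesis unfolding Re_pole
    by (rule divide_nonneg_nonneg[OF *(1) add_nonneg_nonneg[OF zero_le_power2 mult_nonneg_nonneg[OF ** *(2)]]])
qed

lemma norm_outer_le_1: "0 \<le> s \<Longrightarrow> norm (outer_fun s \<kappa> L t) \<le> 1"
  using Re_pole_nonneg \<kappa> by (simp add: outer_fun_def)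

text \<open>With \<epsilon> = \<kappa>/L, the assumption means 1 - cos t <= \<epsilon>^2/4. In
  \<open>Re_pole\<close> the denominator is then at most 2 \<epsilon>^2 and the numerator at least
  \<epsilon>, so the real part of the pole is at least L/(2 \<kappa>).\<close>

lemma norm_outer_le_exp:
  assumes "0 \<le> gap_coord \<kappa> L t"
  shows "norm (outer_fun 1 \<kappa> L t) \<le> exp (- L / 2)"
proof -
  define \<epsilon> where "\<epsilon> = \<kappa> / L"
  have e: "0 < \<epsilon>" "\<epsilon> \<le> 1" using \<kappa> L by (auto simp: \<epsilon>_def field_simps)
  have "L / \<kappa> = 1 / \<epsilon>" by (simp add: \<epsilon>_def)
  then have "0 \<le> 8 * (1 / \<epsilon>)\<^sup>2 * (cos t - 1) + 2" using assms by (simp add: gap_coord_def)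
  then have y: "1 - cos t \<le> \<epsilon>\<^sup>2 / 4" using e by (simp add: field_simps)
  have y0: "0 \<le> 1 - cos t" by simp
  have "\<epsilon>\<^sup>2 + 2 * (1 + \<epsilon>) * (1 - cos t) \<le> \<epsilon>\<^sup>2 + 2 * (1 + 1) * (\<epsilon>\<^sup>2 / 4)"
    using e y y0 by (intro add_mono mult_mono) auto
  then have d: "\<epsilon>\<^sup>2 + 2 * (1 + \<epsilon>) * (1 - cos t) \<le> 2 * \<epsilon>\<^sup>2" by simp
  have d0: "0 < \<epsilon>\<^sup>2 + 2 * (1 + \<epsilon>) * (1 - cos t)"
    using e y0 by (intro add_pos_nonneg mult_nonneg_nonneg) auto
  have "1 / (2 * \<epsilon>) = \<epsilon> / (2 * \<epsilon>\<^sup>2)" using e by (simp add: power2_eq_square)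
  also have "\<dots> \<le> (1 + \<epsilon> - cos t) / (\<epsilon>\<^sup>2 + 2 * (1 + \<epsilon>) * (1 - cos t))"
  proof (rule frac_le)
    show "\<epsilon> \<le> 1 + \<epsilon> - cos t" "0 \<le> 1 + \<epsilon> - cos t" using y0 e by linarith+
  qed (use d d0 in auto)
  also have "\<dots> = Re (pole_fun \<kappa> L t)" unfolding Re_pole \<epsilon>_def ..
  finally have "\<kappa> * (1 / (2 * \<epsilon>)) \<le> \<kappa> * Re (pole_fun \<kappa> L t)" using \<kappa> by (intro mult_left_mono) auto
  moreover have "\<kappa> * (1 / (2 * \<epsilon>)) = L / 2" using \<kappa> by (simp add: \<epsilon>_def)
  ultimately show ?thesis by (simp add: outer_fun_def)
qed

lemma has_vector_derivative_pole:
  "(pole_fun \<kappa> L has_vector_derivative (- \<i>) * (cis (of_int (-1) * t) * (pole_fun \<kappa> L t * pole_fun \<kappa> L t))) (at t)"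
proof -
  let ?D = "\<lambda>t. of_real (1 + \<kappa> / L) - cis (- t)"
  have "(?D has_vector_derivative \<i> * cis (- t)) (at t)"
    using has_vector_derivative_diff[OF has_vector_derivative_const[of "of_real (1 + \<kappa> / L)"] has_vector_derivative_cis[of "-1" t]]
    by simp
  from field_vector_diff_chain_at[OF this, of inverse "- (inverse (?D t))\<^sup>2"] DERIV_inverse[OF pole_den_nonzero[of t]]
  have "(inverse \<circ> ?D has_vector_derivative \<i> * cis (- t) * (- (inverse (?D t))\<^sup>2)) (at t)"
    by (simp add: numeral_2_eq_2)
  then show ?thesis
    by (simp add: pole_fun_def[abs_def] o_def divide_inverse power2_eq_square mult_ac)
qed

lemma has_vector_derivative_outer:
  "(outer_fun s \<kappa> L has_vector_derivative
     outer_fun s \<kappa> L t * ((\<i> * of_real (s * \<kappa>)) * (cis (of_int (-1) * t) * (pole_fun \<kappa> L t * pole_fun \<kappa> L t)))) (at t)"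
proof -
  let ?w = "\<lambda>t. - (of_real (s * \<kappa>) * pole_fun \<kappa> L t)"
  have "(?w has_vector_derivative - (of_real (s * \<kappa>) * ((- \<i>) * (cis (of_int (-1) * t) * (pole_fun \<kappa> L t * pole_fun \<kappa> L t))))) (at t)"
    by (intro has_vector_derivative_minus has_vector_derivative_mult_right has_vector_derivative_pole)
  from field_vector_diff_chain_at[OF this DERIV_exp]
  show ?thesis by (simp add: outer_fun_def[abs_def] o_def mult_ac)
qed

lemma outer_periodic: "outer_fun s \<kappa> L (t + 2 * pi) = outer_fun s \<kappa> L t"
proof -
  have "cis (- (t + 2 * pi)) = cis (- t)" using cis_int_periodic[of "-1" t] by simp
  then show ?thesis unfolding outer_fun_def pole_fun_def by simp
qed

lemma periodic_cont_outer: "periodic_cont (outer_fun s \<kappa> L)"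
  unfolding periodic_cont_def using outer_periodic has_vector_derivative_outer
  by (meson continuous_at_imp_continuous_on has_vector_derivative_continuous)

end

lemma gap_coord_periodic: "gap_coord \<kappa> L (t + 2 * pi) = gap_coord \<kappa> L t"
  by (simp add: gap_coord_def)

lemma fam_periodic: "fam \<kappa> \<beta> g \<Longrightarrow> g L (t + 2 * pi) = g L t"
proof (induction rule: fam.induct)
  case (fam_pole g)
  have "cis (- (t + 2 * pi)) = cis (- t)" using cis_int_periodic[of "-1" t] by simp
  then show ?case using fam_pole unfolding pole_fun_def by simp
qed (simp_all only: gap_coord_periodic cis_int_periodic)

text \<open>Differentiation stays inside the support of the cutoff, as each summand of a member
  contains some \<open>\<beta> j\<close>.\<close>

lemma fam_support: "fam \<kappa> \<beta> g \<Longrightarrow> (\<And>j. \<beta> j (gap_coord \<kappa> L t) = 0) \<Longrightarrow> g L t = 0"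
  by (induction rule: fam.induct) auto

text \<open>Each pole and each explicit factor L costs one power of L.\<close>

lemma fam_bound:
  assumes \<kappa>: "0 < \<kappa>" "\<kappa> \<le> 1" and \<beta>: "smooth_seq \<beta>" and "fam \<kappa> \<beta> g"
  shows "\<exists>C p. \<forall>L\<ge>1. \<forall>t. norm (g L t) \<le> C * L ^ p"
  using assms(4)
proof induction
  case (fam_base j)
  obtain C where "\<forall>x. \<bar>\<beta> j x\<bar> \<le> C" using \<beta> unfolding smooth_seq_def by blast
  then show ?case by (intro exI[of _ C] exI[of _ 0]) simp
next
  case (fam_pole g)
  then obtain C p where C: "\<And>L t. L \<ge> 1 \<Longrightarrow> norm (g L t) \<le> C * L ^ p" by blast
  have "norm (pole_fun \<kappa> L t * g L t) \<le> (C / \<kappa>) * L ^ Suc p" if "L \<ge> 1" for L t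
  proof -
    have "norm (pole_fun \<kappa> L t * g L t) \<le> (L / \<kappa>) * (C * L ^ p)"
      unfolding norm_mult using norm_pole_le[OF \<kappa> that] C[OF that] \<kappa> that by (intro mult_mono) auto
    then show ?thesis by (simp add: field_simps)
  qed
  then show ?case by blast
next
  case (fam_cis g n)
  then show ?case by (simp add: norm_mult)
next
  case (fam_scale g)
  then obtain C p where C: "\<And>L t. L \<ge> 1 \<Longrightarrow> norm (g L t) \<le> C * L ^ p" by blast
  have "norm (of_real L * g L t) \<le> C * L ^ Suc p" if "L \<ge> 1" for L t
    using mult_left_mono[OF C[OF that, of t], of L] that by (simp add: norm_mult mult_ac)
  then show ?case by blast
next
  case (fam_const g c)
  then obtain C p where C: "\<And>L t. L \<ge> 1 \<Longrightarrow> norm (g L t) \<le> C * L ^ p" by blast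
  have "norm (c * g L t) \<le> (norm c * C) * L ^ p" if "L \<ge> 1" for L t
    using mult_left_mono[OF C[OF that, of t], of "norm c"] by (simp add: norm_mult mult_ac)
  then show ?case by blast
next
  case (fam_add g h)
  then obtain C p D q where C: "\<And>L t. L \<ge> 1 \<Longrightarrow> norm (g L t) \<le> C * L ^ p"
    and D: "\<And>L t. L \<ge> 1 \<Longrightarrow> norm (h L t) \<le> D * L ^ q" by blast
  have "norm (g L t + h L t) \<le> (\<bar>C\<bar> + \<bar>D\<bar>) * L ^ (p + q)" if "L \<ge> 1" for L t
  proof -
    have "C * L ^ p \<le> \<bar>C\<bar> * L ^ (p + q)" "D * L ^ q \<le> \<bar>D\<bar> * L ^ (p + q)"
      using that by (auto intro!: mult_mono power_increasing)
    then show ?thesis using C[OF that, of t] D[OF that, of t] norm_triangle_ineq[of "g L t" "h L t"]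
      by (simp add: distrib_right)
  qed
  then show ?case by blast
qed

lemma fam_deriv:
  assumes \<kappa>: "0 < \<kappa>" "\<kappa> \<le> 1" and \<beta>: "smooth_seq \<beta>" and "fam \<kappa> \<beta> g"
  shows "\<exists>g'. fam \<kappa> \<beta> g' \<and> (\<forall>L\<ge>1. \<forall>t. (g L has_vector_derivative g' L t) (at t))"
  using assms(4)
proof induction
  case (fam_base j)
  let ?B = "\<lambda>L t. complex_of_real (\<beta> (Suc j) (gap_coord \<kappa> L t))"
  \<comment> \<open>From -8 sin t = 4 i (cis t - cis (-t)); the two factors L and the 1/\<kappa>^2
    come from the square in \<open>gap_coord\<close>.\<close>
  let ?c = "4 * \<i> / of_real (\<kappa>\<^sup>2)"
  let ?g = "\<lambda>L t. ?c * (of_real L * (of_real L * (cis (of_int 1 * t) * ?B L t)))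
    + (- ?c) * (of_real L * (of_real L * (cis (of_int (-1) * t) * ?B L t)))"
  have "fam \<kappa> \<beta> ?g"
    using fam.fam_base[of \<kappa> \<beta> "Suc j"] by (intro fam.fam_add fam.fam_const fam.fam_scale fam.fam_cis)
  moreover have "((\<lambda>t. of_real (\<beta> j (gap_coord \<kappa> L t))) has_vector_derivative ?g L t) (at t)" for L t
  proof -
    have "(gap_coord \<kappa> L has_real_derivative 8 * (L / \<kappa>)\<^sup>2 * (- sin t)) (at t)"
      unfolding gap_coord_def[abs_def] by (auto intro!: derivative_eq_intros)
    then have "((\<lambda>t. \<beta> j (gap_coord \<kappa> L t)) has_real_derivative \<beta> (Suc j) (gap_coord \<kappa> L t) * (8 * (L / \<kappa>)\<^sup>2 * (- sin t))) (at t)"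
      using \<beta> unfolding smooth_seq_def by (intro DERIV_chain2[of "\<beta> j"]) auto
    then have "((\<lambda>t. complex_of_real (\<beta> j (gap_coord \<kappa> L t))) has_vector_derivative
        of_real (\<beta> (Suc j) (gap_coord \<kappa> L t) * (8 * (L / \<kappa>)\<^sup>2 * (- sin t)))) (at t)"
      by (intro has_vector_derivative_of_real) (simp add: has_real_derivative_iff_has_vector_derivative)
    moreover have "of_real (\<beta> (Suc j) (gap_coord \<kappa> L t) * (8 * (L / \<kappa>)\<^sup>2 * (- sin t))) = ?g L t"
      by (simp add: complex_eq_iff power_divide power2_eq_square)
    ultimately show ?thesis by simp
  qed
  ultimately show ?case by blast
next
  case (fam_pole g)
  then obtain g' where g': "fam \<kappa> \<beta> g'" "\<And>L t. L \<ge> 1 \<Longrightarrow> (g L has_vector_derivative g' L t) (at t)" by blast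
  let ?h = "\<lambda>L t. pole_fun \<kappa> L t * g' L t + (- \<i>) * (cis (of_int (-1) * t) * (pole_fun \<kappa> L t * (pole_fun \<kappa> L t * g L t)))"
  have "((\<lambda>t. pole_fun \<kappa> L t * g L t) has_vector_derivative ?h L t) (at t)" if "L \<ge> 1" for L t
    using has_vector_derivative_mult[OF has_vector_derivative_pole[OF \<kappa> that] g'(2)[OF that], of t]
    by (simp add: mult_ac)
  moreover have "fam \<kappa> \<beta> ?h" by (intro fam.intros g' fam_pole)
  ultimately show ?case by blast
next
  case (fam_cis g n)
  then obtain g' where g': "fam \<kappa> \<beta> g'" "\<And>L t. L \<ge> 1 \<Longrightarrow> (g L has_vector_derivative g' L t) (at t)" by blast
  let ?h = "\<lambda>L t. cis (of_int n * t) * g' L t + (\<i> * of_int n) * (cis (of_int n * t) * g L t)"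
  have "((\<lambda>t. cis (of_int n * t) * g L t) has_vector_derivative ?h L t) (at t)" if "L \<ge> 1" for L t
    using has_vector_derivative_mult[OF has_vector_derivative_cis[of "of_int n"] g'(2)[OF that], of t]
    by (simp add: mult_ac)
  moreover have "fam \<kappa> \<beta> ?h" by (intro fam.intros g' fam_cis)
  ultimately show ?case by blast
next
  case (fam_scale g)
  then obtain g' where g': "fam \<kappa> \<beta> g'" "\<And>L t. L \<ge> 1 \<Longrightarrow> (g L has_vector_derivative g' L t) (at t)" by blast
  then have "fam \<kappa> \<beta> (\<lambda>L t. of_real L * g' L t)"
    "\<forall>L\<ge>1. \<forall>t. ((\<lambda>t. of_real L * g L t) has_vector_derivative of_real L * g' L t) (at t)"
    by (auto intro!: has_vector_derivative_mult_right fam.intros)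
  then show ?case by blast
next
  case (fam_const g c)
  then obtain g' where g': "fam \<kappa> \<beta> g'" "\<And>L t. L \<ge> 1 \<Longrightarrow> (g L has_vector_derivative g' L t) (at t)" by blast
  then have "fam \<kappa> \<beta> (\<lambda>L t. c * g' L t)"
    "\<forall>L\<ge>1. \<forall>t. ((\<lambda>t. c * g L t) has_vector_derivative c * g' L t) (at t)"
    by (auto intro!: has_vector_derivative_mult_right fam.intros)
  then show ?case by blast
next
  case (fam_add g h)
  then obtain g' h' where g': "fam \<kappa> \<beta> g'" "\<And>L t. L \<ge> 1 \<Longrightarrow> (g L has_vector_derivative g' L t) (at t)"
    and h': "fam \<kappa> \<beta> h'" "\<And>L t. L \<ge> 1 \<Longrightarrow> (h L has_vector_derivative h' L t) (at t)" by blast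
  then have "fam \<kappa> \<beta> (\<lambda>L t. g' L t + h' L t)"
    "\<forall>L\<ge>1. \<forall>t. ((\<lambda>t. g L t + h L t) has_vector_derivative g' L t + h' L t) (at t)"
    by (auto intro!: has_vector_derivative_add fam.intros)
  then show ?case by blast
qed

lemma fam_periodic_cont:
  assumes "0 < \<kappa>" "\<kappa> \<le> 1" "smooth_seq \<beta>" "fam \<kappa> \<beta> g" "L \<ge> 1"
  shows "periodic_cont (g L)"
proof -
  obtain g' where "\<And>t. (g L has_vector_derivative g' L t) (at t)" using fam_deriv[OF assms(1-4)] assms(5) by blast
  then have "continuous_on UNIV (g L)"
    by (meson continuous_at_imp_continuous_on has_vector_derivative_continuous)
  then show ?thesis using fam_periodic[OF assms(4)] by (simp add: periodic_cont_def)
qed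

text \<open>The derivative of the outer function times a member is the outer function times another
  member, so M integrations by parts leave the outer function intact as a factor.\<close>

lemma fam_outer_fc:
  assumes \<kappa>: "0 < \<kappa>" "\<kappa> \<le> 1" and \<beta>: "smooth_seq \<beta>" and g: "fam \<kappa> \<beta> g"
  shows "\<exists>h. fam \<kappa> \<beta> h \<and> (\<forall>L\<ge>1. \<forall>n. (\<i> * of_int n) ^ M * fc (\<lambda>t. outer_fun s \<kappa> L t * g L t) n
    = fc (\<lambda>t. outer_fun s \<kappa> L t * h L t) n)"
proof (induction M)
  case 0
  show ?case using g by (intro exI[of _ g]) simp
next
  case (Suc M)
  then obtain h where h: "fam \<kappa> \<beta> h" and eq: "\<And>L n. L \<ge> 1 \<Longrightarrow>
    (\<i> * of_int n) ^ M * fc (\<lambda>t. outer_fun s \<kappa> L t * g L t) n = fc (\<lambda>t. outer_fun s \<kappa> L t * h L t) n" by blast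
  obtain h' where h': "fam \<kappa> \<beta> h'" "\<And>L t. L \<ge> 1 \<Longrightarrow> (h L has_vector_derivative h' L t) (at t)"
    using fam_deriv[OF \<kappa> \<beta> h] by blast
  let ?k = "\<lambda>L t. h' L t + (\<i> * of_real (s * \<kappa>)) * (cis (of_int (-1) * t) * (pole_fun \<kappa> L t * (pole_fun \<kappa> L t * h L t)))"
  have k: "fam \<kappa> \<beta> ?k" by (intro fam.intros h h')
  have "fc (\<lambda>t. outer_fun s \<kappa> L t * ?k L t) n = \<i> * of_int n * fc (\<lambda>t. outer_fun s \<kappa> L t * h L t) n"
    if L: "L \<ge> 1" for L n
  proof (rule fc_deriv)
    show "periodic_cont (\<lambda>t. outer_fun s \<kappa> L t * h L t)"
      by (intro periodic_cont_mult periodic_cont_outer[OF \<kappa> L] fam_periodic_cont[OF \<kappa> \<beta> h L])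
    show "periodic_cont (\<lambda>t. outer_fun s \<kappa> L t * ?k L t)"
      by (intro periodic_cont_mult periodic_cont_outer[OF \<kappa> L] fam_periodic_cont[OF \<kappa> \<beta> k L])
    show "((\<lambda>t. outer_fun s \<kappa> L t * h L t) has_vector_derivative outer_fun s \<kappa> L t * ?k L t) (at t)" for t
      using has_vector_derivative_mult[OF has_vector_derivative_outer[OF \<kappa> L] h'(2)[OF L], of s t]
      by (simp add: algebra_simps)
  qed
  then have "\<forall>L\<ge>1. \<forall>n. (\<i> * of_int n) ^ Suc M * fc (\<lambda>t. outer_fun s \<kappa> L t * g L t) n = fc (\<lambda>t. outer_fun s \<kappa> L t * ?k L t) n"
    using eq by (simp add: mult.assoc)
  with k show ?case by blast
qed

text \<open>The bound w on the outer function is used only on the support of the cutoff. The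
  constants C and p come from the family alone and are uniform in L and n.\<close>

lemma fam_fc_bound:
  assumes \<kappa>: "0 < \<kappa>" "\<kappa> \<le> 1" and \<beta>: "smooth_seq \<beta>" and g: "fam \<kappa> \<beta> g"
    and w: "\<And>L t j. L \<ge> 1 \<Longrightarrow> \<beta> j (gap_coord \<kappa> L t) \<noteq> 0 \<Longrightarrow> norm (outer_fun s \<kappa> L t) \<le> w L"
    and w0: "\<And>L. 0 \<le> w L"
  shows "\<exists>C p. C \<ge> 0 \<and> (\<forall>L\<ge>1. \<forall>n. \<bar>real_of_int n\<bar> ^ M * norm (fc (\<lambda>t. outer_fun s \<kappa> L t * g L t) n) \<le> C * L ^ p * w L)"
proof -
  obtain h where h: "fam \<kappa> \<beta> h" and eq: "\<And>L n. L \<ge> 1 \<Longrightarrow>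
    (\<i> * of_int n) ^ M * fc (\<lambda>t. outer_fun s \<kappa> L t * g L t) n = fc (\<lambda>t. outer_fun s \<kappa> L t * h L t) n"
    using fam_outer_fc[OF \<kappa> \<beta> g] by blast
  obtain C p where C: "\<And>L t. L \<ge> 1 \<Longrightarrow> norm (h L t) \<le> C * L ^ p"
    using fam_bound[OF \<kappa> \<beta> h] by blast
  have C0: "C \<ge> 0" using order_trans[OF norm_ge_zero C[of 1 0]] by simp
  have "\<bar>real_of_int n\<bar> ^ M * norm (fc (\<lambda>t. outer_fun s \<kappa> L t * g L t) n) \<le> C * L ^ p * w L" if L: "L \<ge> 1" for L n
  proof -
    have "norm (outer_fun s \<kappa> L t * h L t) \<le> C * L ^ p * w L" for t
    proof (cases "\<forall>j. \<beta> j (gap_coord \<kappa> L t) = 0")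
      case True
      then show ?thesis using fam_support[OF h, of L t] C0 L w0 by simp
    next
      case False
      then have "norm (outer_fun s \<kappa> L t) \<le> w L" using w L by blast
      then have "norm (outer_fun s \<kappa> L t) * norm (h L t) \<le> w L * (C * L ^ p)"
        using C[OF L] w0 by (intro mult_mono) auto
      then show ?thesis by (simp add: norm_mult mult_ac)
    qed
    then have "norm (fc (\<lambda>t. outer_fun s \<kappa> L t * h L t) n) \<le> C * L ^ p * w L"
      by (intro norm_fc_le periodic_cont_measurable periodic_cont_mult periodic_cont_outer[OF \<kappa> L] fam_periodic_cont[OF \<kappa> \<beta> h L])
    moreover have "norm ((\<i> * of_int n) ^ M * fc (\<lambda>t. outer_fun s \<kappa> L t * g L t) n)
        = \<bar>real_of_int n\<bar> ^ M * norm (fc (\<lambda>t. outer_fun s \<kappa> L t * g L t) n)"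
      by (simp add: norm_mult norm_power)
    ultimately show ?thesis using eq[OF L, of n] by simp
  qed
  with C0 show ?thesis by blast
qed

definition gap_step :: "real \<Rightarrow> real \<Rightarrow> real \<Rightarrow> complex" where
  "gap_step \<kappa> L t = of_real (smooth_step (gap_coord \<kappa> L t))"

text \<open>Derivatives of the cutoff live where the gap coordinate is positive, and there the outer
  function is at most exp(-L/2); differentiation costs only powers of L.\<close>

lemma outer_gap_step_fc_small:
  assumes \<kappa>: "0 < \<kappa>" "\<kappa> \<le> 1"
  shows "\<exists>C p. C \<ge> 0 \<and> (\<forall>L\<ge>1. \<forall>n. \<bar>real_of_int n\<bar> ^ M * norm (fc (\<lambda>t. outer_fun 1 \<kappa> L t * gap_step \<kappa> L t) n) \<le> C * L ^ p * exp (- L / 2))"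
proof -
  obtain \<beta> where \<beta>: "smooth_seq \<beta>" "\<beta> 0 = smooth_step" "\<And>j x. x \<le> 0 \<Longrightarrow> \<beta> j x = 0"
    using smooth_step_seq by blast
  have "fam \<kappa> \<beta> (gap_step \<kappa>)"
    using fam_base[of \<kappa> \<beta> 0] \<beta>(2) by (simp add: gap_step_def[abs_def])
  then show ?thesis
  proof (rule fam_fc_bound[OF \<kappa> \<beta>(1)])
    fix L t j assume "L \<ge> 1" "\<beta> j (gap_coord \<kappa> L t) \<noteq> 0"
    then show "norm (outer_fun 1 \<kappa> L t) \<le> exp (- L / 2)"
      using norm_outer_le_exp[OF \<kappa>, of L t] \<beta>(3)[of "gap_coord \<kappa> L t" j] by force
  qed simp
qed

lemma rapid_outer_gap_step:
  assumes \<kappa>: "0 < \<kappa>" "\<kappa> \<le> 1" and L: "L \<ge> 1"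
  shows "rapid (fc (\<lambda>t. outer_fun 1 \<kappa> L t * (1 - gap_step \<kappa> L t)))"
proof (rule rapidI)
  fix M
  obtain \<beta> where \<beta>: "smooth_seq \<beta>" "\<beta> 0 = smooth_step" "\<And>j x. x \<le> 0 \<Longrightarrow> \<beta> j x = 0"
    using smooth_step_seq by blast
  define \<gamma> where "\<gamma> j x = (if j = 0 then 1 - \<beta> 0 x else - \<beta> j x)" for j :: nat and x
  have "smooth_seq \<gamma>"
    unfolding smooth_seq_def
  proof (intro conjI allI)
    fix j x
    have "(\<beta> j has_real_derivative \<beta> (Suc j) x) (at x)" using \<beta> smooth_seq_def by blast
    then show "(\<gamma> j has_real_derivative \<gamma> (Suc j) x) (at x)"
      by (cases "j = 0") (auto simp: \<gamma>_def[abs_def] intro!: derivative_eq_intros)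
    obtain C where "\<forall>x. \<bar>\<beta> j x\<bar> \<le> C" using \<beta> unfolding smooth_seq_def by blast
    then have C: "\<bar>\<beta> j x\<bar> \<le> C" for x by blast
    have "\<bar>\<gamma> j x\<bar> \<le> 1 + C" for x
    proof (cases "j = 0")
      case True
      have "\<bar>1 - \<beta> 0 x\<bar> \<le> 1 + \<bar>\<beta> 0 x\<bar>" by linarith
      then show ?thesis using C[of x] True by (simp add: \<gamma>_def)
    next
      case False
      then show ?thesis using C[of x] by (simp add: \<gamma>_def)
    qed
    then show "\<exists>C. \<forall>x. \<bar>\<gamma> j x\<bar> \<le> C" by blast
  qed
  note \<gamma> = this
  have f: "fam \<kappa> \<gamma> (\<lambda>L t. 1 - gap_step \<kappa> L t)"
    using fam_base[of \<kappa> \<gamma> 0] \<beta>(2) by (simp add: gap_step_def[abs_def] \<gamma>_def)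
  have "\<exists>C p. C \<ge> 0 \<and> (\<forall>L\<ge>1. \<forall>n. \<bar>real_of_int n\<bar> ^ M *
      norm (fc (\<lambda>t. outer_fun 1 \<kappa> L t * (1 - gap_step \<kappa> L t)) n) \<le> C * L ^ p * 1)"
    by (rule fam_fc_bound[OF \<kappa> \<gamma> f, where w="\<lambda>_. 1"]) (simp_all add: norm_outer_le_1[OF \<kappa>])
  then obtain C p where "\<forall>n. \<bar>real_of_int n\<bar> ^ M *
      norm (fc (\<lambda>t. outer_fun 1 \<kappa> L t * (1 - gap_step \<kappa> L t)) n) \<le> C * L ^ p * 1"
    using L by blast
  then show "\<exists>C. \<forall>n. norm (fc (\<lambda>t. outer_fun 1 \<kappa> L t * (1 - gap_step \<kappa> L t)) n) * \<bar>real_of_int n\<bar> ^ M \<le> C"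
    by (intro exI[of _ "C * L ^ p"]) (auto simp: mult.commute)
qed

lemma rapid_gap_step:
  assumes \<kappa>: "0 < \<kappa>" "\<kappa> \<le> 1" and L: "L \<ge> 1"
  shows "rapid (fc (gap_step \<kappa> L))"
proof (rule rapidI)
  fix M
  obtain \<beta> where \<beta>: "smooth_seq \<beta>" "\<beta> 0 = smooth_step" "\<And>j x. x \<le> 0 \<Longrightarrow> \<beta> j x = 0"
    using smooth_step_seq by blast
  have f: "fam \<kappa> \<beta> (gap_step \<kappa>)"
    using fam_base[of \<kappa> \<beta> 0] \<beta>(2) by (simp add: gap_step_def[abs_def])
  \<comment> \<open>With s = 0 the outer function is identically 1.\<close>
  have "\<exists>C p. C \<ge> 0 \<and> (\<forall>L\<ge>1. \<forall>n. \<bar>real_of_int n\<bar> ^ M *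
      norm (fc (\<lambda>t. outer_fun 0 \<kappa> L t * gap_step \<kappa> L t) n) \<le> C * L ^ p * 1)"
    by (rule fam_fc_bound[OF \<kappa> \<beta>(1) f, where w="\<lambda>_. 1"]) (simp_all add: norm_outer_le_1[OF \<kappa>])
  then obtain C p where "\<forall>n. \<bar>real_of_int n\<bar> ^ M *
      norm (fc (\<lambda>t. outer_fun 0 \<kappa> L t * gap_step \<kappa> L t) n) \<le> C * L ^ p * 1"
    using L by blast
  moreover have "(\<lambda>t. outer_fun 0 \<kappa> L t * gap_step \<kappa> L t) = gap_step \<kappa> L"
    by (simp add: outer_fun_def)
  ultimately have "\<forall>n. \<bar>real_of_int n\<bar> ^ M * norm (fc (gap_step \<kappa> L) n) \<le> C * L ^ p * 1" by simp
  then show "\<exists>C. \<forall>n. norm (fc (gap_step \<kappa> L) n) * \<bar>real_of_int n\<bar> ^ M \<le> C"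
    by (intro exI[of _ "C * L ^ p"]) (auto simp: mult.commute)
qed

lemma periodic_cont_gap_step: "periodic_cont (gap_step \<kappa> L)"
proof -
  have "continuous_on UNIV smooth_step"
    using smooth_step_deriv by (meson DERIV_isCont continuous_at_imp_continuous_on)
  then have "continuous_on UNIV (\<lambda>t. smooth_step (gap_coord \<kappa> L t))"
    unfolding gap_coord_def by (rule continuous_on_compose2) (auto intro!: continuous_intros)
  then show ?thesis unfolding periodic_cont_def gap_step_def gap_coord_periodic
    by (simp add: continuous_on_of_real)
qed

lemma norm_gap_step_le: "norm (gap_step \<kappa> L t) \<le> 1" "norm (1 - gap_step \<kappa> L t) \<le> 1"
proof -
  let ?x = "smooth_step (gap_coord \<kappa> L t)"
  have "\<bar>?x\<bar> \<le> 1" "\<bar>1 - ?x\<bar> \<le> 1" using smooth_step_bounds[of "gap_coord \<kappa> L t"] by linarith+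
  moreover have "1 - gap_step \<kappa> L t = of_real (1 - ?x)" by (simp add: gap_step_def)
  ultimately show "norm (gap_step \<kappa> L t) \<le> 1" "norm (1 - gap_step \<kappa> L t) \<le> 1"
    unfolding gap_step_def by (simp_all only: norm_of_real)
qed

section \<open>Outer functions\<close>

text \<open>All powers cis (-t)^n with n > 0 have mean 0. Since R > 1 the Taylor coefficients are
  absolutely summable, which allows integration term by term.\<close>

lemma mean_value_angle:
  assumes G: "G holomorphic_on ball 0 R" and R: "R > 1"
  shows "(LINT t|angle_measure. G (cis (- t))) = G 0"
proof -
  define a where "a n = (deriv ^^ n) G 0 / fact n" for n
  have s: "(\<lambda>n. a n * z ^ n) sums G z" if "norm z < R" for z
    using holomorphic_power_series[OF G, of z] that by (simp add: a_def)
  have "summable (\<lambda>n. a n * of_real ((1 + R) / 2) ^ n)"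
    using s[of "of_real ((1 + R) / 2)"] R by (intro sums_summable) (simp add: norm_of_real del: of_real_divide)
  then have abs: "summable (\<lambda>n. norm (a n))"
    using powser_insidea[of a "of_real ((1 + R) / 2)" 1] R by (simp add: norm_of_real del: of_real_divide)
  have m: "(\<lambda>t. a n * cis (- t) ^ n) \<in> borel_measurable borel" for n
    by (intro borel_measurable_continuous_onI continuous_intros)
  have int: "integrable angle_measure (\<lambda>t. a n * cis (- t) ^ n)" for n
    by (rule integrable_angle[OF m, where C="norm (a n)"]) (simp add: norm_mult norm_power)
  have "(\<lambda>n. LINT t|angle_measure. a n * cis (- t) ^ n) sums (LINT t|angle_measure. (\<Sum>n. a n * cis (- t) ^ n))"
    using abs by (intro sums_integral int) (auto simp: norm_mult norm_power measure_angle_UNIV)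
  moreover have "(\<Sum>n. a n * cis (- t) ^ n) = G (cis (- t))" for t
    using sums_unique[OF s, of "cis (- t)"] R by simp
  moreover have "(LINT t|angle_measure. a n * cis (- t) ^ n) = (if n = 0 then a 0 else 0)" for n
  proof -
    have "cis (- t) ^ n = cis (of_int (- int n) * t)" for t
      using Complex.DeMoivre[of "- t" n] by simp
    then have "(LINT t|angle_measure. a n * cis (- t) ^ n) = a n * (LINT t|angle_measure. cis (of_int (- int n) * t))"
      by (simp only: integral_mult_right_zero)
    then show ?thesis unfolding integral_cis by (cases "n = 0") simp_all
  qed
  ultimately have "(\<lambda>n. if n = 0 then a 0 else 0) sums (LINT t|angle_measure. G (cis (- t)))" by simp
  moreover have "(\<lambda>n. if n = 0 then a 0 else 0) sums a 0" using sums_single[of 0 "\<lambda>_. a 0"] by simp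
  ultimately show ?thesis using sums_unique2 by (fastforce simp: a_def)
qed

text \<open>The holomorphic extension of the outer function in z = cis (-t). Because of the sign,
  powers of z are nonpositive frequencies in t.\<close>

definition outer_ext :: "real \<Rightarrow> real \<Rightarrow> complex \<Rightarrow> complex" where
  "outer_ext \<kappa> L z = exp (- (of_real \<kappa> * (1 / (of_real (1 + \<kappa> / L) - z))))"

lemma outer_fun_eq_ext: "outer_fun 1 \<kappa> L t = outer_ext \<kappa> L (cis (- t))"
  by (simp add: outer_fun_def outer_ext_def pole_fun_def)

lemma outer_ext_holomorphic: "outer_ext \<kappa> L holomorphic_on ball 0 (1 + \<kappa> / L)"
proof -
  have "of_real (1 + \<kappa> / L) - z \<noteq> 0" if "z \<in> ball 0 (1 + \<kappa> / L)" for z :: complex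
  proof
    assume "of_real (1 + \<kappa> / L) - z = 0"
    then have "z = of_real (1 + \<kappa> / L)" by simp
    then have "norm z = \<bar>1 + \<kappa> / L\<bar>" by (simp only: norm_of_real)
    then show False using that by simp
  qed
  then show ?thesis unfolding outer_ext_def by (intro holomorphic_intros)
qed

context
  fixes \<kappa> L :: real
  assumes \<kappa>: "0 < \<kappa>" "\<kappa> \<le> 1" and L: "1 \<le> L"
begin

lemma radius_gt_1: "1 < 1 + \<kappa> / L"
  using \<kappa> L by simp

text \<open>A positive coefficient is the mean of a holomorphic function multiplied by z^m, which
  vanishes at the origin.\<close>

lemma fc_outer_pos:
  assumes "m > 0" shows "fc (outer_fun 1 \<kappa> L) m = 0"
proof -
  have "cis (- (of_int m * t)) = cis (- t) ^ nat m" for t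
    using Complex.DeMoivre[of "- t" "nat m"] assms by simp
  then have "fc (outer_fun 1 \<kappa> L) m = (LINT t|angle_measure. outer_ext \<kappa> L (cis (- t)) * cis (- t) ^ nat m)"
    unfolding fc_def outer_fun_eq_ext by (simp only:)
  also have "\<dots> = outer_ext \<kappa> L 0 * 0 ^ nat m"
    by (rule mean_value_angle[where G="\<lambda>z. outer_ext \<kappa> L z * z ^ nat m" and R="1 + \<kappa> / L"])
      (intro holomorphic_intros outer_ext_holomorphic, rule radius_gt_1)
  finally show ?thesis using assms by simp
qed

lemma integral_outer_scale:
  assumes "N \<ge> 1"
  shows "(LINT t|angle_measure. outer_fun 1 \<kappa> L (real N * t)) = outer_ext \<kappa> L 0"
proof -
  \<comment> \<open>The N-th root of the radius of holomorphy, so that z^N maps the disc of radius R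
    into the domain of \<open>outer_ext\<close>.\<close>
  define R where "R = root N (1 + \<kappa> / L)"
  have R: "R > 1" "R ^ N = 1 + \<kappa> / L"
    using assms radius_gt_1 unfolding R_def by (auto simp: real_root_gt_1_iff)
  have "outer_ext \<kappa> L holomorphic_on (\<lambda>z. z ^ N) ` ball 0 R"
  proof (rule holomorphic_on_subset[OF outer_ext_holomorphic])
    have "norm z ^ N < R ^ N" if "norm z < R" for z :: complex
      using that assms by (intro power_strict_mono) auto
    then show "(\<lambda>z::complex. z ^ N) ` ball 0 R \<subseteq> ball 0 (1 + \<kappa> / L)"
      unfolding R(2)[symmetric] by (intro image_subsetI) (simp add: norm_power dist_norm)
  qed
  then have hol: "(outer_ext \<kappa> L \<circ> (\<lambda>z. z ^ N)) holomorphic_on ball 0 R"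
    by (intro holomorphic_on_compose holomorphic_intros)
  have "(LINT t|angle_measure. outer_fun 1 \<kappa> L (real N * t)) = (LINT t|angle_measure. (outer_ext \<kappa> L \<circ> (\<lambda>z. z ^ N)) (cis (- t)))"
  proof -
    have "cis (- (real N * t)) = cis (- t) ^ N" for t using Complex.DeMoivre[of "- t" N] by simp
    then show ?thesis by (simp add: outer_fun_eq_ext)
  qed
  also have "\<dots> = (outer_ext \<kappa> L \<circ> (\<lambda>z. z ^ N)) 0" by (rule mean_value_angle[OF hol R(1)])
  finally show ?thesis using assms by (simp add: power_0_left)
qed

lemma Re_outer_ext_0: "1 - \<kappa> \<le> Re (outer_ext \<kappa> L 0)"
proof -
  have "outer_ext \<kappa> L 0 = exp (of_real (- (\<kappa> / (1 + \<kappa> / L))))"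
    by (simp add: outer_ext_def)
  then have "Re (outer_ext \<kappa> L 0) = exp (- (\<kappa> / (1 + \<kappa> / L)))"
    by (simp only: exp_of_real Re_complex_of_real)
  moreover have "\<kappa> / (1 + \<kappa> / L) \<le> \<kappa>"
    using \<kappa> L by (intro divide_le_eq[THEN iffD2]) (auto simp: distrib_left add_pos_pos)
  then have "1 - \<kappa> \<le> 1 + - (\<kappa> / (1 + \<kappa> / L))" by simp
  ultimately show ?thesis using exp_ge_add_one_self[of "- (\<kappa> / (1 + \<kappa> / L))"] by linarith
qed

definition factor_fun :: "real \<Rightarrow> complex" where
  "factor_fun t = outer_fun 1 \<kappa> L t * (1 - gap_step \<kappa> L t)"

lemma periodic_cont_factor_fun: "periodic_cont factor_fun"
  unfolding factor_fun_def[abs_def]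
  by (intro periodic_cont_mult periodic_cont_diff periodic_cont_const periodic_cont_outer[OF \<kappa> L] periodic_cont_gap_step)

lemma norm_factor_fun_le: "norm (factor_fun t) \<le> 1"
  unfolding factor_fun_def norm_mult using norm_outer_le_1[OF \<kappa> L, of 1 t] norm_gap_step_le
  by (intro mult_le_one) auto

lemma rapid_factor_fun: "rapid (fc factor_fun)"
  unfolding factor_fun_def[abs_def] by (rule rapid_outer_gap_step[OF \<kappa> L])

lemma factor_fun_eq_0: "gap_coord \<kappa> L t \<ge> 1 \<Longrightarrow> factor_fun t = 0"
  by (simp add: factor_fun_def gap_step_def smooth_step_eq_1)

text \<open>The outer part has no positive coefficients; only the tiny correction that creates the
  zeros contributes.\<close>

lemma fc_factor_fun_pos:
  assumes "m > 0" shows "fc factor_fun m = - fc (\<lambda>t. outer_fun 1 \<kappa> L t * gap_step \<kappa> L t) m"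
proof -
  have "factor_fun = (\<lambda>t. outer_fun 1 \<kappa> L t - outer_fun 1 \<kappa> L t * gap_step \<kappa> L t)"
    by (simp add: factor_fun_def[abs_def] algebra_simps)
  then show ?thesis
    using fc_outer_pos[OF assms]
    by (simp add: fc_diff periodic_cont_mult periodic_cont_outer[OF \<kappa> L] periodic_cont_gap_step)
qed

lemma norm_outer_gap_step_le: "norm (outer_fun 1 \<kappa> L t * gap_step \<kappa> L t) \<le> exp (- L / 2)"
proof (cases "0 \<le> gap_coord \<kappa> L t")
  case True
  then show ?thesis unfolding norm_mult
    using norm_outer_le_exp[OF \<kappa> L True] norm_gap_step_le(1)[of \<kappa> L t]
    by (meson mult_left_le norm_ge_zero order_trans)
qed (simp add: gap_step_def smooth_step_eq_0)

text \<open>The deviation of the outer factor from 1 is controlled in the quadratic mean by its value at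
  the origin; AM-GM with weight \<open>\<sigma>\<close> transfers this to the mean.\<close>

lemma integral_factor_fun_close:
  assumes N: "N \<ge> 1" and \<sigma>: "\<sigma> > 0" "\<sigma>\<^sup>2 = 2 * \<kappa>"
  shows "(LINT t|angle_measure. norm (1 - factor_fun (real N * t))) \<le> \<sigma> + exp (- L / 2)"
proof -
  let ?h = "\<lambda>t. outer_fun 1 \<kappa> L (real N * t)"
  have h: "periodic_cont ?h" by (rule periodic_cont_scale[OF periodic_cont_outer[OF \<kappa> L]])
  have f: "periodic_cont (\<lambda>t. factor_fun (real N * t))" by (rule periodic_cont_scale[OF periodic_cont_factor_fun])
  have hr: "integrable angle_measure (\<lambda>t. Re (?h t))" by (intro integrable_Re integrable_periodic_cont h)
  have const: "integrable angle_measure (\<lambda>t. c)" for c :: real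
    by (rule finite_measure.integrable_const[OF finite_measure_angle])
  have bd: "norm (1 - factor_fun (real N * t)) \<le> (\<sigma> / 2 + 1 / \<sigma> + exp (- L / 2)) - (1 / \<sigma>) * Re (?h t)" for t
  proof -
    define w where "w = ?h t"
    have w: "norm w \<le> 1" using norm_outer_le_1[OF \<kappa> L, of 1 "real N * t"] by (simp add: w_def)
    have "1 - factor_fun (real N * t) = (1 - w) + outer_fun 1 \<kappa> L (real N * t) * gap_step \<kappa> L (real N * t)"
      by (simp add: factor_fun_def w_def algebra_simps)
    then have "norm (1 - factor_fun (real N * t)) \<le> norm (1 - w) + exp (- L / 2)"
      using norm_triangle_ineq[of "1 - w" "outer_fun 1 \<kappa> L (real N * t) * gap_step \<kappa> L (real N * t)"]
        norm_outer_gap_step_le[of "real N * t"] by (simp only:)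
    moreover have "norm (1 - w) \<le> \<sigma> / 2 + (norm (1 - w))\<^sup>2 / (2 * \<sigma>)"
    proof -
      have "0 \<le> (\<sigma> - norm (1 - w))\<^sup>2" by simp
      then show ?thesis using \<sigma>(1) by (simp add: field_simps power2_eq_square)
    qed
    moreover have "(norm (1 - w))\<^sup>2 / (2 * \<sigma>) \<le> (2 - 2 * Re w) / (2 * \<sigma>)"
    proof (rule divide_right_mono)
      have "(norm (1 - w))\<^sup>2 = 1 - 2 * Re w + (norm w)\<^sup>2"
        unfolding cmod_power2 by (simp add: power2_eq_square algebra_simps)
      also have "(norm w)\<^sup>2 \<le> 1" using w by (simp add: power_le_one)
      finally show "(norm (1 - w))\<^sup>2 \<le> 2 - 2 * Re w" by simp
    qed (use \<sigma> in simp)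
    moreover have "(2 - 2 * Re w) / (2 * \<sigma>) = 1 / \<sigma> - (1 / \<sigma>) * Re w"
      using \<sigma>(1) by (simp add: field_simps)
    ultimately show ?thesis unfolding w_def by linarith
  qed
  have "(LINT t|angle_measure. norm (1 - factor_fun (real N * t)))
      \<le> (LINT t|angle_measure. (\<sigma> / 2 + 1 / \<sigma> + exp (- L / 2)) - (1 / \<sigma>) * Re (?h t))"
    using hr const bd
    by (intro integral_mono integrable_norm integrable_periodic_cont periodic_cont_diff periodic_cont_const f
        Bochner_Integration.integrable_diff integrable_mult_right) auto
  also have "\<dots> = (\<sigma> / 2 + 1 / \<sigma> + exp (- L / 2)) - (1 / \<sigma>) * (LINT t|angle_measure. Re (?h t))"
    using hr const by (simp add: measure_angle_UNIV)
  also have "(LINT t|angle_measure. Re (?h t)) = Re (outer_ext \<kappa> L 0)"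
    using integral_Re[OF integrable_periodic_cont[OF h]] integral_outer_scale[OF N] by simp
  also have "(\<sigma> / 2 + 1 / \<sigma> + exp (- L / 2)) - (1 / \<sigma>) * Re (outer_ext \<kappa> L 0)
      \<le> (\<sigma> / 2 + 1 / \<sigma> + exp (- L / 2)) - (1 / \<sigma>) * (1 - \<kappa>)"
    using Re_outer_ext_0 \<sigma> by (intro diff_left_mono mult_left_mono) auto
  also have "\<dots> = \<sigma> + exp (- L / 2)"
  proof -
    \<comment> \<open>The two error terms \<sigma>/2 and \<kappa>/\<sigma> are balanced by
      \<sigma>^2 = 2 \<kappa>.\<close>
    have "\<kappa> / \<sigma> = \<sigma> / 2" using \<sigma> by (simp add: field_simps power2_eq_square)
    moreover have "(1 / \<sigma>) * (1 - \<kappa>) = 1 / \<sigma> - \<kappa> / \<sigma>" by (simp add: diff_divide_distrib)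
    ultimately show ?thesis by linarith
  qed
  finally show ?thesis .
qed

end

section \<open>Adding one factor to the product\<close>

text \<open>The finitely many ratios with n < n0 have a maximum, so an infinite supremum must be
  produced by arbitrarily large n.\<close>

lemma growth_unbounded:
  fixes \<Omega> :: "nat \<Rightarrow> real"
  assumes "(SUP n\<in>{1<..}. ereal (\<Omega> n / ln (real n))) = \<infinity>"
  shows "\<exists>n\<ge>n0. C * ln (real n) \<le> \<Omega> n"
proof (rule ccontr)
  assume "\<not> ?thesis"
  then have less: "\<Omega> n < C * ln (real n)" if "n \<ge> n0" for n using that by (meson not_le)
  define D where "D = Max (insert C ((\<lambda>n. \<Omega> n / ln (real n)) ` {..<n0}))"
  have "\<Omega> n / ln (real n) \<le> D" if "n > 1" for n
  proof (cases "n < n0")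
    case True
    then show ?thesis unfolding D_def by (intro Max_ge) auto
  next
    case False
    then have "\<Omega> n / ln (real n) \<le> C" using less[of n] that by (simp add: divide_le_eq ln_gt_zero)
    also have "C \<le> D" unfolding D_def by (intro Max_ge) auto
    finally show ?thesis .
  qed
  then have "(SUP n\<in>{1<..}. ereal (\<Omega> n / ln (real n))) \<le> ereal D" by (intro SUP_least) auto
  then show False using assms by simp
qed

lemma ln_power_over_tendsto: "((\<lambda>n. ln (real n) ^ p / real n) \<longlongrightarrow> 0) sequentially"
proof -
  have "filterlim (\<lambda>n. ln (real n)) at_top sequentially"
    by (rule filterlim_compose[OF ln_at_top filterlim_real_sequentially])
  from filterlim_compose[OF tendsto_power_div_exp_0 this]
  have "((\<lambda>n. ln (real n) ^ p / exp (ln (real n))) \<longlongrightarrow> 0) sequentially" .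
  then show ?thesis
    by (rule Lim_transform_eventually) (auto intro: eventually_mono[OF eventually_gt_at_top[of 0]])
qed

context
  fixes P :: "real \<Rightarrow> complex" and k :: nat and \<kappa> :: real
  assumes P: "periodic_cont P" "rapid (fc P)" and \<kappa>: "0 < \<kappa>" "\<kappa> \<le> 1"
begin

text \<open>In the sum over m from \<open>fc_mult_scale\<close>, terms with m < 0 involve
  coefficients of P beyond N and give C/N, and terms with m > 0 contain positive coefficients of the
  factor and give the exponential. C, D and p depend on P, k and \<kappa> but not on L, N, n, so N
  may be chosen afterwards.\<close>

lemma product_coeff_bound:
  obtains C D p where "C \<ge> 0" "D \<ge> 0"
    "\<And>L N n. L \<ge> 1 \<Longrightarrow> N \<ge> 1 \<Longrightarrow> n \<ge> 1 \<Longrightarrow>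
      norm (fc (\<lambda>t. P t * factor_fun \<kappa> L (real N * t)) n) * of_int n ^ k
        \<le> norm (fc P n) * of_int n ^ k + (C / real N + D * real N ^ k * L ^ p * exp (- L / 2))"
proof -
  obtain C1 where C1: "C1 \<ge> 0" "\<And>n. norm (fc P n) * (1 + \<bar>real_of_int n\<bar>) ^ (k + 2) \<le> C1"
    using rapidD[OF P(2)] by blast
  obtain C2 where C2: "C2 \<ge> 0" "\<And>n. norm (fc P n) * (1 + \<bar>real_of_int n\<bar>) ^ k \<le> C2"
    using rapidD[OF P(2)] by blast
  obtain C3 p where C3: "C3 \<ge> 0" "\<And>L n. L \<ge> 1 \<Longrightarrow> \<bar>real_of_int n\<bar> ^ (k + 2) *
      norm (fc (\<lambda>t. outer_fun 1 \<kappa> L t * gap_step \<kappa> L t) n) \<le> C3 * L ^ p * exp (- L / 2)"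
    using outer_gap_step_fc_small[OF \<kappa>, of "k + 2"] by blast
  let ?S = "\<Sum>\<^sub>\<infinity>m::int. 1 / (1 + \<bar>real_of_int m\<bar>)\<^sup>2"
  have S0: "?S \<ge> 0" by (intro infsum_nonneg) auto
  have main: "norm (fc (\<lambda>t. P t * factor_fun \<kappa> L (real N * t)) n) * of_int n ^ k
        \<le> norm (fc P n) * of_int n ^ k + ((4 * C1 * ?S) / real N + (4 * C2 * C3 * ?S) * real N ^ k * L ^ p * exp (- L / 2))"
    if L: "L \<ge> 1" and N: "N \<ge> 1" and n: "n \<ge> 1" for L N n
  proof -
    define f where "f = fc (factor_fun \<kappa> L)"
    define E where "E = C3 * L ^ p * exp (- L / 2)"
    \<comment> \<open>A common constant for both signs of m: each term with m nonzero is at most T /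
      (1 + |m|)^2.\<close>
    define T where "T = 4 * C1 / real N + 4 * C2 * real N ^ k * E"
    have E0: "E \<ge> 0" unfolding E_def using C3 L by simp
    have T0: "T \<ge> 0" unfolding T_def using C1 C2 E0 by simp
    have f1: "norm (f m) \<le> 1" for m unfolding f_def
      by (rule norm_fc_le[OF periodic_cont_measurable[OF periodic_cont_factor_fun[OF \<kappa> L]] norm_factor_fun_le[OF \<kappa> L]])
    have fs: "(\<lambda>m. norm (f m)) summable_on UNIV"
      unfolding f_def by (rule rapid_abs_summable[OF rapid_factor_fun[OF \<kappa> L]])
    have sq: "(1 + real_of_int m) ^ 2 \<le> 4 * real_of_int m ^ 2" if "m \<ge> 1" for m :: int
    proof -
      have "(1 + real_of_int m) ^ 2 \<le> (2 * real_of_int m) ^ 2" using that by (intro power_mono) auto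
      then show ?thesis by (simp add: power_mult_distrib)
    qed
    have neg: "norm (f m) * norm (fc P (n - m * int N)) * of_int n ^ k \<le> T / (1 + \<bar>real_of_int m\<bar>) ^ 2" if m: "m < 0" for m
    proof -
      define q where "q = - m"
      have q: "q \<ge> 1" using m by (simp add: q_def)
      define x where "x = real_of_int (n - m * int N)"
      have x: "x = of_int n + of_int q * real N" by (simp add: x_def q_def)
      have xn: "of_int n \<le> 1 + \<bar>x\<bar>" "of_int q * real N \<le> 1 + \<bar>x\<bar>" using n q by (auto simp: x)
      have "norm (fc P (n - m * int N)) * (of_int n ^ k * (of_int q * real N) ^ 2)
          \<le> norm (fc P (n - m * int N)) * ((1 + \<bar>x\<bar>) ^ k * (1 + \<bar>x\<bar>) ^ 2)"
        using xn n q by (intro mult_left_mono mult_mono power_mono) auto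
      also have "\<dots> \<le> C1" using C1(2)[of "n - m * int N"] unfolding x_def power_add .
      finally have a: "norm (fc P (n - m * int N)) * of_int n ^ k * (of_int q * real N) ^ 2 \<le> C1" by (simp add: mult.assoc)
      \<comment> \<open>The two spare powers of n + qN yield the summable factor in q and a factor
        1/N.\<close>
      have "(1 + real_of_int q) ^ 2 * real N \<le> 4 * (of_int q * real N) ^ 2"
      proof -
        have "(1 + real_of_int q) ^ 2 * real N \<le> (4 * real_of_int q ^ 2) * (real N * real N)"
          using sq[OF q] N by (intro mult_mono) auto
        then show ?thesis by (simp add: power2_eq_square mult_ac)
      qed
      then have "norm (fc P (n - m * int N)) * of_int n ^ k * ((1 + real_of_int q) ^ 2 * real N)
          \<le> norm (fc P (n - m * int N)) * of_int n ^ k * (4 * (of_int q * real N) ^ 2)"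
        using n by (intro mult_left_mono mult_nonneg_nonneg) auto
      also have "\<dots> \<le> 4 * C1" using a by simp
      finally have b: "norm (fc P (n - m * int N)) * of_int n ^ k \<le> (4 * C1 / real N) / (1 + real_of_int q) ^ 2"
        using N q by (simp add: field_simps)
      have "norm (f m) * (norm (fc P (n - m * int N)) * of_int n ^ k) \<le> 1 * (norm (fc P (n - m * int N)) * of_int n ^ k)"
        using f1 n by (intro mult_right_mono) auto
      also have "\<dots> \<le> (4 * C1 / real N) / (1 + real_of_int q) ^ 2" using b by simp
      also have "\<dots> \<le> T / (1 + real_of_int q) ^ 2"
        unfolding T_def using C2 E0 by (intro divide_right_mono) auto
      finally show ?thesis using m by (simp add: q_def mult.assoc)
    qed
    have pos: "norm (f m) * norm (fc P (n - m * int N)) * of_int n ^ k \<le> T / (1 + \<bar>real_of_int m\<bar>) ^ 2" if m: "m > 0" for m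
    proof -
      define x where "x = \<bar>real_of_int (n - m * int N)\<bar>"
      define y where "y = of_int m * real N"
      have m1: "real_of_int m \<ge> 1" using m by linarith
      have y: "y \<ge> 1" unfolding y_def using mult_mono[of 1 "real_of_int m" 1 "real N"] m1 N by simp
      \<comment> \<open>The weight n^k is shared out: (1 + x)^k is absorbed by the decay of P, and
        y^k = (mN)^k by the small coefficient of the factor, whence the power N^k in the
        bound.\<close>
      have "real_of_int n \<le> x + y" unfolding x_def y_def by simp
      also have "\<dots> \<le> (1 + x) * y"
        using y mult_left_mono[of 1 y x] by (simp add: x_def distrib_right)
      finally have "of_int n ^ k \<le> ((1 + x) * y) ^ k" using n by (intro power_mono) auto
      then have "norm (f m) * norm (fc P (n - m * int N)) * of_int n ^ k
          \<le> norm (f m) * norm (fc P (n - m * int N)) * ((1 + x) * y) ^ k" by (intro mult_left_mono) auto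
      also have "\<dots> = (norm (fc P (n - m * int N)) * (1 + x) ^ k) * (norm (f m) * y ^ k)"
        by (simp add: power_mult_distrib mult_ac)
      also have "\<dots> \<le> C2 * (norm (f m) * y ^ k)"
        using C2(2)[of "n - m * int N"] y unfolding x_def by (intro mult_right_mono) auto
      also have "norm (f m) * y ^ k \<le> 4 * real N ^ k * E / (1 + real_of_int m) ^ 2"
      proof -
        have "norm (f m) = norm (fc (\<lambda>t. outer_fun 1 \<kappa> L t * gap_step \<kappa> L t) m)"
          unfolding f_def fc_factor_fun_pos[OF \<kappa> L m] by simp
        then have "real_of_int m ^ (k + 2) * norm (f m) \<le> E" using C3(2)[OF L, of m] m by (simp add: E_def)
        then have e: "norm (f m) * real_of_int m ^ k * (real_of_int m) ^ 2 \<le> E" unfolding power_add by (simp add: mult_ac)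
        have "norm (f m) * real_of_int m ^ k * (1 + real_of_int m) ^ 2 \<le> norm (f m) * real_of_int m ^ k * (4 * real_of_int m ^ 2)"
          using sq[of m] m by (intro mult_left_mono mult_nonneg_nonneg) auto
        also have "\<dots> \<le> 4 * E" using e by simp
        finally have "norm (f m) * real_of_int m ^ k \<le> 4 * E / (1 + real_of_int m) ^ 2"
          using m1 by (simp add: pos_le_divide_eq)
        then have "(norm (f m) * real_of_int m ^ k) * real N ^ k \<le> (4 * E / (1 + real_of_int m) ^ 2) * real N ^ k"
          by (intro mult_right_mono) auto
        then show ?thesis by (simp add: y_def power_mult_distrib mult_ac)
      qed
      then have "C2 * (norm (f m) * y ^ k) \<le> C2 * (4 * real N ^ k * E / (1 + real_of_int m) ^ 2)"
        using C2(1) by (rule mult_left_mono)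
      also have "\<dots> \<le> T / (1 + real_of_int m) ^ 2"
        unfolding T_def times_divide_eq_right using C1 by (intro divide_right_mono) (auto simp: mult_ac)
      finally show ?thesis using m by simp
    qed
    \<comment> \<open>As the factor has modulus at most 1, so has its mean. The constant 1 here
      makes errors of successive stages add up instead of multiplying.\<close>
    have zero: "norm (f 0) * norm (fc P (n - 0 * int N)) * of_int n ^ k \<le> norm (fc P n) * of_int n ^ k"
      using mult_right_mono[OF f1[of 0], of "norm (fc P n) * of_int n ^ k"] n by (simp add: mult.assoc)
    let ?g = "\<lambda>m::int. (if m = 0 then norm (fc P n) * of_int n ^ k else 0) + T * (1 / (1 + \<bar>real_of_int m\<bar>) ^ 2)"
    let ?a = "\<lambda>m. f m * fc P (n - m * int N) * of_real (of_int n ^ k)"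
    have ag: "norm (?a m) \<le> ?g m" for m
    proof -
      have "norm (?a m) = norm (f m) * norm (fc P (n - m * int N)) * of_int n ^ k"
        unfolding norm_mult norm_of_real using n by (simp add: power_abs)
      also have "\<dots> \<le> ?g m"
        using neg[of m] pos[of m] zero T0 by (cases m "0::int" rule: linorder_cases) auto
      finally show ?thesis .
    qed
    have g1: "(\<lambda>m::int. if m = 0 then norm (fc P n) * of_int n ^ k else 0) summable_on UNIV"
      by (subst summable_on_cong_neutral[where T="{0}" and g="\<lambda>_. norm (fc P n) * of_int n ^ k"]) auto
    have g2: "(\<lambda>m::int. T * (1 / (1 + \<bar>real_of_int m\<bar>) ^ 2)) summable_on UNIV"
      by (intro summable_on_cmult_right summable_on_int_inverse_square)
    have gs: "?g summable_on UNIV" by (rule summable_on_add[OF g1 g2])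
    have as: "(\<lambda>m. norm (?a m)) summable_on UNIV" by (rule summable_on_comparison_test[OF gs ag]) auto
    have "norm (fc (\<lambda>t. P t * factor_fun \<kappa> L (real N * t)) n) * of_int n ^ k
        = norm (fc (\<lambda>t. P t * factor_fun \<kappa> L (real N * t)) n * of_real (of_int n ^ k))"
      unfolding norm_mult norm_of_real using n by (simp add: power_abs)
    also have "fc (\<lambda>t. P t * factor_fun \<kappa> L (real N * t)) n * of_real (of_int n ^ k) = infsum ?a UNIV"
      unfolding fc_mult_scale[OF P(1) periodic_cont_factor_fun[OF \<kappa> L] fs[unfolded f_def]] infsum_cmult_left'
      unfolding f_def ..
    also have "norm \<dots> \<le> (\<Sum>\<^sub>\<infinity>m. norm (?a m))" by (rule norm_infsum_bound[OF as])
    also have "\<dots> \<le> infsum ?g UNIV" by (rule infsum_mono[OF as gs ag])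
    also have "\<dots> = norm (fc P n) * of_int n ^ k + T * ?S"
    proof -
      have "(\<Sum>\<^sub>\<infinity>m::int. if m = 0 then norm (fc P n) * of_int n ^ k else 0) = norm (fc P n) * of_int n ^ k"
        by (subst infsum_cong_neutral[where T="{0}" and g="\<lambda>_. norm (fc P n) * of_int n ^ k"]) auto
      moreover have "(\<Sum>\<^sub>\<infinity>m::int. T * (1 / (1 + \<bar>real_of_int m\<bar>) ^ 2)) = T * ?S"
        unfolding infsum_cmult_right' ..
      ultimately show ?thesis unfolding infsum_add[OF g1 g2] by (simp only:)
    qed
    finally show ?thesis unfolding T_def E_def by (simp add: algebra_simps)
  qed
  show ?thesis
    by (rule that[OF _ _ main]) (use S0 C1 C2 C3 in auto)
qed

text \<open>With \<open>L\<close> a multiple of \<open>ln N\<close>, the outer factor is at most a negative power of \<open>N\<close> on the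
  gaps, while the gaps still have relative length of order \<open>1 / ln N\<close>; the growth hypothesis on
  \<open>\<Omega>\<close> is used for this length.\<close>

lemma product_step:
  fixes \<Omega> :: "nat \<Rightarrow> real"
  assumes \<Omega>: "\<And>C n0. \<exists>n\<ge>n0. C * ln (real n) \<le> \<Omega> n" and \<delta>: "\<delta> > 0"
  obtains M L where "M \<ge> 1" "M \<ge> k" "L \<ge> 1" "exp (- L / 2) \<le> \<delta>" "real k \<le> \<Omega> M * (\<kappa> / (32 * L))"
    "\<And>n. n \<ge> 1 \<Longrightarrow> norm (fc (\<lambda>t. P t * factor_fun \<kappa> L (real (2 * M) * t)) n) * of_int n ^ k
        \<le> norm (fc P n) * of_int n ^ k + 1 / 2 ^ k"
proof -
  obtain C D p where C: "C \<ge> 0" "D \<ge> 0"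
    "\<And>L N n. L \<ge> 1 \<Longrightarrow> N \<ge> 1 \<Longrightarrow> n \<ge> 1 \<Longrightarrow>
      norm (fc (\<lambda>t. P t * factor_fun \<kappa> L (real N * t)) n) * of_int n ^ k
        \<le> norm (fc P n) * of_int n ^ k + (C / real N + D * real N ^ k * L ^ p * exp (- L / 2))"
    using product_coeff_bound by blast
  \<comment> \<open>With L = a ln N this gives exp(-L/2) = N^-(k+1), which beats N^k and leaves 1/N
    to absorb the powers of ln N.\<close>
  define a where "a = 2 * (real k + 1)"
  have a: "a \<ge> 2" by (simp add: a_def)
  \<comment> \<open>The power 0 makes C/N another instance of
    \<open>ln_power_over_tendsto\<close>.\<close>
  have "(\<lambda>N. C * (ln (real N) ^ 0 / real N) + D * a ^ p * (ln (real N) ^ p / real N)) \<longlonglongrightarrow> C * 0 + D * a ^ p * 0"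
    by (intro tendsto_intros ln_power_over_tendsto)
  then have "\<forall>\<^sub>F N in sequentially. C * (ln (real N) ^ 0 / real N) + D * a ^ p * (ln (real N) ^ p / real N) < 1 / 2 ^ k"
    by (intro order_tendstoD(2)) auto
  moreover have "\<forall>\<^sub>F N in sequentially. 1 / real N < \<delta>"
    using \<delta> by (intro order_tendstoD(2)[OF lim_1_over_n]) auto
  ultimately have "\<forall>\<^sub>F N in sequentially. C * (ln (real N) ^ 0 / real N) + D * a ^ p * (ln (real N) ^ p / real N) < 1 / 2 ^ k \<and> 1 / real N < \<delta>"
    by (rule eventually_conj)
  then obtain N0 where N0: "\<And>N. N \<ge> N0 \<Longrightarrow> C * (ln (real N) ^ 0 / real N) + D * a ^ p * (ln (real N) ^ p / real N) < 1 / 2 ^ k \<and> 1 / real N < \<delta>"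
    unfolding eventually_sequentially by blast
  \<comment> \<open>The target is 32 k L / \<kappa> <= \<Omega> M, and L <= 2 a ln M. The summand 3
    in the lower bound gives exp 1 <= 2 M, hence ln N >= 1, and 2 M <= M^2.\<close>
  obtain M where M: "M \<ge> N0 + k + 3" "64 * real k * a / \<kappa> * ln (real M) \<le> \<Omega> M" using \<Omega> by blast
  \<comment> \<open>Growth is required at half the spacing, since
    \<open>fourier_coeff_gap_bound\<close> only sees frequencies of size at least N/2.\<close>
  define N where "N = 2 * M"
  define L where "L = a * ln (real N)"
  have N: "N \<ge> N0" "N \<ge> 1" "real N > 0" using M by (auto simp: N_def)
  have "1 \<le> ln (real N)"
  proof -
    have "exp 1 \<le> real N" using exp_le M(1) by (simp add: N_def)
    then show ?thesis using N by (simp add: ln_ge_iff)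
  qed
  then have L: "L \<ge> 1" unfolding L_def using mult_mono[of 1 a 1 "ln (real N)"] a by simp
  have ex: "exp (- L / 2) = 1 / real N ^ (k + 1)"
  proof -
    have "- L / 2 = - (real (k + 1) * ln (real N))" by (simp add: L_def a_def)
    also have "exp \<dots> = 1 / exp (real (k + 1) * ln (real N))" by (simp add: exp_minus divide_inverse)
    also have "exp (real (k + 1) * ln (real N)) = real N ^ (k + 1)"
      unfolding exp_of_nat_mult using N by simp
    finally show ?thesis .
  qed
  show ?thesis
  proof (rule that[of M L])
    show "M \<ge> 1" "M \<ge> k" "L \<ge> 1" using M L by auto
    have "1 / real N ^ (k + 1) \<le> 1 / real N ^ 1"
      using N by (intro divide_left_mono power_increasing) auto
    then show "exp (- L / 2) \<le> \<delta>" using N0[OF N(1)] ex by simp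
    have "ln (real N) \<le> 2 * ln (real M)"
    proof -
      have "real N \<le> real M ^ 2" using M by (simp add: N_def power2_eq_square)
      then have "ln (real N) \<le> ln (real M ^ 2)" using N M by (subst ln_le_cancel_iff) auto
      then show ?thesis using M by (simp add: ln_realpow)
    qed
    then have "a * ln (real N) \<le> a * (2 * ln (real M))" using a by (intro mult_left_mono) auto
    then have "L \<le> 2 * a * ln (real M)" by (simp add: L_def)
    then have "32 * real k / \<kappa> * L \<le> 32 * real k / \<kappa> * (2 * a * ln (real M))"
      using \<kappa> by (intro mult_left_mono) auto
    also have "\<dots> = 64 * real k * a / \<kappa> * ln (real M)" by simp
    also have "\<dots> \<le> \<Omega> M" by (rule M(2))
    finally show "real k \<le> \<Omega> M * (\<kappa> / (32 * L))"
      using \<kappa> L by (simp add: field_simps)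
    fix n :: int assume n: "n \<ge> 1"
    have "real N ^ k * L ^ p * exp (- L / 2) = a ^ p * (ln (real N) ^ p / real N)"
      unfolding ex using N by (simp add: L_def power_mult_distrib field_simps)
    then have "C / real N + D * real N ^ k * L ^ p * exp (- L / 2) \<le> 1 / 2 ^ k"
      using N0[OF N(1)] by (simp add: mult.assoc)
    then show "norm (fc (\<lambda>t. P t * factor_fun \<kappa> L (real (2 * M) * t)) n) * of_int n ^ k
        \<le> norm (fc P n) * of_int n ^ k + 1 / 2 ^ k"
      using C(3)[OF L N(2) n] unfolding N_def by linarith
  qed
qed

end

section \<open>Test functions in the gaps\<close>

lemma fc_of_real_minus: "fc (\<lambda>t. of_real (g t)) (- n) = cnj (fc (\<lambda>t. of_real (g t)) n)"
proof -
  have "(LINT t|angle_measure. cnj (complex_of_real (g t) * cis (- (of_int n * t)))) = cnj (LINT t|angle_measure. complex_of_real (g t) * cis (- (of_int n * t)))"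
    by (rule Bochner_Integration.integral_cnj)
  then show ?thesis by (simp add: fc_def cis_cnj)
qed

context
  fixes \<kappa> L :: real
  assumes \<kappa>: "0 < \<kappa>" "\<kappa> \<le> 1" and L: "1 \<le> L"
begin

text \<open>Doubling L turns the coordinate x into 4 x - 6, which is negative for x <= 1. The cutoff
  with 2 L is therefore supported inside the removed arc.\<close>

lemma gap_step_double_eq_0:
  assumes "gap_coord \<kappa> L t \<le> 1" shows "gap_step \<kappa> (2 * L) t = 0"
proof -
  have "gap_coord \<kappa> (2 * L) t = 4 * gap_coord \<kappa> L t - 6"
    by (simp add: gap_coord_def power_mult_distrib power_divide field_simps)
  then show ?thesis using assms by (simp add: gap_step_def smooth_step_eq_0)
qed

lemma integral_gap_step_ge: "\<kappa> / (32 * L) \<le> (LINT t|angle_measure. smooth_step (gap_coord \<kappa> (2 * L) t))"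
proof -
  \<comment> \<open>By 1 - cos t <= t^2/2 the cutoff with parameter 2 L equals 1 on [0, e), as 8 (2
    L/\<kappa>)^2 e^2/2 = 1. The constant 32 then comes from pi < 4.\<close>
  define e where "e = \<kappa> / (4 * L)"
  have e: "0 < e" "e \<le> 1" using \<kappa> L by (auto simp: e_def field_simps)
  have pi4: "pi < 4" using pi_less_4 .
  have one: "smooth_step (gap_coord \<kappa> (2 * L) t) = 1" if t: "t \<in> {0..<e}" for t
  proof (rule smooth_step_eq_1)
    have "1 - cos t = 2 * (sin (t / 2))\<^sup>2" using cos_double_sin[of "t / 2"] by simp
    also have "(sin (t / 2))\<^sup>2 \<le> (t / 2)\<^sup>2"
      using abs_sin_x_le_abs_x[of "t / 2"] by (simp only: abs_le_square_iff)
    also have "2 * (t / 2)\<^sup>2 \<le> e\<^sup>2 / 2" using t e by (simp add: power_divide power_mono)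
    finally have "1 - cos t \<le> e\<^sup>2 / 2" by simp
    then have "8 * (2 * L / \<kappa>)\<^sup>2 * (1 - cos t) \<le> 8 * (2 * L / \<kappa>)\<^sup>2 * (e\<^sup>2 / 2)" by (intro mult_left_mono) auto
    also have "\<dots> = 1" using \<kappa> L by (simp add: e_def power_divide power_mult_distrib field_simps)
    finally show "1 \<le> gap_coord \<kappa> (2 * L) t" by (simp add: gap_coord_def algebra_simps)
  qed
  have e2: "e \<le> 2 * pi" using e pi_gt3 by linarith
  then have sub: "{0..<2*pi} \<inter> {0..<e} = {0..<e}" by auto
  have "measure angle_measure {0..<e} = measure lborel ({0..<2*pi} \<inter> {0..<e}) / measure lborel {0..<2*pi::real}"
    by (rule measure_uniform_measure) auto
  then have m: "measure angle_measure {0..<e} = e / (2*pi)" using e e2 by (simp add: sub min_def)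
  have "\<kappa> / (32 * L) = e / (2 * 4)" by (simp add: e_def)
  also have "\<dots> \<le> e / (2 * pi)" using e pi4 by (intro divide_left_mono) auto
  also have "\<dots> = (LINT t|angle_measure. indicator {0..<e} t)" using m by simp
  also have "\<dots> \<le> (LINT t|angle_measure. smooth_step (gap_coord \<kappa> (2 * L) t))"
  proof (rule integral_mono)
    show "integrable angle_measure (indicator {0..<e} :: real \<Rightarrow> real)"
      by (rule integrable_angle[where C=1]) (auto simp: indicator_def)
    have "(\<lambda>t. Re (gap_step \<kappa> (2 * L) t)) \<in> borel_measurable borel"
      using periodic_cont_measurable[OF periodic_cont_gap_step] by measurable
    then show "integrable angle_measure (\<lambda>t. smooth_step (gap_coord \<kappa> (2 * L) t))"
      using smooth_step_bounds by (intro integrable_angle[where C=1]) (auto simp: gap_step_def)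
    show "indicator {0..<e} t \<le> smooth_step (gap_coord \<kappa> (2 * L) t)" for t
      using one[of t] smooth_step_bounds(1) by (simp add: indicator_def)
  qed
  finally show ?thesis .
qed

text \<open>A function with values in \<open>[0, 1]\<close> satisfies \<open>\<parallel>\<phi>\<parallel>\<^sub>2\<^sup>2 \<le> \<parallel>\<phi>\<parallel>\<^sub>1\<close>; by Parseval this bounds the
  coefficients in terms of the one at 0.\<close>

lemma gap_test_coeffs:
  defines "c \<equiv> fc (gap_step \<kappa> (2 * L))"
  shows "(\<lambda>m. norm (c m)) summable_on UNIV"
    and "gap_coord \<kappa> L t \<le> 1 \<Longrightarrow> (\<Sum>\<^sub>\<infinity>m. c m * cis (of_int m * t)) = 0"
    and "\<kappa> / (32 * L) \<le> norm (c 0)"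
    and "finite F \<Longrightarrow> (\<Sum>m\<in>F. (norm (c m))\<^sup>2) \<le> norm (c 0)"
proof -
  let ?\<phi> = "gap_step \<kappa> (2 * L)"
  have L2: "1 \<le> 2 * L" using L by simp
  show s: "(\<lambda>m. norm (c m)) summable_on UNIV"
    unfolding c_def by (rule rapid_abs_summable[OF rapid_gap_step[OF \<kappa> L2]])
  show "(\<Sum>\<^sub>\<infinity>m. c m * cis (of_int m * t)) = 0" if "gap_coord \<kappa> L t \<le> 1"
    using fourier_inversion[OF periodic_cont_gap_step s[unfolded c_def], of t] gap_step_double_eq_0[OF that]
    by (simp add: c_def)
  let ?r = "\<lambda>t. smooth_step (gap_coord \<kappa> (2 * L) t)"
  have "c 0 = (LINT t|angle_measure. complex_of_real (?r t))" by (simp add: c_def fc_def gap_step_def)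
  then have c0: "c 0 = of_real (LINT t|angle_measure. ?r t)" by (simp add: integral_complex_of_real)
  have "\<kappa> / (32 * L) \<ge> 0" using \<kappa> L by simp
  then have nonneg: "0 \<le> (LINT t|angle_measure. ?r t)" using integral_gap_step_ge by linarith
  have nc0: "norm (c 0) = (LINT t|angle_measure. ?r t)" unfolding c0 norm_of_real using nonneg by simp
  show "\<kappa> / (32 * L) \<le> norm (c 0)" unfolding nc0 by (rule integral_gap_step_ge)
  \<comment> \<open>For a real function the coefficient at -m is conjugate to that at m, so
    \<open>fc_mult_scale\<close> with N = 1 at frequency 0 becomes Parseval.\<close>
  have cc: "c m * c (0 - m * int 1) = of_real ((norm (c m))\<^sup>2)" for m
    using fc_of_real_minus[of ?r m] complex_norm_square[of "c m"]
    by (simp add: c_def gap_step_def[abs_def])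
  have meas: "?r \<in> borel_measurable borel"
  proof -
    have "(\<lambda>t. Re (?\<phi> t)) \<in> borel_measurable borel"
      using periodic_cont_measurable[OF periodic_cont_gap_step] by measurable
    then show ?thesis by (simp add: gap_step_def)
  qed
  have sq: "fc (\<lambda>t. ?\<phi> t * ?\<phi> (real 1 * t)) 0 = of_real (LINT t|angle_measure. (?r t)\<^sup>2)"
  proof -
    have "fc (\<lambda>t. ?\<phi> t * ?\<phi> (real 1 * t)) 0 = (LINT t|angle_measure. complex_of_real ((?r t)\<^sup>2))"
      by (simp add: fc_def gap_step_def power2_eq_square)
    then show ?thesis by (simp only: integral_complex_of_real)
  qed
  have "(\<Sum>\<^sub>\<infinity>m. complex_of_real ((norm (c m))\<^sup>2)) = of_real (LINT t|angle_measure. (?r t)\<^sup>2)"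
    using fc_mult_scale[OF periodic_cont_gap_step periodic_cont_gap_step s[unfolded c_def], where n=0 and N=1] sq cc
    by (simp only: c_def)
  note sum_eq = this
  have c1: "norm (c m) \<le> 1" for m
    unfolding c_def by (rule norm_fc_le[OF periodic_cont_measurable[OF periodic_cont_gap_step] norm_gap_step_le(1)])
  have s2: "(\<lambda>m. (norm (c m))\<^sup>2) summable_on UNIV"
    by (rule summable_on_comparison_test[OF s])
      (use c1 in \<open>auto simp: power2_eq_square intro!: mult_left_le\<close>)
  have parseval: "(\<Sum>\<^sub>\<infinity>m. (norm (c m))\<^sup>2) = (LINT t|angle_measure. (?r t)\<^sup>2)"
    using infsumI[OF has_sum_bounded_linear[OF bounded_linear_of_real has_sum_infsum[OF s2]]] sum_eq
    by (metis of_real_eq_iff)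
  show "(\<Sum>m\<in>F. (norm (c m))\<^sup>2) \<le> norm (c 0)" if "finite F"
  proof -
    have "(\<Sum>m\<in>F. (norm (c m))\<^sup>2) \<le> (\<Sum>\<^sub>\<infinity>m. (norm (c m))\<^sup>2)"
      using that by (intro finite_sum_le_infsum s2) auto
    also have "\<dots> = (LINT t|angle_measure. (?r t)\<^sup>2)" by (rule parseval)
    also have "\<dots> \<le> (LINT t|angle_measure. ?r t)"
    proof (rule integral_mono)
      show "integrable angle_measure ?r" "integrable angle_measure (\<lambda>t. (?r t)\<^sup>2)"
        using meas smooth_step_bounds by (auto intro!: integrable_angle[where C=1] simp: power_le_one abs_le_iff)
      show "(?r t)\<^sup>2 \<le> ?r t" for t
        using smooth_step_bounds[of "gap_coord \<kappa> (2 * L) t"] by (simp add: power2_eq_square mult_left_le)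
    qed
    finally show ?thesis by (simp add: nc0)
  qed
qed

end

section \<open>Integration against complex measures\<close>

lemma complex_measure_integral_eqI:
  fixes f :: "'a \<Rightarrow> complex"
  assumes \<mu>: "complex_measure M \<mu>"
    and sets: "sets p = sets M" "sets q = sets M" "sets p' = sets M" "sets q' = sets M"
    and fin: "finite_measure p" "finite_measure q" "finite_measure p'" "finite_measure q'"
    and eq: "\<And>A. A \<in> sets M \<Longrightarrow> \<mu> A = of_real (measure p A - measure q A) + \<i> * of_real (measure p' A - measure q' A)"
    and f: "f \<in> borel_measurable M" "\<And>x. norm (f x) \<le> C"
  shows "complex_measure_integral M \<mu> f =
    ((\<integral>x. f x \<partial>p) - (\<integral>x. f x \<partial>q)) + \<i> * ((\<integral>x. f x \<partial>p') - (\<integral>x. f x \<partial>q'))"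
proof -
  have "signed_integral M (\<lambda>A. Re (\<mu> A)) f = (\<integral>x. f x \<partial>p) - (\<integral>x. f x \<partial>q)"
    by (rule signed_integral_eqI[OF complex_measure_Re[OF \<mu>] sets(1,2) fin(1,2) _ f]) (simp add: eq)
  moreover have "signed_integral M (\<lambda>A. Im (\<mu> A)) f = (\<integral>x. f x \<partial>p') - (\<integral>x. f x \<partial>q')"
    by (rule signed_integral_eqI[OF complex_measure_Im[OF \<mu>] sets(3,4) fin(3,4) _ f]) (simp add: eq)
  ultimately show ?thesis unfolding complex_measure_integral_def by simp
qed

text \<open>Four finite measures stand in for \<mu> from here on. The last clause transfers the
  support condition: a set all of whose measurable subsets have \<mu>-value 0 is null for each of
  the four.\<close>

lemma complex_measure_decomposition:
  assumes \<mu>: "complex_measure M \<mu>"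
  obtains p q p' q' where "sets p = sets M" "sets q = sets M" "sets p' = sets M" "sets q' = sets M"
    "finite_measure p" "finite_measure q" "finite_measure p'" "finite_measure q'"
    "\<And>A. A \<in> sets M \<Longrightarrow> \<mu> A = of_real (measure p A - measure q A) + \<i> * of_real (measure p' A - measure q' A)"
    "\<forall>A\<in>sets M. (\<forall>B\<in>sets M. B \<subseteq> A \<longrightarrow> \<mu> B = 0) \<longrightarrow>
      A \<in> null_sets p \<and> A \<in> null_sets q \<and> A \<in> null_sets p' \<and> A \<in> null_sets q'"
proof -
  let ?r = "\<lambda>A. Re (\<mu> A)" and ?i = "\<lambda>A. Im (\<mu> A)"
  note R = complex_measure_Re[OF \<mu>] and I = complex_measure_Im[OF \<mu>]
  note R' = signed_measure_minus[OF R] and I' = signed_measure_minus[OF I]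
  have null: "A \<in> null_sets (positive_variation M \<nu>)"
    if "signed_measure M \<nu>" "A \<in> sets M" "\<And>B. B \<in> sets M \<Longrightarrow> B \<subseteq> A \<Longrightarrow> \<nu> B = 0" for A \<nu>
  proof (rule null_setsI)
    have "upper_variation M \<nu> A \<le> 0" by (rule upper_variation_le[OF that(1)]) (simp add: that(3))
    then show "emeasure (positive_variation M \<nu>) A = 0"
      by (simp add: emeasure_positive_variation[OF that(1,2)] ennreal_neg)
  qed (simp add: that)
  show ?thesis
  proof (rule that[of "positive_variation M ?r" "positive_variation M (\<lambda>A. - ?r A)"
        "positive_variation M ?i" "positive_variation M (\<lambda>A. - ?i A)"])
    fix A assume A: "A \<in> sets M"
    show "\<mu> A = of_real (measure (positive_variation M ?r) A - measure (positive_variation M (\<lambda>A. - ?r A)) A)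
        + \<i> * of_real (measure (positive_variation M ?i) A - measure (positive_variation M (\<lambda>A. - ?i A)) A)"
      unfolding Jordan_decomposition[OF R A, symmetric] Jordan_decomposition[OF I A, symmetric]
      by (simp add: complex_eq_iff)
  next
    show "\<forall>A\<in>sets M. (\<forall>B\<in>sets M. B \<subseteq> A \<longrightarrow> \<mu> B = 0) \<longrightarrow>
        A \<in> null_sets (positive_variation M ?r) \<and> A \<in> null_sets (positive_variation M (\<lambda>A. - ?r A)) \<and>
        A \<in> null_sets (positive_variation M ?i) \<and> A \<in> null_sets (positive_variation M (\<lambda>A. - ?i A))"
      by (intro ballI impI conjI null R R' I I') auto
  qed (simp_all add: sets_positive_variation[OF R] sets_positive_variation[OF R'] sets_positive_variation[OF I]
      sets_positive_variation[OF I'] finite_measure_positive_variation[OF R] finite_measure_positive_variation[OF R']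
      finite_measure_positive_variation[OF I] finite_measure_positive_variation[OF I'])
qed

text \<open>Stated with \<open>has_sum\<close> so that the term of index 0 can later be split
  off.\<close>

lemma complex_measure_integral_infsum:
  fixes a :: "int \<Rightarrow> complex"
  assumes \<mu>: "complex_measure M \<mu>" and a: "(\<lambda>n. norm (a n)) summable_on UNIV"
    and g: "\<And>n. g n \<in> borel_measurable M" "\<And>n x. norm (g n x) \<le> 1"
    and meas: "(\<lambda>x. \<Sum>\<^sub>\<infinity>n. a n * g n x) \<in> borel_measurable M"
  shows "((\<lambda>n. a n * complex_measure_integral M \<mu> (g n)) has_sum
     complex_measure_integral M \<mu> (\<lambda>x. \<Sum>\<^sub>\<infinity>n. a n * g n x)) UNIV"
proof -
  obtain p q p' q' where sets: "sets p = sets M" "sets q = sets M" "sets p' = sets M" "sets q' = sets M"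
    and fin: "finite_measure p" "finite_measure q" "finite_measure p'" "finite_measure q'"
    and eq: "\<And>A. A \<in> sets M \<Longrightarrow> \<mu> A = of_real (measure p A - measure q A) + \<i> * of_real (measure p' A - measure q' A)"
    using complex_measure_decomposition[OF \<mu>] by metis
  have hs: "((\<lambda>n. a n * (LINT x|X. g n x)) has_sum (LINT x|X. (\<Sum>\<^sub>\<infinity>n. a n * g n x))) UNIV"
    if X: "finite_measure X" "sets X = sets M" for X
  proof -
    have gX: "g n \<in> borel_measurable X" for n using g(1) X(2) by (simp cong: measurable_cong_sets)
    have "norm (a n * (LINT x|X. g n x)) \<le> norm (a n) * (1 * measure X (space X))" for n
      unfolding norm_mult
      by (intro mult_left_mono norm_integral_finite_measure_le[OF X(1) gX g(2)]) auto
    then have "(\<lambda>n. norm (a n * (LINT x|X. g n x))) summable_on UNIV"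
      by (intro summable_on_comparison_test[OF summable_on_cmult_left[OF a]]) auto
    then have "(\<lambda>n. a n * (LINT x|X. g n x)) summable_on UNIV" by (rule abs_summable_summable)
    then show ?thesis unfolding integral_infsum[OF X(1) a gX g(2)] by (rule has_sum_infsum)
  qed
  have bd: "norm (\<Sum>\<^sub>\<infinity>n. a n * g n x) \<le> (\<Sum>\<^sub>\<infinity>n. norm (a n))" for x
  proof -
    have s: "(\<lambda>n. norm (a n * g n x)) summable_on UNIV"
      by (rule summable_on_comparison_test[OF a]) (auto simp: norm_mult intro!: mult_left_le g(2))
    have "norm (\<Sum>\<^sub>\<infinity>n. a n * g n x) \<le> (\<Sum>\<^sub>\<infinity>n. norm (a n * g n x))" by (rule norm_infsum_bound[OF s])
    also have "\<dots> \<le> (\<Sum>\<^sub>\<infinity>n. norm (a n))"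
      by (rule infsum_mono[OF s a]) (auto simp: norm_mult intro!: mult_left_le g(2))
    finally show ?thesis .
  qed
  have I: "complex_measure_integral M \<mu> f = ((\<integral>x. f x \<partial>p) - (\<integral>x. f x \<partial>q)) + \<i> * ((\<integral>x. f x \<partial>p') - (\<integral>x. f x \<partial>q'))"
    if "f \<in> borel_measurable M" "\<And>x. norm (f x) \<le> C" for f C
    by (rule complex_measure_integral_eqI[OF \<mu> sets fin eq that])
  have "((\<lambda>n. (a n * (LINT x|p. g n x) + - (a n * (LINT x|q. g n x))) +
        \<i> * (a n * (LINT x|p'. g n x) + - (a n * (LINT x|q'. g n x)))) has_sum
      ((LINT x|p. (\<Sum>\<^sub>\<infinity>n. a n * g n x)) + - (LINT x|q. (\<Sum>\<^sub>\<infinity>n. a n * g n x))) +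
        \<i> * ((LINT x|p'. (\<Sum>\<^sub>\<infinity>n. a n * g n x)) + - (LINT x|q'. (\<Sum>\<^sub>\<infinity>n. a n * g n x)))) UNIV"
    using sets fin by (intro has_sum_add has_sum_uminusI has_sum_cmult_right hs) auto
  then show ?thesis
    unfolding I[OF meas bd] I[OF g] by (simp add: algebra_simps)
qed

section \<open>Measures on the circle\<close>

lemma space_circle_borel [simp]: "space circle_borel = unit_circle"
  by (simp add: circle_borel_def space_restrict_space)

lemma circle_borel_measurable:
  "continuous_on unit_circle f \<Longrightarrow> f \<in> borel_measurable circle_borel"
  unfolding circle_borel_def by (rule borel_measurable_continuous_on_restrict)

lemma integrable_circle_continuous:
  fixes f :: "complex \<Rightarrow> 'b::{banach, second_countable_topology}"
  assumes X: "finite_measure X" "sets X = sets circle_borel" and f: "continuous_on unit_circle f"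
  shows "integrable X f"
proof -
  have "bounded (f ` unit_circle)" by (intro compact_imp_bounded compact_continuous_image f compact_sphere)
  then obtain B where "\<forall>y\<in>f ` unit_circle. norm y \<le> B" unfolding bounded_iff by blast
  then have B: "\<And>z. z \<in> unit_circle \<Longrightarrow> norm (f z) \<le> B" by blast
  have sp: "space X = unit_circle" using sets_eq_imp_space_eq[OF X(2)] by simp
  show ?thesis
  proof (rule finite_measure.integrable_const_bound[OF X(1), where B=B])
    show "AE x in X. norm (f x) \<le> B" by (rule AE_I2) (use B sp in simp)
    show "f \<in> borel_measurable X" using circle_borel_measurable[OF f] X(2) by (simp cong: measurable_cong_sets)
  qed
qed

text \<open>The continuous functions max 0 (1 - n dist(z, C)) converge to the indicator of the
  closed set C, and closed sets are an intersection-stable generator.\<close>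

lemma finite_circle_measures_eqI:
  assumes p: "finite_measure p" "sets p = sets circle_borel" and q: "finite_measure q" "sets q = sets circle_borel"
    and eq: "\<And>u :: complex \<Rightarrow> real. continuous_on unit_circle u \<Longrightarrow> (\<integral>z. u z \<partial>p) = (\<integral>z. u z \<partial>q)"
    and A: "A \<in> sets circle_borel"
  shows "measure p A = measure q A"
proof -
  have emb: "(\<lambda>z. z) \<in> measurable circle_borel borel"
    unfolding circle_borel_def by (rule measurable_restrict_space1) simp
  have lim: "(\<lambda>n. \<integral>z. max 0 (1 - real n * infdist z C) \<partial>X) \<longlonglongrightarrow> measure X (C \<inter> unit_circle)"
    if X: "finite_measure X" "sets X = sets circle_borel" and C: "closed C" "C \<noteq> {}" for X C
  proof -
    have sp: "space X = unit_circle" using sets_eq_imp_space_eq[OF X(2)] by simp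
    have "C \<inter> unit_circle \<in> sets circle_borel"
      unfolding circle_borel_def using C by (subst sets_restrict_space_iff) auto
    then have CX: "C \<inter> unit_circle \<in> sets X" using X(2) by simp
    have "(\<lambda>n. \<integral>z. max 0 (1 - real n * infdist z C) \<partial>X) \<longlonglongrightarrow> (\<integral>z. indicator (C \<inter> unit_circle) z \<partial>X)"
    proof (rule integral_dominated_convergence[where w="\<lambda>_. 1"])
      show "indicator (C \<inter> unit_circle) \<in> borel_measurable X" using CX by simp
      have c: "continuous_on unit_circle (\<lambda>z. max 0 (1 - real n * infdist z C))" for n
        by (intro continuous_intros continuous_on_infdist)
      show "(\<lambda>z. max 0 (1 - real n * infdist z C)) \<in> borel_measurable X" for n
        using circle_borel_measurable[OF c[of n]] X(2) by (simp cong: measurable_cong_sets)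
      show "integrable X (\<lambda>_. 1::real)" by (rule finite_measure.integrable_const[OF X(1)])
      show "AE z in X. norm (max 0 (1 - real n * infdist z C)) \<le> 1" for n
        by (rule AE_I2) (auto simp: infdist_nonneg)
      show "AE z in X. (\<lambda>n. max 0 (1 - real n * infdist z C)) \<longlonglongrightarrow> indicator (C \<inter> unit_circle) z"
      proof (rule AE_I2)
        fix z assume z: "z \<in> space X"
        show "(\<lambda>n. max 0 (1 - real n * infdist z C)) \<longlonglongrightarrow> indicator (C \<inter> unit_circle) z"
        proof (cases "z \<in> C")
          case True
          then show ?thesis using z sp by simp
        next
          case False
          then have pos: "0 < infdist z C" using C by (metis infdist_nonneg in_closed_iff_infdist_zero less_le)
          obtain m where m: "1 < real m * infdist z C" using reals_Archimedean3[OF pos] by blast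
          have "max 0 (1 - real n * infdist z C) = 0" if "n \<ge> m" for n
          proof -
            have "real m * infdist z C \<le> real n * infdist z C" using that pos by (intro mult_right_mono) auto
            then show ?thesis using m by simp
          qed
          then have "\<forall>\<^sub>F n in sequentially. max 0 (1 - real n * infdist z C) = 0"
            unfolding eventually_sequentially by blast
          then show ?thesis using False by (simp add: tendsto_eventually)
        qed
      qed
    qed
    then show ?thesis using CX by simp
  qed
  \<comment> \<open>Pushed forward to the plane, where closed sets generate the Borel sets.\<close>
  let ?p = "distr p borel (\<lambda>z. z)" and ?q = "distr q borel (\<lambda>z. z)"
  have mp: "(\<lambda>z. z) \<in> measurable p borel" "(\<lambda>z. z) \<in> measurable q borel"
    using emb p q by (simp_all cong: measurable_cong_sets)
  have sp: "space p = unit_circle" "space q = unit_circle"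
    using sets_eq_imp_space_eq[OF p(2)] sets_eq_imp_space_eq[OF q(2)] by simp_all
  have e: "emeasure ?p B = emeasure p (B \<inter> unit_circle)" "emeasure ?q B = emeasure q (B \<inter> unit_circle)"
    if "B \<in> sets borel" for B
    using that mp sp by (simp_all add: emeasure_distr)
  have cl: "emeasure ?p C = emeasure ?q C" if C: "closed C" for C
  \<comment> \<open>\<open>infdist\<close> to the empty set is 0, so the approximating functions
    would not converge to its indicator.\<close>
  proof (cases "C = {}")
    case False
    have "measure p (C \<inter> unit_circle) = measure q (C \<inter> unit_circle)"
    proof (rule LIMSEQ_unique)
      have "(\<integral>z. max 0 (1 - real n * infdist z C) \<partial>p) = (\<integral>z. max 0 (1 - real n * infdist z C) \<partial>q)" for n
        by (intro eq continuous_intros continuous_on_infdist)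
      then show "(\<lambda>n. \<integral>z. max 0 (1 - real n * infdist z C) \<partial>p) \<longlonglongrightarrow> measure q (C \<inter> unit_circle)"
        using lim[OF q C False] by simp
    qed (rule lim[OF p C False])
    then show ?thesis using e[of C] C p q by (simp add: finite_measure.emeasure_eq_measure)
  qed simp
  have "?p = ?q"
  proof (rule measure_eqI_generator_eq[where E="Collect closed" and A="\<lambda>_. UNIV" and \<Omega>=UNIV])
    show "Int_stable (Collect closed :: complex set set)" by (auto simp: Int_stable_def)
    show "sets ?p = sigma_sets UNIV (Collect closed)" "sets ?q = sigma_sets UNIV (Collect closed)"
      by (simp_all add: borel_eq_closed)
    show "emeasure ?p UNIV \<noteq> \<infinity>" for i :: nat
      using e(1)[of UNIV] finite_measure.emeasure_finite[OF p(1)] by simp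
  qed (use cl in auto)
  moreover have "A \<in> sets borel" "A \<subseteq> unit_circle"
    using A unfolding circle_borel_def by (auto simp: sets_restrict_space_iff)
  ultimately have "emeasure p A = emeasure q A" using e[of A] by (simp add: Int_absorb2)
  then show ?thesis by (simp add: measure_def)
qed

lemma complex_measure_integral_cong:
  assumes "\<And>z. z \<in> space M \<Longrightarrow> f z = g z"
  shows "complex_measure_integral M \<mu> f = complex_measure_integral M \<mu> g"
proof -
  have "integral\<^sup>L (positive_variation M \<nu>) f = integral\<^sup>L (positive_variation M \<nu>) g" for \<nu>
    by (rule Bochner_Integration.integral_cong) (simp_all add: assms positive_variation_def space_measure_of_conv)
  then show ?thesis unfolding complex_measure_integral_def signed_integral_def by simp
qed

lemma circle_powi_continuous: "continuous_on unit_circle (\<lambda>z. z powi n)"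
  by (auto intro!: continuous_intros)

lemma norm_circle_powi: "z \<in> unit_circle \<Longrightarrow> norm (z powi n) = 1"
  by (simp add: norm_power_int)

text \<open>The general rule asks for a bound on the whole type, while functions such as powers of z
  are bounded on the circle only; they are replaced by 0 off the circle.\<close>

lemma complex_measure_integral_circle_eqI:
  fixes f :: "complex \<Rightarrow> complex"
  assumes \<mu>: "complex_measure circle_borel \<mu>"
    and sets: "sets p = sets circle_borel" "sets q = sets circle_borel" "sets p' = sets circle_borel" "sets q' = sets circle_borel"
    and fin: "finite_measure p" "finite_measure q" "finite_measure p'" "finite_measure q'"
    and eq: "\<And>A. A \<in> sets circle_borel \<Longrightarrow> \<mu> A = of_real (measure p A - measure q A) + \<i> * of_real (measure p' A - measure q' A)"
    and f: "continuous_on unit_circle f"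
  shows "complex_measure_integral circle_borel \<mu> f =
    ((\<integral>x. f x \<partial>p) - (\<integral>x. f x \<partial>q)) + \<i> * ((\<integral>x. f x \<partial>p') - (\<integral>x. f x \<partial>q'))"
proof -
  let ?f = "\<lambda>z. if z \<in> unit_circle then f z else 0"
  have "bounded (f ` unit_circle)" by (intro compact_imp_bounded compact_continuous_image f compact_sphere)
  then obtain B where "\<forall>y\<in>f ` unit_circle. norm y \<le> B" unfolding bounded_iff by blast
  then have B: "norm (?f z) \<le> \<bar>B\<bar>" for z by force
  have "continuous_on unit_circle ?f" using f by (rule continuous_on_cong[THEN iffD1, rotated 2]) auto
  then have m: "?f \<in> borel_measurable circle_borel" by (rule circle_borel_measurable)
  have sp: "space p = unit_circle" "space q = unit_circle" "space p' = unit_circle" "space q' = unit_circle"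
    using sets[THEN sets_eq_imp_space_eq] by simp_all
  have c: "(\<integral>x. f x \<partial>X) = (\<integral>x. ?f x \<partial>X)" if "space X = unit_circle" for X
    using that by (intro Bochner_Integration.integral_cong) auto
  have "complex_measure_integral circle_borel \<mu> f = complex_measure_integral circle_borel \<mu> ?f"
    by (rule complex_measure_integral_cong) simp
  also have "\<dots> = ((\<integral>x. ?f x \<partial>p) - (\<integral>x. ?f x \<partial>q)) + \<i> * ((\<integral>x. ?f x \<partial>p') - (\<integral>x. ?f x \<partial>q'))"
    by (rule complex_measure_integral_eqI[OF \<mu> sets fin eq m B])
  finally show ?thesis by (simp only: c sp)
qed

text \<open>The functional D vanishes on trigonometric polynomials, hence on continuous functions.
  For real u its real and imaginary parts vanish separately, which forces p = q and p' = q'.\<close>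

lemma fourier_coeffs_0_imp_trivial:
  assumes \<mu>: "complex_measure circle_borel \<mu>" and 0: "\<And>n. fourier_coeff \<mu> n = 0"
  shows "\<not> nontrivial_circle_measure \<mu>"
proof -
  obtain p q p' q' where sets: "sets p = sets circle_borel" "sets q = sets circle_borel" "sets p' = sets circle_borel" "sets q' = sets circle_borel"
    and fin: "finite_measure p" "finite_measure q" "finite_measure p'" "finite_measure q'"
    and eq: "\<And>A. A \<in> sets circle_borel \<Longrightarrow> \<mu> A = of_real (measure p A - measure q A) + \<i> * of_real (measure p' A - measure q' A)"
    using complex_measure_decomposition[OF \<mu>] by metis
  define D where "D f = ((\<integral>x. f x \<partial>p) - (\<integral>x. f x \<partial>q)) + \<i> * ((\<integral>x. f x \<partial>p') - (\<integral>x. f x \<partial>q'))" for f :: "complex \<Rightarrow> complex"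
  have cmi: "complex_measure_integral circle_borel \<mu> f = D f" if "continuous_on unit_circle f" for f
    unfolding D_def by (rule complex_measure_integral_circle_eqI[OF \<mu> sets fin eq that])
  note int = integrable_circle_continuous[OF fin(1) sets(1)] integrable_circle_continuous[OF fin(2) sets(2)]
    integrable_circle_continuous[OF fin(3) sets(3)] integrable_circle_continuous[OF fin(4) sets(4)]
  have trig: "D g = 0" if "trig_poly g" for g
    using that
  proof induction
    case (trig_poly_monom c n)
    have "D (\<lambda>z. c * z powi n) = c * D (\<lambda>z. z powi n)" by (simp add: D_def algebra_simps)
    also have "D (\<lambda>z. z powi n) = fourier_coeff \<mu> (- n)"
      by (simp add: fourier_coeff_def cmi[OF circle_powi_continuous])
    finally show ?case using 0 by simp
  next
    case (trig_poly_add f g)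
    have "D (\<lambda>z. f z + g z) = D f + D g"
      using trig_poly_continuous[OF trig_poly_add(1)] trig_poly_continuous[OF trig_poly_add(2)]
      by (simp add: D_def int algebra_simps)
    then show ?case using trig_poly_add by simp
  qed
  have cont: "D f = 0" if f: "continuous_on unit_circle f" for f
  proof -
    define T where "T = measure p unit_circle + measure q unit_circle + (measure p' unit_circle + measure q' unit_circle)"
    have T: "T \<ge> 0" by (simp add: T_def)
    have "norm (D f) \<le> 0 + e" if "e > 0" for e
    proof -
      obtain g where g: "trig_poly g" "\<forall>z\<in>unit_circle. norm (f z - g z) < e / (T + 1)"
        using trig_poly_dense[OF f, of "e / (T + 1)"] \<open>e > 0\<close> T by auto
      have gc: "continuous_on unit_circle g" by (rule trig_poly_continuous[OF g(1)])
      then have hc: "continuous_on unit_circle (\<lambda>z. f z - g z)" using f by (intro continuous_intros)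
      have b: "norm (\<integral>z. f z - g z \<partial>X) \<le> e / (T + 1) * measure X unit_circle"
        if X: "finite_measure X" "sets X = sets circle_borel" for X
      proof -
        have sp: "space X = unit_circle" using sets_eq_imp_space_eq[OF X(2)] by simp
        have "norm (\<integral>z. f z - g z \<partial>X) \<le> (\<integral>z. norm (f z - g z) \<partial>X)" by (rule integral_norm_bound)
        also have "\<dots> \<le> (\<integral>z. e / (T + 1) \<partial>X)"
          using g(2) sp by (intro integral_mono integrable_norm integrable_circle_continuous[OF X hc] finite_measure.integrable_const[OF X(1)])
            (auto intro: less_imp_le)
        finally show ?thesis by (simp add: sp mult.commute)
      qed
      have "D f = D (\<lambda>z. f z - g z)"
        using trig[OF g(1)] f gc by (simp add: D_def int algebra_simps)
      also have "norm \<dots> \<le> norm (\<integral>z. f z - g z \<partial>p) + norm (\<integral>z. f z - g z \<partial>q)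
          + (norm (\<integral>z. f z - g z \<partial>p') + norm (\<integral>z. f z - g z \<partial>q'))"
        unfolding D_def
        by (intro order_trans[OF norm_triangle_ineq] add_mono order_trans[OF norm_triangle_ineq4])
          (auto simp: norm_mult intro: order_trans[OF norm_triangle_ineq4])
      also have "\<dots> \<le> e / (T + 1) * T"
        using b[OF fin(1) sets(1)] b[OF fin(2) sets(2)] b[OF fin(3) sets(3)] b[OF fin(4) sets(4)]
        by (simp add: T_def distrib_left)
      also have "\<dots> \<le> e" using T \<open>e > 0\<close> by (simp add: field_simps)
      finally show ?thesis by simp
    qed
    then have "norm (D f) \<le> 0" by (rule field_le_epsilon)
    then show ?thesis by simp
  qed
  have real: "(\<integral>z. u z \<partial>p) = (\<integral>z. u z \<partial>q) \<and> (\<integral>z. u z \<partial>p') = (\<integral>z. u z \<partial>q')"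
    if u: "continuous_on unit_circle u" for u :: "complex \<Rightarrow> real"
  proof -
    have "continuous_on unit_circle (\<lambda>z. complex_of_real (u z))" using u by (intro continuous_intros)
    then have "D (\<lambda>z. complex_of_real (u z)) = 0" by (rule cont)
    then show ?thesis by (simp add: D_def integral_complex_of_real complex_eq_iff)
  qed
  have "\<mu> A = 0" if A: "A \<in> sets circle_borel" for A
    using finite_circle_measures_eqI[OF fin(1) sets(1) fin(2) sets(2) _ A]
      finite_circle_measures_eqI[OF fin(3) sets(3) fin(4) sets(4) _ A] real eq[OF A] by simp
  then show ?thesis unfolding nontrivial_circle_measure_def by blast
qed

text \<open>The complement of E is null for all four parts of \<mu>, so f vanishes almost everywhere
  for each.\<close>

lemma complex_measure_integral_eq_0:
  assumes \<mu>: "\<mu> \<in> circle_measures_on E" and E: "closed E"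
    and f: "continuous_on unit_circle f" "\<And>z. z \<in> unit_circle \<inter> E \<Longrightarrow> f z = 0"
  shows "complex_measure_integral circle_borel \<mu> f = 0"
proof -
  have \<mu>': "complex_measure circle_borel \<mu>" using \<mu> by (simp add: circle_measures_on_def)
  obtain p q p' q' where sets: "sets p = sets circle_borel" "sets q = sets circle_borel" "sets p' = sets circle_borel" "sets q' = sets circle_borel"
    and fin: "finite_measure p" "finite_measure q" "finite_measure p'" "finite_measure q'"
    and eq: "\<And>A. A \<in> sets circle_borel \<Longrightarrow> \<mu> A = of_real (measure p A - measure q A) + \<i> * of_real (measure p' A - measure q' A)"
    and null: "\<forall>A\<in>sets circle_borel. (\<forall>B\<in>sets circle_borel. B \<subseteq> A \<longrightarrow> \<mu> B = 0) \<longrightarrow>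
      A \<in> null_sets p \<and> A \<in> null_sets q \<and> A \<in> null_sets p' \<and> A \<in> null_sets q'"
    by (rule complex_measure_decomposition[OF \<mu>'], (rule that; (assumption | blast)))
  let ?A = "unit_circle - E"
  have "?A \<in> sets circle_borel"
    unfolding circle_borel_def using E by (subst sets_restrict_space_iff) auto
  moreover have "\<mu> B = 0" if "B \<in> sets circle_borel" "B \<subseteq> ?A" for B
  proof -
    have "B \<inter> E = {}" using that by auto
    then show ?thesis using \<mu> that(1) unfolding circle_measures_on_def by blast
  qed
  ultimately have N: "?A \<in> null_sets p \<and> ?A \<in> null_sets q \<and> ?A \<in> null_sets p' \<and> ?A \<in> null_sets q'" using null by blast
  have z: "(\<integral>x. f x \<partial>X) = 0" if "?A \<in> null_sets X" "sets X = sets circle_borel" for X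
  proof (rule integral_eq_zero_AE)
    have sp: "space X = unit_circle" using sets_eq_imp_space_eq[OF that(2)] by simp
    show "AE x in X. f x = 0" by (rule AE_I'[OF that(1)]) (use f(2) sp in auto)
  qed
  have "complex_measure_integral circle_borel \<mu> f =
      ((\<integral>x. f x \<partial>p) - (\<integral>x. f x \<partial>q)) + \<i> * ((\<integral>x. f x \<partial>p') - (\<integral>x. f x \<partial>q'))"
    by (rule complex_measure_integral_circle_eqI[OF \<mu>' sets fin eq f(1)])
  then show ?thesis using N sets by (simp add: z)
qed

lemma circle_series_continuous:
  assumes "(\<lambda>m::int. norm (c m)) summable_on UNIV"
  shows "continuous_on unit_circle (\<lambda>z. \<Sum>\<^sub>\<infinity>m. c m * z powi (e m))"
proof (rule uniform_limit_theorem)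
  show "uniform_limit unit_circle (\<lambda>X z. \<Sum>m\<in>X. c m * z powi (e m)) (\<lambda>z. \<Sum>\<^sub>\<infinity>m. c m * z powi (e m))
      (finite_subsets_at_top UNIV)"
    by (rule Weierstrass_m_test_general[OF _ assms]) (simp add: norm_mult norm_circle_powi)
  show "\<forall>\<^sub>F X in finite_subsets_at_top UNIV. continuous_on unit_circle (\<lambda>z. \<Sum>m\<in>X. c m * z powi (e m))"
    by (intro always_eventually allI continuous_intros circle_powi_continuous)
qed simp

text \<open>Reduces the use of Cauchy-Schwarz to finite sums.\<close>

lemma has_sum_norm_le:
  assumes "(f has_sum x) A" "\<And>F. finite F \<Longrightarrow> F \<subseteq> A \<Longrightarrow> norm (sum f F) \<le> b"
  shows "norm x \<le> b"
proof (rule tendsto_upperbound)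
  show "((\<lambda>F. norm (sum f F)) \<longlongrightarrow> norm x) (finite_subsets_at_top A)"
    using assms(1) unfolding has_sum_def by (rule tendsto_norm)
  show "\<forall>\<^sub>F F in finite_subsets_at_top A. norm (sum f F) \<le> b"
    using assms(2) by (intro eventually_finite_subsets_at_top_weakI) auto
qed simp

text \<open>The test function lives on the gaps, which carry no mass of \<open>\<mu>\<close>. Its coefficient at 0 dominates
  in the resulting linear relation between coefficients of \<open>\<mu>\<close>, as all others meet frequencies of
  size at least \<open>M\<close>.\<close>

lemma fourier_coeff_gap_bound:
  fixes \<Omega> :: "nat \<Rightarrow> real"
  assumes \<mu>: "\<mu> \<in> circle_measures_on E" and E: "closed E"
    and \<kappa>: "0 < \<kappa>" "\<kappa> \<le> 1" and L: "1 \<le> L" and M: "M \<ge> 1"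
    and gap: "\<And>t. cis t \<in> E \<Longrightarrow> gap_coord \<kappa> L (real (2 * M) * t) \<le> 1"
    and \<Omega>: "mono \<Omega>" "\<And>n. 0 < \<Omega> n"
    and S: "\<And>F. finite F \<Longrightarrow> (\<Sum>n\<in>F. (cmod (fourier_coeff \<mu> n))\<^sup>2 * \<Omega> (nat \<bar>n\<bar>)) \<le> S"
    and j: "\<bar>j\<bar> \<le> int M"
  shows "(cmod (fourier_coeff \<mu> j))\<^sup>2 * (\<Omega> M * (\<kappa> / (32 * L))) \<le> S"
proof -
  define c where "c = fc (gap_step \<kappa> (2 * L))"
  note test = gap_test_coeffs[OF \<kappa> L, folded c_def]
  have \<mu>': "complex_measure circle_borel \<mu>" using \<mu> by (simp add: circle_measures_on_def)
  define N where "N = int (2 * M)"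
  define e where "e m = m * N - j" for m
  define \<nu> where "\<nu> m = fourier_coeff \<mu> (j - m * N)" for m
  \<comment> \<open>Set to 0 off the circle to meet the global bound of
    \<open>complex_measure_integral_infsum\<close>.\<close>
  let ?g = "\<lambda>m z. if z \<in> unit_circle then z powi e m else 0"
  have gm: "?g m \<in> borel_measurable circle_borel" for m
    by (rule measurable_cong[THEN iffD1, OF _ circle_borel_measurable[OF circle_powi_continuous[of "e m"]]]) simp
  have gn: "norm (?g m z) \<le> 1" for m z by (simp add: norm_circle_powi)
  have cg: "complex_measure_integral circle_borel \<mu> (?g m) = \<nu> m" for m
    unfolding \<nu>_def fourier_coeff_def e_def by (rule complex_measure_integral_cong) simp
  have sm: "(\<lambda>z. \<Sum>\<^sub>\<infinity>m. c m * ?g m z) \<in> borel_measurable circle_borel"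
    by (rule measurable_cong[THEN iffD1, OF _ circle_borel_measurable[OF circle_series_continuous[OF test(1), of e]]]) simp
  have "complex_measure_integral circle_borel \<mu> (\<lambda>z. \<Sum>\<^sub>\<infinity>m. c m * ?g m z)
      = complex_measure_integral circle_borel \<mu> (\<lambda>z. \<Sum>\<^sub>\<infinity>m. c m * z powi e m)"
    by (rule complex_measure_integral_cong) simp
  also have "\<dots> = 0"
  proof (rule complex_measure_integral_eq_0[OF \<mu> E circle_series_continuous[OF test(1)]])
    fix z assume z: "z \<in> unit_circle \<inter> E"
    then have "z = cis (Arg2pi z)" using Arg2pi_eq[of z] by (simp add: cis_conv_exp)
    then obtain t where t: "z = cis t" by blast
    \<comment> \<open>At cis t the series is cis (-jt) times the test function at 2 M t, and the
      latter vanishes on E.\<close>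
    have "c m * z powi e m = cis (- (of_int j * t)) * (c m * cis (of_int m * (real (2 * M) * t)))" for m
    proof -
      have "of_int (e m) * t = - (of_int j * t) + of_int m * (real (2 * M) * t)"
        by (simp add: e_def N_def algebra_simps)
      then have "z powi e m = cis (- (of_int j * t)) * cis (of_int m * (real (2 * M) * t))"
        unfolding t cis_powi cis_mult by simp
      then show ?thesis by simp
    qed
    then have "(\<Sum>\<^sub>\<infinity>m. c m * z powi e m) = cis (- (of_int j * t)) * (\<Sum>\<^sub>\<infinity>m. c m * cis (of_int m * (real (2 * M) * t)))"
      by (simp only: infsum_cmult_right')
    also have "\<dots> = 0" using test(2)[OF gap[of t]] z t by simp
    finally show "(\<Sum>\<^sub>\<infinity>m. c m * z powi e m) = 0" .
  qed
  finally have hs: "((\<lambda>m. c m * \<nu> m) has_sum 0) UNIV"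
    using complex_measure_integral_infsum[OF \<mu>' test(1) gm gn sm] cg by simp
  \<comment> \<open>Splitting off m = 0 expresses the coefficient at j by those at the distant
    frequencies j - mN.\<close>
  have "((\<lambda>m. c m * \<nu> m) has_sum (0 - (\<Sum>m\<in>{0}. c m * \<nu> m))) (UNIV - {0})"
    by (rule has_sum_Diff[OF hs has_sum_finite]) auto
  then have hs0: "((\<lambda>m. c m * \<nu> m) has_sum (- (c 0 * \<nu> 0))) (UNIV - {0})" by simp
  have c0: "0 < norm (c 0)" using test(3) \<kappa> L by (intro less_le_trans[OF _ test(3)]) auto
  have S0: "0 \<le> S" using S[of "{}"] by simp
  have far: "(\<Sum>m\<in>F. (norm (\<nu> m))\<^sup>2) \<le> S / \<Omega> M" if F: "finite F" "F \<subseteq> UNIV - {0}" for F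
  proof -
    have inj: "inj_on (\<lambda>m. j - m * N) F" using M by (auto simp: inj_on_def N_def)
    have "(\<Sum>m\<in>F. (norm (\<nu> m))\<^sup>2) * \<Omega> M = (\<Sum>m\<in>F. (norm (\<nu> m))\<^sup>2 * \<Omega> M)" by (rule sum_distrib_right)
    also have "\<dots> \<le> (\<Sum>m\<in>F. (norm (\<nu> m))\<^sup>2 * \<Omega> (nat \<bar>j - m * N\<bar>))"
    proof (intro sum_mono mult_left_mono monoD[OF \<Omega>(1)])
      \<comment> \<open>Here |j - mN| >= N - |j| >= 2 M - M.\<close>
      fix m assume "m \<in> F"
      then have "\<bar>m\<bar> \<ge> 1" using F(2) by auto
      then have "1 * N \<le> \<bar>m\<bar> * N" by (intro mult_right_mono) (auto simp: N_def)
      then have "N \<le> \<bar>m\<bar> * N" by (simp only: mult_1)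
      also have "\<bar>m\<bar> * N = \<bar>m * N\<bar>" by (simp add: abs_mult N_def)
      also have "\<dots> \<le> \<bar>j - m * N\<bar> + \<bar>j\<bar>" by linarith
      finally show "M \<le> nat \<bar>j - m * N\<bar>" using j by (simp add: N_def)
    qed simp
    also have "\<dots> = (\<Sum>n\<in>(\<lambda>m. j - m * N) ` F. (cmod (fourier_coeff \<mu> n))\<^sup>2 * \<Omega> (nat \<bar>n\<bar>))"
      using inj by (simp add: sum.reindex \<nu>_def)
    also have "\<dots> \<le> S" using F(1) by (intro S) simp
    finally show ?thesis using \<Omega>(2)[of M] by (simp add: pos_le_divide_eq)
  qed
  have "norm (- (c 0 * \<nu> 0)) \<le> sqrt (norm (c 0) * (S / \<Omega> M))"
  proof (rule has_sum_norm_le[OF hs0])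
    fix F :: "int set" assume F: "finite F" "F \<subseteq> UNIV - {0}"
    have "norm (\<Sum>m\<in>F. c m * \<nu> m) \<le> (\<Sum>m\<in>F. norm (c m) * norm (\<nu> m))"
      using norm_sum[of "\<lambda>m. c m * \<nu> m" F] by (simp add: norm_mult)
    moreover have "(\<Sum>m\<in>F. norm (c m) * norm (\<nu> m))\<^sup>2 \<le> (\<Sum>m\<in>F. (norm (c m))\<^sup>2) * (\<Sum>m\<in>F. (norm (\<nu> m))\<^sup>2)"
      by (rule Cauchy_Schwarz_ineq_sum)
    moreover have "(\<Sum>m\<in>F. (norm (c m))\<^sup>2) * (\<Sum>m\<in>F. (norm (\<nu> m))\<^sup>2) \<le> norm (c 0) * (S / \<Omega> M)"
      using test(4)[OF F(1)] far[OF F] by (intro mult_mono) (auto intro: sum_nonneg)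
    ultimately show "norm (\<Sum>m\<in>F. c m * \<nu> m) \<le> sqrt (norm (c 0) * (S / \<Omega> M))"
      by (meson order_trans real_le_rsqrt)
  qed
  then have "(norm (c 0 * \<nu> 0))\<^sup>2 \<le> (sqrt (norm (c 0) * (S / \<Omega> M)))\<^sup>2"
    by (intro power_mono) auto
  also have "\<dots> = norm (c 0) * (S / \<Omega> M)"
    using S0 less_imp_le[OF \<Omega>(2)[of M]] by (intro real_sqrt_pow2 mult_nonneg_nonneg divide_nonneg_nonneg) auto
  finally have "(norm (c 0 * \<nu> 0))\<^sup>2 \<le> norm (c 0) * (S / \<Omega> M)" .
  then have "norm (c 0) * (norm (c 0) * (norm (\<nu> 0))\<^sup>2) \<le> norm (c 0) * (S / \<Omega> M)"
    by (simp add: norm_mult power_mult_distrib power2_eq_square mult_ac)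
  \<comment> \<open>One factor |c 0| cancels because the square sum of the test coefficients is at
    most |c 0|. The loss is thus the gap length itself and not its square, as the growth hypothesis
    requires.\<close>
  then have "norm (c 0) * (norm (\<nu> 0))\<^sup>2 \<le> S / \<Omega> M" by (rule mult_left_le_imp_le[OF _ c0])
  moreover have "\<kappa> / (32 * L) * (norm (\<nu> 0))\<^sup>2 \<le> norm (c 0) * (norm (\<nu> 0))\<^sup>2"
    using test(3) by (intro mult_right_mono) auto
  ultimately have "\<kappa> / (32 * L) * (norm (\<nu> 0))\<^sup>2 \<le> S / \<Omega> M" by linarith
  then have "\<kappa> / (32 * L) * (norm (\<nu> 0))\<^sup>2 * \<Omega> M \<le> S" using \<Omega>(2)[of M] by (simp only: pos_le_divide_eq)
  then show ?thesis by (simp add: \<nu>_def mult_ac)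
qed

section \<open>The limiting density\<close>

lemma complex_measure_of_measures:
  assumes sets: "sets p = sets M" "sets q = sets M" "sets p' = sets M" "sets q' = sets M"
    and fin: "finite_measure p" "finite_measure q" "finite_measure p'" "finite_measure q'"
  shows "complex_measure M (\<lambda>A. of_real (measure p A - measure q A) + \<i> * of_real (measure p' A - measure q' A))"
  unfolding complex_measure_def
proof (intro conjI allI impI)
  fix A :: "nat \<Rightarrow> 'a set" assume A: "range A \<subseteq> sets M" "disjoint_family A"
  have s: "(\<lambda>i. measure X (A i)) sums measure X (\<Union>i. A i)" if "sets X = sets M" "finite_measure X" for X
    by (rule finite_measure.finite_measure_UNION[OF that(2)]) (use A that in auto)
  show "(\<lambda>i. of_real (measure p (A i) - measure q (A i)) + \<i> * of_real (measure p' (A i) - measure q' (A i)))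
      sums (of_real (measure p (\<Union>i. A i) - measure q (\<Union>i. A i)) + \<i> * of_real (measure p' (\<Union>i. A i) - measure q' (\<Union>i. A i)))"
    using sets fin by (intro sums_add sums_mult sums_of_real sums_diff s)
qed simp

definition circle_density :: "(real \<Rightarrow> real) \<Rightarrow> complex measure" where
  "circle_density w = distr (density angle_measure (\<lambda>t. ennreal (w t))) circle_borel cis"

lemma cis_measurable: "cis \<in> measurable angle_measure circle_borel"
proof -
  have "cis \<in> borel_measurable angle_measure"
    by (intro measurable_angle borel_measurable_continuous_onI continuous_intros)
  then show ?thesis unfolding circle_borel_def by (intro measurable_restrict_space2) auto
qed

context
  fixes w :: "real \<Rightarrow> real"
  assumes w: "w \<in> borel_measurable borel" "\<And>t. 0 \<le> w t" "\<And>t. w t \<le> 1"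
begin

lemma sets_circle_density: "sets (circle_density w) = sets circle_borel"
  by (simp add: circle_density_def)

lemma circle_density_cis_measurable: "cis \<in> measurable (density angle_measure (\<lambda>t. ennreal (w t))) circle_borel"
  by (subst measurable_cong_sets[OF sets_density refl]) (rule cis_measurable)

lemma finite_measure_circle_density: "finite_measure (circle_density w)"
proof -
  have "finite_measure (density angle_measure (\<lambda>t. ennreal (w t)))"
  proof (rule finite_measureI)
    have "emeasure (density angle_measure (\<lambda>t. ennreal (w t))) UNIV = (\<integral>\<^sup>+t. ennreal (w t) \<partial>angle_measure)"
      using w by (subst emeasure_density) auto
    also have "\<dots> \<le> (\<integral>\<^sup>+t. 1 \<partial>angle_measure)" using w by (intro nn_integral_mono) auto
    also have "\<dots> < \<infinity>" using finite_measure.emeasure_finite[OF finite_measure_angle, of UNIV] by (simp add: less_top)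
    finally show "emeasure (density angle_measure (\<lambda>t. ennreal (w t))) (space (density angle_measure (\<lambda>t. ennreal (w t)))) \<noteq> \<infinity>"
      by simp
  qed
  then show ?thesis unfolding circle_density_def
    by (rule finite_measure.finite_measure_distr[OF _ circle_density_cis_measurable])
qed

lemma integral_circle_density:
  fixes f :: "complex \<Rightarrow> 'b::{banach, second_countable_topology}"
  assumes "f \<in> borel_measurable circle_borel"
  shows "(LINT z|circle_density w. f z) = (LINT t|angle_measure. w t *\<^sub>R f (cis t))"
proof -
  have "(LINT z|circle_density w. f z) = (LINT t|density angle_measure (\<lambda>t. ennreal (w t)). f (cis t))"
    unfolding circle_density_def by (rule integral_distr[OF circle_density_cis_measurable assms])
  also have "\<dots> = (LINT t|angle_measure. w t *\<^sub>R f (cis t))"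
    using w measurable_compose[OF cis_measurable assms] by (subst integral_density) auto
  finally show ?thesis .
qed

lemma measure_circle_density:
  assumes "A \<in> sets circle_borel"
  shows "measure (circle_density w) A = (LINT t|angle_measure. w t * indicator A (cis t))"
proof -
  have sp: "space (circle_density w) = unit_circle" by (simp add: circle_density_def)
  have "A \<subseteq> unit_circle" using sets.sets_into_space[OF assms] by simp
  then have "measure (circle_density w) A = (LINT z|circle_density w. indicator A z)"
    by (simp add: sp Int_absorb2)
  also have "\<dots> = (LINT t|angle_measure. w t *\<^sub>R indicator A (cis t))"
    by (rule integral_circle_density[OF borel_measurable_indicator[OF assms]])
  finally show ?thesis by (simp only: real_scaleR_def)
qed

end

lemma complex_part_bounds:
  fixes q :: complex
  assumes "norm q \<le> 1"
  shows "0 \<le> max 0 (Re q)" "max 0 (Re q) \<le> 1" "0 \<le> max 0 (- Re q)" "max 0 (- Re q) \<le> 1"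
    "0 \<le> max 0 (Im q)" "max 0 (Im q) \<le> 1" "0 \<le> max 0 (- Im q)" "max 0 (- Im q) \<le> 1"
  using abs_Re_le_cmod[of q] abs_Im_le_cmod[of q] assms by auto

text \<open>The positive and negative parts of Re Q and Im Q serve as densities of four measures,
  from which the integral may be computed by
  \<open>complex_measure_integral_circle_eqI\<close>.\<close>

lemma bounded_density_measure:
  assumes Q: "Q \<in> borel_measurable borel" "\<And>t. norm (Q t) \<le> 1"
    and E: "\<And>t. cis t \<notin> E \<Longrightarrow> Q t = 0"
  obtains \<mu> where "\<mu> \<in> circle_measures_on E" "\<And>n. fourier_coeff \<mu> n = fc Q n" "\<mu> unit_circle = fc Q 0"
proof -
  let ?a = "\<lambda>t. max 0 (Re (Q t))" and ?b = "\<lambda>t. max 0 (- Re (Q t))"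
    and ?c = "\<lambda>t. max 0 (Im (Q t))" and ?d = "\<lambda>t. max 0 (- Im (Q t))"
  have m: "?a \<in> borel_measurable borel" "?b \<in> borel_measurable borel" "?c \<in> borel_measurable borel" "?d \<in> borel_measurable borel"
    using Q(1) by measurable
  note parts = complex_part_bounds[OF Q(2)]
  note wa = m(1) parts(1,2) and wb = m(2) parts(3,4) and wc = m(3) parts(5,6) and wd = m(4) parts(7,8)
  note sets = sets_circle_density[OF wa] sets_circle_density[OF wb] sets_circle_density[OF wc] sets_circle_density[OF wd]
  note fin = finite_measure_circle_density[OF wa] finite_measure_circle_density[OF wb]
    finite_measure_circle_density[OF wc] finite_measure_circle_density[OF wd]
  note int = integral_circle_density[OF wa] integral_circle_density[OF wb] integral_circle_density[OF wc] integral_circle_density[OF wd]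
  define \<mu> where "\<mu> A = complex_of_real (measure (circle_density ?a) A - measure (circle_density ?b) A)
    + \<i> * complex_of_real (measure (circle_density ?c) A - measure (circle_density ?d) A)" for A
  have cm: "complex_measure circle_borel \<mu>"
    unfolding \<mu>_def[abs_def] by (rule complex_measure_of_measures[OF sets fin])
  have split: "(of_real (?a t) * z - of_real (?b t) * z) + \<i> * (of_real (?c t) * z - of_real (?d t) * z) = Q t * z" for t and z :: complex
  proof -
    have "?a t - ?b t = Re (Q t)" "?c t - ?d t = Im (Q t)" by auto
    then have "complex_of_real (?a t) - of_real (?b t) = of_real (Re (Q t))" "complex_of_real (?c t) - of_real (?d t) = of_real (Im (Q t))"
      by (simp_all only: of_real_diff[symmetric])
    then have "(complex_of_real (?a t) - of_real (?b t)) + \<i> * (complex_of_real (?c t) - of_real (?d t)) = Q t"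
      using complex_eq[of "Q t"] by simp
    moreover have "(of_real (?a t) * z - of_real (?b t) * z) + \<i> * (of_real (?c t) * z - of_real (?d t) * z)
      = ((complex_of_real (?a t) - of_real (?b t)) + \<i> * (complex_of_real (?c t) - of_real (?d t))) * z"
      by (simp only: ring_distribs mult.assoc)
    ultimately show ?thesis by (simp only:)
  qed
  have cint: "((LINT t|angle_measure. of_real (?a t) * f t) - (LINT t|angle_measure. of_real (?b t) * f t))
      + \<i> * ((LINT t|angle_measure. of_real (?c t) * f t) - (LINT t|angle_measure. of_real (?d t) * f t))
      = (LINT t|angle_measure. Q t * f t)"
    if f: "f \<in> borel_measurable borel" "\<And>t. norm (f t) \<le> 1" for f :: "real \<Rightarrow> complex"
  proof -
    have i: "integrable angle_measure (\<lambda>t. of_real (w t) * f t)"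
      if "w \<in> borel_measurable borel" "\<And>t. 0 \<le> w t" "\<And>t. w t \<le> 1" for w :: "real \<Rightarrow> real"
      using that f by (intro integrable_angle[where C=1]) (auto simp: norm_mult intro!: mult_le_one)
    note ia = i[OF wa] and ib = i[OF wb] and ic = i[OF wc] and id = i[OF wd]
    have "(LINT t|angle_measure. Q t * f t) =
      (LINT t|angle_measure. (of_real (?a t) * f t - of_real (?b t) * f t) + \<i> * (of_real (?c t) * f t - of_real (?d t) * f t))"
      by (simp only: split)
    also have "\<dots> = (LINT t|angle_measure. (of_real (?a t) * f t - of_real (?b t) * f t))
        + (LINT t|angle_measure. \<i> * (of_real (?c t) * f t - of_real (?d t) * f t))"
      by (intro Bochner_Integration.integral_add integrable_mult_right Bochner_Integration.integrable_diff ia ib ic id)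
    finally show ?thesis
      by (simp only: integral_mult_right_zero Bochner_Integration.integral_diff[OF ia ib] Bochner_Integration.integral_diff[OF ic id])
  qed
  have "\<mu> A = (LINT t|angle_measure. Q t * indicator A (cis t))" if A: "A \<in> sets circle_borel" for A
  proof -
    have "(indicator A :: complex \<Rightarrow> complex) \<in> borel_measurable circle_borel"
      using A by simp
    from measurable_compose[OF cis_measurable this]
    have im: "(\<lambda>t. indicator A (cis t) :: complex) \<in> borel_measurable borel" by simp
    have "complex_of_real (LINT t|angle_measure. w t * indicator A (cis t))
      = (LINT t|angle_measure. of_real (w t) * (indicator A (cis t) :: complex))" for w :: "real \<Rightarrow> real"
    proof -
      have "complex_of_real (w t * indicator A (cis t)) = of_real (w t) * indicator A (cis t)" for t
        by (simp add: indicator_def)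
      then show ?thesis by (simp only: integral_complex_of_real[symmetric])
    qed
    then show ?thesis
      unfolding \<mu>_def measure_circle_density[OF wa A] measure_circle_density[OF wb A]
        measure_circle_density[OF wc A] measure_circle_density[OF wd A] of_real_diff
      using cint[OF im] by (simp add: indicator_def)
  qed
  note \<mu>_eq = this
  have "\<mu> A = 0" if "A \<in> sets circle_borel" "A \<inter> E = {}" for A
  proof -
    have z: "Q t * indicator A (cis t) = 0" for t
      using E[of t] that(2) by (cases "cis t \<in> A") auto
    show ?thesis unfolding \<mu>_eq[OF that(1)] z by simp
  qed
  then have 1: "\<mu> \<in> circle_measures_on E" using cm by (simp add: circle_measures_on_def)
  have "fourier_coeff \<mu> n = fc Q n" for n
  proof -
    have "fourier_coeff \<mu> n = ((LINT z|circle_density ?a. z powi (- n)) - (LINT z|circle_density ?b. z powi (- n)))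
      + \<i> * ((LINT z|circle_density ?c. z powi (- n)) - (LINT z|circle_density ?d. z powi (- n)))"
      unfolding fourier_coeff_def
      by (rule complex_measure_integral_circle_eqI[OF cm sets fin _ circle_powi_continuous]) (simp add: \<mu>_def)
    also have "\<dots> = (LINT t|angle_measure. Q t * cis (of_int (- n) * t))"
      unfolding int[OF circle_borel_measurable[OF circle_powi_continuous]] cis_powi scaleR_conv_of_real
      by (rule cint[OF periodic_cont_measurable[OF periodic_cont_cis]]) simp
    finally show ?thesis by (simp only: fc_altdef)
  qed
  moreover have "\<mu> unit_circle = fc Q 0"
    using \<mu>_eq[of unit_circle] sets.top[of circle_borel] by (simp add: fc_def)
  ultimately show ?thesis using 1 that by blast
qed

section \<open>Choice of the stages\<close>

lemma rapid_fc_1: "rapid (fc (\<lambda>_. 1))"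
proof (rule rapidI)
  fix M
  have "fc (\<lambda>_. 1) n = (if n = 0 then 1 else 0)" for n
    using integral_cis[of "- n"] by (simp add: fc_altdef)
  then have "norm (fc (\<lambda>_. 1) n) * \<bar>real_of_int n\<bar> ^ M \<le> 1" for n
    by (simp add: power_0_left)
  then show "\<exists>C. \<forall>n. norm (fc (\<lambda>_. 1) n) * \<bar>real_of_int n\<bar> ^ M \<le> C" by blast
qed

text \<open>Chosen so that \<sigma> = 2^-(k+3) satisfies \<sigma>^2 = 2 \<kappa> in
  \<open>integral_factor_fun_close\<close>. With exp(-L/2) <= 2^-(k+3) stage k moves the product by
  at most 2^-(k+2) in mean, and these sum to 1/2.\<close>

definition stage_kappa :: "nat \<Rightarrow> real" where "stage_kappa k = ((1/2) ^ (k + 3))\<^sup>2 / 2"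

lemma stage_kappa_bounds: "0 < stage_kappa k" "stage_kappa k \<le> 1"
proof -
  have "((1/2::real) ^ (k + 3))\<^sup>2 \<le> 1" by (intro power_le_one) auto
  then show "stage_kappa k \<le> 1" by (simp add: stage_kappa_def)
qed (simp add: stage_kappa_def)

text \<open>The parameters of stage k depend on the partial product reached so far, so the sequence
  is built by dependent choice.\<close>

lemma product_sequence:
  fixes \<Omega> :: "nat \<Rightarrow> real"
  assumes \<Omega>: "\<And>C n0. \<exists>n\<ge>n0. C * ln (real n) \<le> \<Omega> n"
  obtains P M L where
    "P 0 = (\<lambda>_. 1)" "\<And>k. periodic_cont (P k)" "\<And>k. rapid (fc (P k))" "\<And>k t. norm (P k t) \<le> 1"
    "\<And>k. M k \<ge> 1" "\<And>k. M k \<ge> k" "\<And>k. L k \<ge> 1" "\<And>k. real k \<le> \<Omega> (M k) * (stage_kappa k / (32 * L k))"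
    "\<And>k. P (Suc k) = (\<lambda>t. P k t * factor_fun (stage_kappa k) (L k) (real (2 * M k) * t))"
    "\<And>k n. n \<ge> 1 \<Longrightarrow> norm (fc (P (Suc k)) n) * of_int n ^ k \<le> norm (fc (P k) n) * of_int n ^ k + 1 / 2 ^ k"
    "\<And>k. (LINT t|angle_measure. norm (P (Suc k) t - P k t)) \<le> (1/2) ^ (k + 2)"
proof -
  define good where "good k P \<longleftrightarrow> (k = 0 \<longrightarrow> P = (\<lambda>_. 1)) \<and> periodic_cont P \<and> rapid (fc P) \<and> (\<forall>t. norm (P t) \<le> 1)"
    for k :: nat and P :: "real \<Rightarrow> complex"
  define R where "R k P P' M L \<longleftrightarrow> M \<ge> 1 \<and> M \<ge> k \<and> L \<ge> 1 \<and> real k \<le> \<Omega> M * (stage_kappa k / (32 * L))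
    \<and> P' = (\<lambda>t. P t * factor_fun (stage_kappa k) L (real (2 * M) * t))
    \<and> (\<forall>n\<ge>1. norm (fc P' n) * of_int n ^ k \<le> norm (fc P n) * of_int n ^ k + 1 / 2 ^ k)
    \<and> (LINT t|angle_measure. norm (P' t - P t)) \<le> (1/2) ^ (k + 2)"
    for k P P' M L
  \<comment> \<open>Only the products are chosen recursively; M and L are existential in the
    relation and are extracted afterwards.\<close>
  have "\<exists>P. \<forall>k. good k (P k) \<and> (\<exists>M L. R k (P k) (P (Suc k)) M L)"
  proof (rule dependent_nat_choice)
    show "\<exists>P. good 0 P" using rapid_fc_1 periodic_cont_const by (auto simp: good_def)
    fix P k assume g: "good k P"
    then have P: "periodic_cont P" "rapid (fc P)" "\<And>t. norm (P t) \<le> 1" by (auto simp: good_def)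
    obtain M L where st: "M \<ge> 1" "M \<ge> k" "L \<ge> 1" "exp (- L / 2) \<le> (1/2) ^ (k + 3)" "real k \<le> \<Omega> M * (stage_kappa k / (32 * L))"
      "\<And>n. n \<ge> 1 \<Longrightarrow> norm (fc (\<lambda>t. P t * factor_fun (stage_kappa k) L (real (2 * M) * t)) n) * of_int n ^ k
        \<le> norm (fc P n) * of_int n ^ k + 1 / 2 ^ k"
      by (rule product_step[OF P(1,2) stage_kappa_bounds \<Omega>, of "(1/2) ^ (k + 3)"]) auto
    define P' where "P' = (\<lambda>t. P t * factor_fun (stage_kappa k) L (real (2 * M) * t))"
    let ?f = "factor_fun (stage_kappa k) L"
    note fp = periodic_cont_factor_fun[OF stage_kappa_bounds st(3), of k]
    have p': "periodic_cont P'" unfolding P'_def by (rule periodic_cont_mult[OF P(1) periodic_cont_scale[OF fp]])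
    have "fc P' = (\<lambda>n. \<Sum>\<^sub>\<infinity>m. fc ?f m * fc P (n - m * int (2 * M)))"
      unfolding P'_def
      by (rule ext, rule fc_mult_scale[OF P(1) fp rapid_abs_summable[OF rapid_factor_fun[OF stage_kappa_bounds st(3)]]])
    then have r': "rapid (fc P')"
      by (simp only: rapid_convolution[OF rapid_factor_fun[OF stage_kappa_bounds st(3)] P(2)])
    have n': "norm (P' t) \<le> 1" for t
      unfolding P'_def norm_mult using P(3) norm_factor_fun_le[OF stage_kappa_bounds st(3)] by (intro mult_le_one) auto
    have "(LINT t|angle_measure. norm (P' t - P t)) \<le> (LINT t|angle_measure. norm (1 - ?f (real (2 * M) * t)))"
    proof (rule integral_mono)
      show "integrable angle_measure (\<lambda>t. norm (P' t - P t))"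
        by (intro integrable_norm integrable_periodic_cont periodic_cont_diff p' P)
      show "integrable angle_measure (\<lambda>t. norm (1 - ?f (real (2 * M) * t)))"
        by (intro integrable_norm integrable_periodic_cont periodic_cont_diff periodic_cont_const periodic_cont_scale fp)
      fix t
      have "P' t - P t = - (P t * (1 - ?f (real (2 * M) * t)))" by (simp add: P'_def algebra_simps)
      then have "norm (P' t - P t) = norm (P t) * norm (1 - ?f (real (2 * M) * t))" by (simp only: norm_minus_cancel norm_mult)
      also have "\<dots> \<le> 1 * norm (1 - ?f (real (2 * M) * t))" by (intro mult_right_mono P) auto
      finally show "norm (P' t - P t) \<le> norm (1 - ?f (real (2 * M) * t))" by simp
    qed
    also have "\<dots> \<le> (1/2) ^ (k + 3) + exp (- L / 2)"
      by (rule integral_factor_fun_close[OF stage_kappa_bounds st(3)]) (use st(1) in \<open>auto simp: stage_kappa_def\<close>)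
    also have "\<dots> \<le> (1/2) ^ (k + 3) + (1/2) ^ (k + 3)" using st(4) by simp
    also have "\<dots> = (1/2::real) ^ (k + 2)" by (simp add: power_add power_divide)
    finally have d': "(LINT t|angle_measure. norm (P' t - P t)) \<le> (1/2) ^ (k + 2)" .
    have "good (Suc k) P'" using p' r' n' by (simp add: good_def)
    moreover have "R k P P' M L" unfolding R_def using st d' by (auto simp: P'_def)
    ultimately show "\<exists>P'. good (Suc k) P' \<and> (\<exists>M L. R k P P' M L)" by blast
  qed
  then obtain P where P: "\<And>k. good k (P k)" "\<forall>k. \<exists>M L. R k (P k) (P (Suc k)) M L" by blast
  then obtain M L where "\<And>k. R k (P k) (P (Suc k)) (M k) (L k)" by metis
  then have R: "M k \<ge> 1 \<and> M k \<ge> k \<and> L k \<ge> 1 \<and> real k \<le> \<Omega> (M k) * (stage_kappa k / (32 * L k))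
    \<and> P (Suc k) = (\<lambda>t. P k t * factor_fun (stage_kappa k) (L k) (real (2 * M k) * t))
    \<and> (\<forall>n\<ge>1. norm (fc (P (Suc k)) n) * of_int n ^ k \<le> norm (fc (P k) n) * of_int n ^ k + 1 / 2 ^ k)
    \<and> (LINT t|angle_measure. norm (P (Suc k) t - P k t)) \<le> (1/2) ^ (k + 2)" for k
    unfolding R_def by blast
  have G: "(k = 0 \<longrightarrow> P k = (\<lambda>_. 1)) \<and> periodic_cont (P k) \<and> rapid (fc (P k)) \<and> (\<forall>t. norm (P k t) \<le> 1)" for k
    using P(1)[of k] unfolding good_def .
  show ?thesis
    by (rule that[of P M L]) (use R G in blast)+
qed

text \<open>The partial products need not converge everywhere, but their increments are summable in mean.\<close>

lemma AE_limit_of_bounded_sequence: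
  fixes P :: "nat \<Rightarrow> real \<Rightarrow> complex"
  assumes P: "\<And>k. periodic_cont (P k)" "\<And>k t. norm (P k t) \<le> 1"
    and d: "\<And>k. (LINT t|angle_measure. norm (P (Suc k) t - P k t)) \<le> (1/2) ^ (k + 2)"
  obtains Q where "Q \<in> borel_measurable borel" "\<And>t. norm (Q t) \<le> 1"
    "\<And>t. \<forall>\<^sub>F k in sequentially. P k t = 0 \<Longrightarrow> Q t = 0"
    "\<And>n. (\<lambda>k. fc (P k) n) \<longlonglongrightarrow> fc Q n"
proof -
  have mP: "P k \<in> borel_measurable borel" for k by (rule periodic_cont_measurable[OF P(1)])
  define q where "q t = lim (\<lambda>k. P k t)" for t
  \<comment> \<open>Where the products diverge, \<open>lim\<close> is an unspecified value; the
    truncation makes the bound 1 hold everywhere, and Q is still exactly 0 wherever the products are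
    eventually 0.\<close>
  define Q where "Q t = (if norm (q t) \<le> 1 then q t else 0)" for t
  have mq: "q \<in> borel_measurable borel" unfolding q_def[abs_def] using mP by (intro borel_measurable_lim_metric)
  have mQ: "Q \<in> borel_measurable borel" unfolding Q_def[abs_def] using mq by measurable
  have Q1: "norm (Q t) \<le> 1" for t by (simp add: Q_def)
  have Q0: "Q t = 0" if "\<forall>\<^sub>F k in sequentially. P k t = 0" for t
  proof -
    have "(\<lambda>k. P k t) \<longlonglongrightarrow> 0" using that by (rule tendsto_eventually)
    then have "q t = 0" unfolding q_def by (rule limI)
    then show ?thesis by (simp add: Q_def)
  qed
  have AEs: "AE t in angle_measure. (\<lambda>k. P k t) \<longlonglongrightarrow> Q t"
  proof -
    let ?d = "\<lambda>k t. norm (P (Suc k) t - P k t)"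
    have di: "integrable angle_measure (?d k)" for k
      by (intro integrable_norm integrable_periodic_cont periodic_cont_diff P)
    have md: "(\<lambda>t. ennreal (?d k t)) \<in> borel_measurable angle_measure" for k
      using mP[of k] mP[of "Suc k"] by measurable
    have "(\<integral>\<^sup>+t. (\<Sum>k. ennreal (?d k t)) \<partial>angle_measure) = (\<Sum>k. \<integral>\<^sup>+t. ennreal (?d k t) \<partial>angle_measure)"
      by (rule nn_integral_suminf[OF md])
    also have "\<dots> = (\<Sum>k. ennreal (LINT t|angle_measure. ?d k t))"
      by (simp add: nn_integral_eq_integral[OF di])
    also have "\<dots> \<le> (\<Sum>k. ennreal ((1/2) ^ (k + 2)))"
      by (intro suminf_le ennreal_leI d summableI)
    also have "\<dots> = ennreal (\<Sum>k. (1/2) ^ (k + 2))"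
      by (rule suminf_ennreal2) (auto simp: power_add summable_geometric intro!: summable_mult2)
    also have "\<dots> < \<infinity>" by simp
    finally have "AE t in angle_measure. (\<Sum>k. ennreal (?d k t)) \<noteq> \<infinity>"
      using md by (intro nn_integral_PInf_AE) auto
    then show ?thesis
    proof eventually_elim
      case (elim t)
      then have "summable (\<lambda>k. ?d k t)" by (intro summable_suminf_not_top) auto
      then have "summable (\<lambda>k. P (Suc k) t - P k t)" by (rule summable_norm_cancel)
      then have "(\<lambda>n. \<Sum>k<n. P (Suc k) t - P k t) \<longlonglongrightarrow> (\<Sum>k. P (Suc k) t - P k t)" by (rule summable_LIMSEQ)
      then have "(\<lambda>n. P n t - P 0 t) \<longlonglongrightarrow> (\<Sum>k. P (Suc k) t - P k t)" by (simp only: sum_lessThan_telescope[of "\<lambda>k. P k t"])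
      from tendsto_add[OF this tendsto_const[of "P 0 t"]]
      have c: "(\<lambda>n. P n t) \<longlonglongrightarrow> (\<Sum>k. P (Suc k) t - P k t) + P 0 t" by simp
      then have "q t = (\<Sum>k. P (Suc k) t - P k t) + P 0 t" unfolding q_def by (rule limI)
      then have cq: "(\<lambda>n. P n t) \<longlonglongrightarrow> q t" using c by simp
      have "norm (q t) \<le> 1" by (rule Lim_norm_ubound[OF _ cq]) (auto simp: P(2))
      then show ?case using cq by (simp add: Q_def)
    qed
  qed
  have "(\<lambda>k. fc (P k) n) \<longlonglongrightarrow> fc Q n" for n
    unfolding fc_def
  proof (rule integral_dominated_convergence[where w="\<lambda>_. 1"])
    have mc: "(\<lambda>t. cis (- (of_int n * t))) \<in> borel_measurable borel"
      by (intro borel_measurable_continuous_onI continuous_intros)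
    show "(\<lambda>t. Q t * cis (- (of_int n * t))) \<in> borel_measurable angle_measure"
      using mQ mc by (intro measurable_angle borel_measurable_times)
    show "(\<lambda>t. P k t * cis (- (of_int n * t))) \<in> borel_measurable angle_measure" for k
      using mP mc by (intro measurable_angle borel_measurable_times)
    show "integrable angle_measure (\<lambda>_. 1::real)" by (rule finite_measure.integrable_const[OF finite_measure_angle])
    show "AE t in angle_measure. norm (P k t * cis (- (of_int n * t))) \<le> 1" for k
      by (rule AE_I2) (simp add: norm_mult P(2))
    show "AE t in angle_measure. (\<lambda>k. P k t * cis (- (of_int n * t))) \<longlonglongrightarrow> Q t * cis (- (of_int n * t))"
      using AEs by eventually_elim (intro tendsto_intros)
  qed
  then show ?thesis using that[of Q] mQ Q1 Q0 by blast
qed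

section \<open>Assembly of the set and the measure\<close>

theorem theorem2p6:
  fixes \<Omega> :: "nat \<Rightarrow> real"
  assumes "\<And>n. 0 < \<Omega> n"
    and "mono \<Omega>"
    and "filterlim \<Omega> at_top sequentially"
    and "(SUP n\<in>{1<..}. ereal (\<Omega> n / ln (real n))) = \<infinity>"
  shows "\<exists>E \<subseteq> unit_circle. compact E \<and> 0 < emeasure circle_lebesgue E \<and>
     (\<forall>\<mu>\<in>circle_measures_on E. nontrivial_circle_measure \<mu> \<longrightarrow>
        (\<Sum>\<^sub>\<infinity>n::int. ennreal ((cmod (fourier_coeff \<mu> n))\<^sup>2 * \<Omega> (nat \<bar>n\<bar>))) = \<infinity>) \<and>
     (\<exists>\<mu>\<in>circle_measures_on E. nontrivial_circle_measure \<mu> \<and>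
        (\<forall>M::real. M > 0 \<longrightarrow>
           (\<lambda>n::nat. cmod (fourier_coeff \<mu> (int n))) \<in> O(\<lambda>n. real n powr (- M))))"
proof -
  obtain P M L where P0: "P 0 = (\<lambda>_. 1)" and P: "\<And>k. periodic_cont (P k)" "\<And>k. rapid (fc (P k))" "\<And>k t. norm (P k t) \<le> 1"
    and M: "\<And>k. M k \<ge> 1" "\<And>k. M k \<ge> k" and L: "\<And>k. L k \<ge> 1" and \<Omega>M: "\<And>k. real k \<le> \<Omega> (M k) * (stage_kappa k / (32 * L k))"
    and PS: "\<And>k. P (Suc k) = (\<lambda>t. P k t * factor_fun (stage_kappa k) (L k) (real (2 * M k) * t))"
    and dec: "\<And>k n. n \<ge> 1 \<Longrightarrow> norm (fc (P (Suc k)) n) * of_int n ^ k \<le> norm (fc (P k) n) * of_int n ^ k + 1 / 2 ^ k"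
    and d: "\<And>k. (LINT t|angle_measure. norm (P (Suc k) t - P k t)) \<le> (1/2) ^ (k + 2)"
    by (rule product_sequence[OF growth_unbounded[OF assms(4)]], (rule that; (assumption | blast)))
  obtain Q where Q: "Q \<in> borel_measurable borel" "\<And>t. norm (Q t) \<le> 1"
    "\<And>t. \<forall>\<^sub>F k in sequentially. P k t = 0 \<Longrightarrow> Q t = 0"
    "\<And>n. (\<lambda>k. fc (P k) n) \<longlonglongrightarrow> fc Q n"
    by (rule AE_limit_of_bounded_sequence[OF P(1,3) d], (rule that; (assumption | blast)))
  \<comment> \<open>The condition \<open>gap_coord\<close> <= 1 at 2 M t, written through Re
    (z^(2M)) so that it is visibly closed in z. Off E some factor is exactly 0.\<close>
  define E where "E = unit_circle \<inter> (\<Inter>k. {z. 8 * (L k / stage_kappa k)\<^sup>2 * (Re (z ^ (2 * M k)) - 1) + 2 \<le> 1})"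
  have "closed {z. 8 * (L k / stage_kappa k)\<^sup>2 * (Re (z ^ (2 * M k)) - 1) + 2 \<le> 1}" for k
    by (intro closed_Collect_le continuous_intros)
  then have "compact E" unfolding E_def by (intro compact_Int_closed closed_INT) auto
  then have Ecl: "closed E" by (rule compact_imp_closed)
  have Re_cis: "Re (cis t ^ N) = cos (real N * t)" for t N
    unfolding Complex.DeMoivre by simp
  have gap: "gap_coord (stage_kappa k) (L k) (real (2 * M k) * t) \<le> 1" if "cis t \<in> E" for k t
    using that unfolding E_def Re_cis gap_coord_def by (auto simp: Re_cis)
  have Q0: "Q t = 0" if "cis t \<notin> E" for t
  proof (rule Q(3))
    obtain k where "\<not> 8 * (L k / stage_kappa k)\<^sup>2 * (Re (cis t ^ (2 * M k)) - 1) + 2 \<le> 1"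
      using \<open>cis t \<notin> E\<close> unfolding E_def by auto
    then have "factor_fun (stage_kappa k) (L k) (real (2 * M k) * t) = 0"
      unfolding Re_cis by (intro factor_fun_eq_0[OF stage_kappa_bounds L]) (simp add: gap_coord_def)
    then have z: "P (Suc k) t = 0" by (simp add: PS)
    \<comment> \<open>A zero of one factor persists in all later products.\<close>
    have "P (j + Suc k) t = 0" for j
      by (induction j) (use z PS in auto)
    then have "P i t = 0" if "i \<ge> Suc k" for i using that by (metis le_add_diff_inverse2)
    then show "\<forall>\<^sub>F k in sequentially. P k t = 0" unfolding eventually_sequentially by blast
  qed
  obtain \<mu> where \<mu>: "\<mu> \<in> circle_measures_on E" "\<And>n. fourier_coeff \<mu> n = fc Q n" "\<mu> unit_circle = fc Q 0"
    by (rule bounded_density_measure[OF Q(1,2), of E], erule Q0, (rule that; (assumption | blast)))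
  have fcQ: "fc Q 0 \<noteq> 0"
  proof -
    \<comment> \<open>The right-hand side is the sum of 2^-(i+2) over i < k.\<close>
    have diff: "norm (fc (P k) 0 - 1) \<le> 1/2 - (1/2) ^ (k + 1)" for k
    proof (induction k)
      case 0
      show ?case using integral_cis[of 0] by (simp add: P0 fc_def)
    next
      case (Suc k)
      have "fc (P (Suc k)) 0 - fc (P k) 0 = (LINT t|angle_measure. P (Suc k) t - P k t)"
        by (simp add: fc_def integrable_periodic_cont[OF P(1)])
      then have "norm (fc (P (Suc k)) 0 - fc (P k) 0) \<le> (LINT t|angle_measure. norm (P (Suc k) t - P k t))"
        by (simp only: integral_norm_bound)
      also have "\<dots> \<le> (1/2) ^ (k + 2)" by (rule d)
      finally have "norm (fc (P (Suc k)) 0 - 1) \<le> (1/2) ^ (k + 2) + (1/2 - (1/2) ^ (k + 1))"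
        using Suc norm_triangle_ineq[of "fc (P (Suc k)) 0 - fc (P k) 0" "fc (P k) 0 - 1"] by simp
      also have "\<dots> = 1/2 - (1/2) ^ (Suc k + 1)" by simp
      finally show ?case .
    qed
    have "norm (fc (P k) 0 - 1) \<le> 1/2" for k
      by (rule order_trans[OF diff]) simp
    moreover have "(\<lambda>k. fc (P k) 0 - 1) \<longlonglongrightarrow> fc Q 0 - 1" by (intro tendsto_intros Q(4))
    ultimately have "norm (fc Q 0 - 1) \<le> 1/2"
      by (intro Lim_norm_ubound[of sequentially "\<lambda>k. fc (P k) 0 - 1"]) auto
    then show ?thesis by auto
  qed
  \<comment> \<open>The limit density vanishes off E and has nonzero mean, which is impossible if E
    is a null set.\<close>
  have Epos: "0 < emeasure circle_lebesgue E"
  proof (rule ccontr)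
    assume "\<not> ?thesis"
    then have "emeasure circle_lebesgue E = 0" by (simp add: zero_less_iff_neq_zero)
    moreover have Es: "E \<in> sets circle_borel"
      unfolding circle_borel_def using Ecl by (subst sets_restrict_space_iff) (auto simp: E_def)
    ultimately have z: "emeasure angle_measure (cis -` E \<inter> space angle_measure) = 0"
      unfolding circle_lebesgue_def by (simp only: emeasure_distr[OF cis_measurable Es])
    have "cis -` E \<inter> space angle_measure \<in> null_sets angle_measure"
      using z measurable_sets[OF cis_measurable Es] by (intro null_setsI)
    then have "AE t in angle_measure. Q t * cis (- (of_int 0 * t)) = 0"
      by (rule AE_I') (use Q0 in auto)
    then have "fc Q 0 = 0" unfolding fc_def by (rule integral_eq_zero_AE)
    then show False using fcQ by simp
  qed
  have decay: "\<exists>C. \<forall>n\<ge>1. norm (fc Q n) * of_int n ^ m \<le> C" for m :: nat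
  proof -
    \<comment> \<open>The stage estimate controls the weight n^m only from stage m on; before that,
      \<open>P m\<close> is rapidly decreasing by itself.\<close>
    obtain C where C: "\<And>n. norm (fc (P m) n) * (1 + \<bar>real_of_int n\<bar>) ^ m \<le> C" using rapidD[OF P(2)] by metis
    have "norm (fc Q n) * of_int n ^ m \<le> C + 2" if n: "n \<ge> 1" for n
    proof -
      have n1: "1 \<le> real_of_int n" using n by simp
      \<comment> \<open>2 - 2/2^i is the sum of 2^-l over l < i, the total error of the stages m,
        ..., m + i - 1.\<close>
      have "norm (fc (P (m + i)) n) * of_int n ^ m \<le> C + (2 - 2 / 2 ^ i)" for i
      proof (induction i)
        case 0
        have "norm (fc (P m) n) * of_int n ^ m \<le> norm (fc (P m) n) * (1 + \<bar>real_of_int n\<bar>) ^ m"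
          using n1 by (intro mult_left_mono power_mono) auto
        then show ?case using C[of n] by simp
      next
        case (Suc i)
        have p: "0 < real_of_int n ^ i" "1 \<le> real_of_int n ^ i" using n1 by (auto simp: one_le_power)
        have "norm (fc (P (Suc (m + i))) n) * of_int n ^ (m + i) \<le> norm (fc (P (m + i)) n) * of_int n ^ (m + i) + 1 / 2 ^ (m + i)"
          by (rule dec[OF n])
        \<comment> \<open>Stage m + i carries the weight n^(m+i); the error is multiplied by the
          surplus n^i >= 1 so that this power can be cancelled.\<close>
        also have "1 / 2 ^ (m + i) \<le> (1 / 2 ^ i) * real_of_int n ^ i"
        proof -
          have "1 / 2 ^ (m + i) \<le> (1 / 2 ^ i :: real)" by (intro divide_left_mono power_increasing) auto
          also have "(1 / 2 ^ i :: real) * 1 \<le> (1 / 2 ^ i) * real_of_int n ^ i" using p by (intro mult_left_mono) auto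
          finally show ?thesis by simp
        qed
        finally have "(norm (fc (P (Suc (m + i))) n) * of_int n ^ m) * of_int n ^ i
            \<le> (norm (fc (P (m + i)) n) * of_int n ^ m + 1 / 2 ^ i) * real_of_int n ^ i"
          by (simp add: power_add distrib_right mult.assoc)
        then have "norm (fc (P (Suc (m + i))) n) * of_int n ^ m \<le> norm (fc (P (m + i)) n) * of_int n ^ m + 1 / 2 ^ i"
          using p by (simp add: mult_le_cancel_right_pos)
        also have "\<dots> \<le> C + (2 - 2 / 2 ^ i) + 1 / 2 ^ i" using Suc by simp
        also have "\<dots> = C + (2 - 2 / 2 ^ Suc i)" by simp
        finally show ?case by simp
      qed
      note bound = this
      have b: "norm (fc (P (i + m)) n * of_real (of_int n ^ m)) \<le> C + 2" for i
      proof -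
        have "norm (fc (P (i + m)) n * of_real (of_int n ^ m)) = norm (fc (P (m + i)) n) * of_int n ^ m"
          using n1 by (simp add: norm_mult norm_power add.commute)
        also have "\<dots> \<le> C + (2 - 2 / 2 ^ i)" by (rule bound)
        also have "\<dots> \<le> C + 2" by simp
        finally show ?thesis .
      qed
      have "(\<lambda>i. fc (P (i + m)) n * of_real (of_int n ^ m)) \<longlonglongrightarrow> fc Q n * of_real (of_int n ^ m)"
        by (intro tendsto_intros LIMSEQ_ignore_initial_segment Q(4))
      then have "norm (fc Q n * of_real (of_int n ^ m)) \<le> C + 2"
        by (rule Lim_norm_ubound[rotated]) (use b in auto)
      then show ?thesis using n1 by (simp add: norm_mult norm_power)
    qed
    then show ?thesis by blast
  qed
  have bigo: "(\<lambda>n::nat. cmod (fourier_coeff \<mu> (int n))) \<in> O(\<lambda>n. real n powr (- r))" if "r > 0" for r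
  proof -
    define m where "m = nat \<lceil>r\<rceil>"
    have m: "r \<le> real m" unfolding m_def by linarith
    obtain C where C: "\<And>n. n \<ge> 1 \<Longrightarrow> norm (fc Q n) * of_int n ^ m \<le> C" using decay by blast
    have C0: "0 \<le> C" using order_trans[OF _ C[of 1]] by simp
    have "norm (cmod (fourier_coeff \<mu> (int n))) \<le> C * norm (real n powr (- r))" if n: "n \<ge> 1" for n :: nat
    proof -
      have n1: "1 \<le> real n" using n by simp
      have "norm (fc Q (int n)) \<le> C / real n ^ m"
        using C[of "int n"] n by (simp add: pos_le_divide_eq)
      also have "\<dots> = C * real n powr (- real m)" using n1 by (simp add: powr_minus powr_realpow divide_inverse)
      also have "\<dots> \<le> C * real n powr (- r)" using n1 m C0 by (intro mult_left_mono powr_mono) auto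
      finally show ?thesis by (simp add: \<mu>(2))
    qed
    then show ?thesis
      by (intro bigoI[of _ C] eventually_mono[OF eventually_ge_at_top[of 1]])
  qed
  have infinite: "(\<Sum>\<^sub>\<infinity>n::int. ennreal ((cmod (fourier_coeff \<mu> n))\<^sup>2 * \<Omega> (nat \<bar>n\<bar>))) = \<infinity>"
    if \<mu>: "\<mu> \<in> circle_measures_on E" "nontrivial_circle_measure \<mu>" for \<mu>
  proof (rule ccontr)
    let ?x = "\<lambda>n. (cmod (fourier_coeff \<mu> n))\<^sup>2 * \<Omega> (nat \<bar>n\<bar>)"
    assume "\<not> ?thesis"
    then obtain S where S: "(\<Sum>\<^sub>\<infinity>n::int. ennreal (?x n)) = ennreal S" "S \<ge> 0"
      by (cases "\<Sum>\<^sub>\<infinity>n::int. ennreal (?x n)") auto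
    have x0: "0 \<le> ?x n" for n using assms(1) by (simp add: less_imp_le)
    have fin: "(\<Sum>n\<in>F. ?x n) \<le> S" if "finite F" for F
    proof -
      have "(\<Sum>n\<in>F. ennreal (?x n)) \<le> (\<Sum>\<^sub>\<infinity>n. ennreal (?x n))"
        using that by (subst nonneg_infsum_complete) (auto intro!: SUP_upper)
      then show ?thesis using S x0 by (simp add: sum_ennreal)
    qed
    have "fourier_coeff \<mu> j = 0" for j
    proof (rule ccontr)
      assume j: "fourier_coeff \<mu> j \<noteq> 0"
      obtain k0 where k0: "S < real k0 * (cmod (fourier_coeff \<mu> j))\<^sup>2"
        using reals_Archimedean3[of "(cmod (fourier_coeff \<mu> j))\<^sup>2"] j by auto
      \<comment> \<open>k >= k0 contradicts the choice of k0 once |\<mu>^(j)|^2 k <= S is known, and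
        k >= |j| puts j within the range |j| <= M k of the gap estimate.\<close>
      define k where "k = max k0 (nat \<bar>j\<bar>)"
      have "\<bar>j\<bar> \<le> int (M k)" using M(2)[of k] unfolding k_def by linarith
      then have "(cmod (fourier_coeff \<mu> j))\<^sup>2 * (\<Omega> (M k) * (stage_kappa k / (32 * L k))) \<le> S"
        by (intro fourier_coeff_gap_bound[OF \<mu>(1) Ecl stage_kappa_bounds L M(1) gap assms(2,1) fin])
      moreover have "(cmod (fourier_coeff \<mu> j))\<^sup>2 * real k0 \<le> (cmod (fourier_coeff \<mu> j))\<^sup>2 * (\<Omega> (M k) * (stage_kappa k / (32 * L k)))"
      proof (intro mult_left_mono order_trans[OF _ \<Omega>M[of k]])
        show "real k0 \<le> real k" by (simp add: k_def)
      qed simp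
      ultimately show False using k0 by (simp add: mult.commute)
    qed
    then have "\<not> nontrivial_circle_measure \<mu>"
      using \<mu>(1) by (intro fourier_coeffs_0_imp_trivial) (auto simp: circle_measures_on_def)
    then show False using \<mu>(2) by simp
  qed
  have "unit_circle \<in> sets circle_borel" using sets.top[of circle_borel] by simp
  moreover have "\<mu> unit_circle \<noteq> 0" unfolding \<mu>(3) by (rule fcQ)
  ultimately have "nontrivial_circle_measure \<mu>" unfolding nontrivial_circle_measure_def by blast
  moreover have "E \<subseteq> unit_circle" by (auto simp: E_def)
  ultimately show ?thesis using \<open>compact E\<close> Epos infinite bigo \<mu>(1) by blast
qed

end
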